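(* For every planar hyperbola $\mathcal H\subset\mathbb{R}^3$, there exists a nondegenerate $\mathbb{Z}_2$ harmonic function defined in a neighbourhood of $\mathcal H$ in $\mathbb{R}^3$ whose branching set is $\mathcal H$.
   Context: A planar hyperbola in $\mathbb{R}^3$ is (both branches of) a nondegenerate hyperbola lying in an affine plane of $\mathbb{R}^3$; up to Euclidean motion it is $\{x_1^2/h_1^2-x_3^2/h_3^2=1,\ x_2=0\}$ with $h_1,h_3>0$. $\mathbb{Z}_2$ harmonic functions. Let $(M,g)$ be a Riemannian $n$-manifold (here an open subset of $\mathbb{R}^3$ with the Euclidean metric) and $\Sigma\subset M$ a closed oriented (and co-oriented) codimension-two submanifold. Let $\mathcal I$ be a flat real line bundle over $M\setminus\Sigma$ with structure group $\{\pm1\}$ whose monodromy around every sufficiently small loop linking $\Sigma$ is $-1$. A $\mathbb{Z}_2$ harmonic function with branching set $\Sigma$ is a smooth section $f$ of $\mathcal I$ over $M\setminus\Sigma$ with $|f|,|\nabla f|\in L^2_{\mathrm{loc}}(M)$ and $\Delta_g f=0$ on $M\setminus\Sigma$. The normal bundle $N_\Sigma$ is made into a complex line bundle by the co-orientation and the metric, and $\zeta$ denotes the inverse of the normal exponential map on a tubular neighbourhood of $\Sigma$. Near $\Sigma$ such an $f$ has an expansion $$f=\operatorname{Re}(A\zeta^{1/2}+B\zeta^{3/2})-\tfrac12\operatorname{Re}(\overline{\mu}\zeta)\operatorname{Re}(A\zeta^{1/2})+O(|\zeta|^{5/2}),$$ with $A\in\Gamma(\Sigma,N_\Sigma^{-1/2})$,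 $B\in\Gamma(\Sigma,N_\Sigma^{-3/2})$ and $\mu\in\Gamma(\Sigma,N_\Sigma)$ the mean curvature vector of $\Sigma$. $f$ is critical if $A\equiv0$, and nondegenerate if it is critical and $B$ is nowhere vanishing on $\Sigma$. *)

theory Defs
  imports "HOL-Analysis.Analysis" "HOL-Complex_Analysis.Winding_Numbers"
begin

section \<open>Smooth functions\<close>

text \<open>\<open>Ck_on k W f\<close>, meant for open \<open>W\<close>: all partial derivatives of order at most \<open>k\<close>
  exist and are continuous.\<close>

primrec Ck_on ::
    "nat \<Rightarrow> 'a::euclidean_space set \<Rightarrow> ('a \<Rightarrow> 'b::real_normed_vector) \<Rightarrow> bool" where
  "Ck_on 0 W f = continuous_on W f"
| "Ck_on (Suc k) W f =
    ((\<forall>x\<in>W. f differentiable (at x)) \<and>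
     (\<forall>v. Ck_on k W (\<lambda>x. frechet_derivative f (at x) v)))"

text \<open>For open \<open>S\<close> this is ordinary smoothness; for an embedded submanifold \<open>S\<close> it is
  smoothness as a function on the submanifold.\<close>

definition smooth_on :: "'a::euclidean_space set \<Rightarrow> ('a \<Rightarrow> 'b::real_normed_vector) \<Rightarrow> bool" where
  "smooth_on S f \<longleftrightarrow>
    (\<forall>x\<in>S. \<exists>W F. open W \<and> x \<in> W \<and> (\<forall>k. Ck_on k W F) \<and> (\<forall>y\<in>S \<inter> W. F y = f y))"

definition gradient :: "(real^3 \<Rightarrow> real) \<Rightarrow> real^3 \<Rightarrow> real^3" where
  "gradient f x = (\<Sum>b\<in>Basis. frechet_derivative f (at x) b *\<^sub>R b)"

definition laplacian :: "(real^3 \<Rightarrow> real) \<Rightarrow> real^3 \<Rightarrow> real" where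
  "laplacian f x =
    (\<Sum>b\<in>Basis. frechet_derivative (\<lambda>y. frechet_derivative f (at y) b) (at x) b)"


section \<open>Planar hyperbolas\<close>

definition standard_hyperbola :: "real \<Rightarrow> real \<Rightarrow> (real^3) set" where
  "standard_hyperbola h1 h3 = {x. (x$1)\<^sup>2 / h1\<^sup>2 - (x$3)\<^sup>2 / h3\<^sup>2 = 1 \<and> x$2 = 0}"

definition planar_hyperbola :: "(real^3) set \<Rightarrow> bool" where
  "planar_hyperbola H \<longleftrightarrow>
    (\<exists>h1 h3 p \<phi>. h1 > 0 \<and> h3 > 0 \<and> orthogonal_transformation \<phi> \<and>
      H = (\<lambda>x. p + \<phi> x) ` standard_hyperbola h1 h3)"


section \<open>Oriented curves in space\<close>

text \<open>A regular parametrization \<open>c\<close> of the relatively open piece \<open>\<Sigma> \<inter> W\<close>, compatible with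
  the unit tangent field \<open>\<tau>\<close>. Here \<open>sgn v = v /\<^sub>R norm v\<close>.\<close>

definition oriented_chart ::
    "(real^3) set \<Rightarrow> (real^3 \<Rightarrow> real^3) \<Rightarrow> real set \<Rightarrow> (real^3) set \<Rightarrow> (real \<Rightarrow> real^3) \<Rightarrow> bool" where
  "oriented_chart \<Sigma> \<tau> J W c \<longleftrightarrow>
    open J \<and> open W \<and> smooth_on J c \<and> (\<exists>k. homeomorphism J (\<Sigma> \<inter> W) c k) \<and>
    (\<forall>t\<in>J. vector_derivative c (at t) \<noteq> 0 \<and> \<tau> (c t) = sgn (vector_derivative c (at t)))"

text \<open>\<open>\<Sigma>\<close> is a smooth embedded one-dimensional submanifold and the unit tangent field \<open>\<tau>\<close> is
  its orientation. The co-orientation is the one induced from the standard orientation of space: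
  for a unit normal \<open>n\<close> at \<open>p\<close>, the basis \<open>n, cross3 (\<tau> p) n\<close> of the normal plane is positive.\<close>

definition oriented_curve :: "(real^3) set \<Rightarrow> (real^3 \<Rightarrow> real^3) \<Rightarrow> bool" where
  "oriented_curve \<Sigma> \<tau> \<longleftrightarrow> (\<forall>p\<in>\<Sigma>. \<exists>J W c. oriented_chart \<Sigma> \<tau> J W c \<and> p \<in> W)"

text \<open>The derivative of \<open>\<tau>\<close> by arc length is the curvature vector. The sign is the one for which
  the term \<open>- 1/2 Re (cnj \<mu> \<zeta>) Re (A \<zeta>\<^sup>1\<^sup>/\<^sup>2)\<close> in the expansion below is correct for harmonic
  functions: \<open>\<mu>\<close> is the gradient of arc length (it points away from the centre of curvature).\<close>

definition mean_curvature_vector ::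
    "(real^3) set \<Rightarrow> (real^3 \<Rightarrow> real^3) \<Rightarrow> real^3 \<Rightarrow> real^3" where
  "mean_curvature_vector \<Sigma> \<tau> p =
    (SOME \<mu>. \<exists>J W c t. oriented_chart \<Sigma> \<tau> J W c \<and> t \<in> J \<and> c t = p \<and>
       \<mu> = - (vector_derivative (\<tau> \<circ> c) (at t) /\<^sub>R norm (vector_derivative c (at t))))"


section \<open>The normal bundle and the normal exponential map\<close>

text \<open>A complex line bundle over a one-dimensional manifold is trivial, so the normal bundle has a
  global unitary frame \<open>e\<close>; it identifies the normal plane at \<open>p\<close> with \<open>\<complex>\<close>, multiplication by
  \<open>\<i>\<close> being \<open>cross3 (\<tau> p)\<close>.\<close>

definition normal_frame ::
    "(real^3) set \<Rightarrow> (real^3 \<Rightarrow> real^3) \<Rightarrow> (real^3 \<Rightarrow> real^3) \<Rightarrow> bool" where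
  "normal_frame \<Sigma> \<tau> e \<longleftrightarrow>
    smooth_on \<Sigma> e \<and> (\<forall>p\<in>\<Sigma>. norm (e p) = 1 \<and> e p \<bullet> \<tau> p = 0)"

definition frame_vector ::
    "(real^3 \<Rightarrow> real^3) \<Rightarrow> (real^3 \<Rightarrow> real^3) \<Rightarrow> real^3 \<Rightarrow> complex \<Rightarrow> real^3" where
  "frame_vector \<tau> e p w = Re w *\<^sub>R e p + Im w *\<^sub>R cross3 (\<tau> p) (e p)"

definition frame_coordinate ::
    "(real^3 \<Rightarrow> real^3) \<Rightarrow> (real^3 \<Rightarrow> real^3) \<Rightarrow> real^3 \<Rightarrow> real^3 \<Rightarrow> complex" where
  "frame_coordinate \<tau> e p v = Complex (v \<bullet> e p) (v \<bullet> cross3 (\<tau> p) (e p))"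

definition normal_exp ::
    "(real^3 \<Rightarrow> real^3) \<Rightarrow> (real^3 \<Rightarrow> real^3) \<Rightarrow> real^3 \<Rightarrow> complex \<Rightarrow> real^3" where
  "normal_exp \<tau> e p w = p + frame_vector \<tau> e p w"

text \<open>On the tubular neighbourhood \<open>T \<subseteq> U\<close> of \<open>\<Sigma>\<close>, the inverse \<open>\<zeta>\<close> of the normal exponential map
  is split into its base point \<open>\<pi> x\<close> and its complex fibre coordinate \<open>z x\<close>. A smooth right
  inverse which extends the zero section is injective, hence the inverse of the normal exponential
  map on its image, an open neighbourhood of the zero section.\<close>

definition tubular_neighbourhood ::
    "(real^3) set \<Rightarrow> (real^3) set \<Rightarrow> (real^3 \<Rightarrow> real^3) \<Rightarrow> (real^3 \<Rightarrow> real^3) \<Rightarrow>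
     (real^3) set \<Rightarrow> (real^3 \<Rightarrow> real^3) \<Rightarrow> (real^3 \<Rightarrow> complex) \<Rightarrow> bool" where
  "tubular_neighbourhood U \<Sigma> \<tau> e T \<pi> z \<longleftrightarrow>
    normal_frame \<Sigma> \<tau> e \<and> open T \<and> \<Sigma> \<subseteq> T \<and> T \<subseteq> U \<and>
    smooth_on T \<pi> \<and> smooth_on T z \<and>
    (\<forall>x\<in>T. \<pi> x \<in> \<Sigma> \<and> normal_exp \<tau> e (\<pi> x) (z x) = x) \<and>
    (\<forall>p\<in>\<Sigma>. \<pi> p = p \<and> z p = 0)"


section \<open>Flat real line bundles with structure group \<open>{\<plusminus>1}\<close>\<close>

text \<open>The bundle over \<open>X\<close> is given by an open cover \<open>V\<close> and locally constant transition functions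
  \<open>g\<close>. A section \<open>f\<close> is the family of its local representatives \<open>f i\<close> on \<open>V i\<close>.\<close>

definition flat_Z2_bundle ::
    "(real^3) set \<Rightarrow> ('i \<Rightarrow> (real^3) set) \<Rightarrow> ('i \<Rightarrow> 'i \<Rightarrow> real^3 \<Rightarrow> real) \<Rightarrow> bool" where
  "flat_Z2_bundle X V g \<longleftrightarrow>
    (\<forall>i. open (V i)) \<and> (\<Union>i. V i) = X \<and>
    (\<forall>i j. continuous_on (V i \<inter> V j) (g i j) \<and> (\<forall>x\<in>V i \<inter> V j. g i j x \<in> {1, -1})) \<and>
    (\<forall>i j k. \<forall>x\<in>V i \<inter> V j \<inter> V k. g i j x * g j k x = g i k x)"

definition bundle_section ::
    "('i \<Rightarrow> (real^3) set) \<Rightarrow> ('i \<Rightarrow> 'i \<Rightarrow> real^3 \<Rightarrow> real) \<Rightarrow>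
     ('i \<Rightarrow> real^3 \<Rightarrow> 'b::real_vector) \<Rightarrow> bool" where
  "bundle_section V g f \<longleftrightarrow> (\<forall>i j. \<forall>x\<in>V i \<inter> V j. f i x = g i j x *\<^sub>R f j x)"

text \<open>The pointwise norm of a section (with values in the bundle tensored with \<open>'b\<close>) does not
  depend on the chosen trivialization.\<close>

definition section_norm ::
    "('i \<Rightarrow> (real^3) set) \<Rightarrow> ('i \<Rightarrow> real^3 \<Rightarrow> 'b::real_normed_vector) \<Rightarrow> real^3 \<Rightarrow> real" where
  "section_norm V f x = norm (f (SOME i. x \<in> V i) x)"

text \<open>The monodromy around the loop \<open>\<gamma>\<close> is \<open>m\<close>: a parallel unit section \<open>s\<close> along \<open>\<gamma>\<close>, given by
  its local representatives, returns as \<open>m\<close> times itself.\<close>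

definition has_monodromy ::
    "('i \<Rightarrow> (real^3) set) \<Rightarrow> ('i \<Rightarrow> 'i \<Rightarrow> real^3 \<Rightarrow> real) \<Rightarrow> (real \<Rightarrow> real^3) \<Rightarrow> real \<Rightarrow> bool" where
  "has_monodromy V g \<gamma> m \<longleftrightarrow>
    (\<exists>s :: 'i \<Rightarrow> real \<Rightarrow> real.
      (\<forall>i. continuous_on {t\<in>{0..1}. \<gamma> t \<in> V i} (s i)) \<and>
      (\<forall>i. \<forall>t\<in>{0..1}. \<gamma> t \<in> V i \<longrightarrow> s i t \<in> {1, -1}) \<and>
      (\<forall>i j. \<forall>t\<in>{0..1}. \<gamma> t \<in> V i \<inter> V j \<longrightarrow> s i t = g i j (\<gamma> t) * s j t) \<and>
      (\<forall>i. pathstart \<gamma> \<in> V i \<longrightarrow> s i 1 = m * s i 0))"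

text \<open>Every loop near a point of \<open>\<Sigma>\<close> which winds once around \<open>\<Sigma>\<close>, in either direction, has
  monodromy \<open>-1\<close>.\<close>

definition monodromy_minus_one_around ::
    "(real^3) set \<Rightarrow> (real^3) set \<Rightarrow> (real^3 \<Rightarrow> real^3) \<Rightarrow>
     ('i \<Rightarrow> (real^3) set) \<Rightarrow> ('i \<Rightarrow> 'i \<Rightarrow> real^3 \<Rightarrow> real) \<Rightarrow> bool" where
  "monodromy_minus_one_around U \<Sigma> \<tau> V g \<longleftrightarrow>
    (\<exists>e T \<pi> z. tubular_neighbourhood U \<Sigma> \<tau> e T \<pi> z \<and>
      (\<forall>p\<in>\<Sigma>. \<exists>\<epsilon>>0. ball p \<epsilon> \<subseteq> T \<and>
        (\<forall>\<gamma>. path \<gamma> \<and> pathfinish \<gamma> = pathstart \<gamma> \<and> path_image \<gamma> \<subseteq> ball p \<epsilon> - \<Sigma> \<and>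
             winding_number (z \<circ> \<gamma>) 0 \<in> {1, -1} \<longrightarrow> has_monodromy V g \<gamma> (-1))))"


section \<open>\<open>\<int>\<^sub>2\<close> harmonic functions\<close>

definition locally_square_integrable ::
    "(real^3) set \<Rightarrow> (real^3) set \<Rightarrow> (real^3 \<Rightarrow> real) \<Rightarrow> bool" where
  "locally_square_integrable U \<Sigma> h \<longleftrightarrow>
    (\<forall>K. compact K \<and> K \<subseteq> U \<longrightarrow> (\<lambda>x. (h x)\<^sup>2) absolutely_integrable_on (K - \<Sigma>))"

definition Z2_harmonic_function ::
    "(real^3) set \<Rightarrow> (real^3) set \<Rightarrow> (real^3 \<Rightarrow> real^3) \<Rightarrow>
     ('i \<Rightarrow> (real^3) set) \<Rightarrow> ('i \<Rightarrow> 'i \<Rightarrow> real^3 \<Rightarrow> real) \<Rightarrow> ('i \<Rightarrow> real^3 \<Rightarrow> real) \<Rightarrow> bool" where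
  "Z2_harmonic_function U \<Sigma> \<tau> V g f \<longleftrightarrow>
    open U \<and> closedin (top_of_set U) \<Sigma> \<and> oriented_curve \<Sigma> \<tau> \<and>
    flat_Z2_bundle (U - \<Sigma>) V g \<and> monodromy_minus_one_around U \<Sigma> \<tau> V g \<and>
    bundle_section V g f \<and> (\<forall>i. smooth_on (V i) (f i)) \<and>
    locally_square_integrable U \<Sigma> (section_norm V f) \<and>
    locally_square_integrable U \<Sigma> (section_norm V (\<lambda>i. gradient (f i))) \<and>
    (\<forall>i. \<forall>x\<in>V i. laplacian (f i) x = 0)"

text \<open>The expansion of \<open>f\<close> over an open set \<open>W\<close> of a tubular neighbourhood. The square root
  \<open>\<zeta>\<^sup>1\<^sup>/\<^sup>2\<close> is a continuous section \<open>\<sigma>\<close> of the complexified bundle with square \<open>z\<close>. It is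
  determined up to sign on connected \<open>W - \<Sigma>\<close>, and changing that sign changes the sign of both \<open>A\<close>
  and \<open>B\<close>: this, together with the choice of the frame, is the ambiguity in representing sections of
  the powers \<open>-1/2\<close> and \<open>-3/2\<close> of the normal bundle by complex functions.\<close>

definition expansion_on ::
    "(real^3) set \<Rightarrow> (real^3 \<Rightarrow> real^3) \<Rightarrow> (real^3 \<Rightarrow> real^3) \<Rightarrow>
     (real^3 \<Rightarrow> real^3) \<Rightarrow> (real^3 \<Rightarrow> complex) \<Rightarrow>
     ('i \<Rightarrow> (real^3) set) \<Rightarrow> ('i \<Rightarrow> 'i \<Rightarrow> real^3 \<Rightarrow> real) \<Rightarrow> ('i \<Rightarrow> real^3 \<Rightarrow> real) \<Rightarrow>
     (real^3) set \<Rightarrow> (real^3 \<Rightarrow> complex) \<Rightarrow> (real^3 \<Rightarrow> complex) \<Rightarrow> bool" where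
  "expansion_on \<Sigma> \<tau> e \<pi> z V g f W A B \<longleftrightarrow>
    smooth_on (\<Sigma> \<inter> W) A \<and> smooth_on (\<Sigma> \<inter> W) B \<and>
    (\<exists>\<sigma> C.
      (\<forall>i. continuous_on (V i \<inter> W) (\<sigma> i) \<and> (\<forall>x\<in>V i \<inter> W. (\<sigma> i x)\<^sup>2 = z x)) \<and>
      bundle_section (\<lambda>i. V i \<inter> W) g \<sigma> \<and>
      (\<forall>i. \<forall>x\<in>V i \<inter> W.
        \<bar>f i x -
          (Re (A (\<pi> x) * \<sigma> i x + B (\<pi> x) * (\<sigma> i x)^3)
           - 1/2 * Re (cnj (frame_coordinate \<tau> e (\<pi> x) (mean_curvature_vector \<Sigma> \<tau> (\<pi> x))) * z x)
                 * Re (A (\<pi> x) * \<sigma> i x))\<bar>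
        \<le> C * norm (z x) powr (5/2)))"

text \<open>The coefficients in the expansion of \<open>f\<close> satisfy \<open>P\<close> at each point of \<open>\<Sigma>\<close>. Since they are
  local and unique up to the choices above, \<open>P\<close> has to be independent of these choices.\<close>

definition expansion_coefficients_satisfy ::
    "(complex \<Rightarrow> complex \<Rightarrow> bool) \<Rightarrow> (real^3) set \<Rightarrow> (real^3) set \<Rightarrow> (real^3 \<Rightarrow> real^3) \<Rightarrow>
     ('i \<Rightarrow> (real^3) set) \<Rightarrow> ('i \<Rightarrow> 'i \<Rightarrow> real^3 \<Rightarrow> real) \<Rightarrow> ('i \<Rightarrow> real^3 \<Rightarrow> real) \<Rightarrow> bool" where
  "expansion_coefficients_satisfy P U \<Sigma> \<tau> V g f \<longleftrightarrow>
    (\<exists>e T \<pi> z. tubular_neighbourhood U \<Sigma> \<tau> e T \<pi> z \<and>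
      (\<forall>p\<in>\<Sigma>. \<exists>W A B. open W \<and> p \<in> W \<and> W \<subseteq> T \<and> \<pi> ` W \<subseteq> W \<and>
        expansion_on \<Sigma> \<tau> e \<pi> z V g f W A B \<and> (\<forall>q\<in>\<Sigma> \<inter> W. P (A q) (B q))))"

definition critical ::
    "(real^3) set \<Rightarrow> (real^3) set \<Rightarrow> (real^3 \<Rightarrow> real^3) \<Rightarrow>
     ('i \<Rightarrow> (real^3) set) \<Rightarrow> ('i \<Rightarrow> 'i \<Rightarrow> real^3 \<Rightarrow> real) \<Rightarrow> ('i \<Rightarrow> real^3 \<Rightarrow> real) \<Rightarrow> bool" where
  "critical U \<Sigma> \<tau> V g f \<longleftrightarrow> expansion_coefficients_satisfy (\<lambda>a b. a = 0) U \<Sigma> \<tau> V g f"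

definition nondegenerate ::
    "(real^3) set \<Rightarrow> (real^3) set \<Rightarrow> (real^3 \<Rightarrow> real^3) \<Rightarrow>
     ('i \<Rightarrow> (real^3) set) \<Rightarrow> ('i \<Rightarrow> 'i \<Rightarrow> real^3 \<Rightarrow> real) \<Rightarrow> ('i \<Rightarrow> real^3 \<Rightarrow> real) \<Rightarrow> bool" where
  "nondegenerate U \<Sigma> \<tau> V g f \<longleftrightarrow>
    critical U \<Sigma> \<tau> V g f \<and> expansion_coefficients_satisfy (\<lambda>a b. b \<noteq> 0) U \<Sigma> \<tau> V g f"


section \<open>Planar hyperbolas admit an orientation\<close>

lemma Ck_on_cosh_sinh:
  fixes a b d :: "'b::real_normed_vector"
  shows "Ck_on k UNIV (\<lambda>t::real. d + cosh t *\<^sub>R a + sinh t *\<^sub>R b)"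
proof (induction k arbitrary: a b d)
  case 0
  show ?case by (auto intro!: continuous_intros)
next
  case (Suc k)
  have D: "((\<lambda>t::real. d + cosh t *\<^sub>R a + sinh t *\<^sub>R b) has_derivative
      (\<lambda>h. h *\<^sub>R (sinh t *\<^sub>R a + cosh t *\<^sub>R b))) (at t)" for t
    by (auto intro!: derivative_eq_intros simp: algebra_simps)
  have E: "frechet_derivative (\<lambda>t::real. d + cosh t *\<^sub>R a + sinh t *\<^sub>R b) (at t) v =
      0 + cosh t *\<^sub>R (v *\<^sub>R b) + sinh t *\<^sub>R (v *\<^sub>R a)" for v t
    by (subst frechet_derivative_at[OF D, symmetric]) (simp add: algebra_simps)
  have 1: "(\<lambda>t::real. d + cosh t *\<^sub>R a + sinh t *\<^sub>R b) differentiable (at t)" for t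
    using D by (rule differentiableI)
  have 2: "Ck_on k UNIV (\<lambda>t. frechet_derivative (\<lambda>t::real. d + cosh t *\<^sub>R a + sinh t *\<^sub>R b) (at t) v)" for v
    unfolding E by (rule Suc.IH)
  show ?case
    using 1 2 by simp
qed

lemma planar_hyperbola_orientable:
  assumes "planar_hyperbola H"
  shows "\<exists>\<tau>. oriented_curve H \<tau>"
proof -
  obtain h1 h3 p \<phi> where h: "h1 > 0" "h3 > 0" and \<phi>: "orthogonal_transformation \<phi>"
    and H: "H = (\<lambda>x. p + \<phi> x) ` standard_hyperbola h1 h3"
    using assms unfolding planar_hyperbola_def by blast
  define u v where "u = \<phi> (axis 1 1)" and "v = \<phi> (axis 3 1)"
  have inn: "\<phi> x \<bullet> \<phi> y = x \<bullet> y" for x y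
    using \<phi> by (simp add: orthogonal_transformation_def)
  have lin: "linear \<phi>" using \<phi> by (simp add: orthogonal_transformation_def)
  have uv: "u \<bullet> u = 1" "v \<bullet> v = 1" "u \<bullet> v = 0" "v \<bullet> u = 0"
    by (simp_all add: u_def v_def inn inner_axis_axis)
  have Heq: "x \<in> H \<longleftrightarrow> (\<exists>X Y. X\<^sup>2 / h1\<^sup>2 - Y\<^sup>2 / h3\<^sup>2 = 1 \<and> x = p + X *\<^sub>R u + Y *\<^sub>R v)" for x
  proof
    assume "x \<in> H"
    then obtain y where y: "y \<in> standard_hyperbola h1 h3" "x = p + \<phi> y" using H by auto
    then have "y = (y$1) *\<^sub>R axis 1 1 + (y$3) *\<^sub>R axis 3 1"
      by (simp add: standard_hyperbola_def vec_eq_iff forall_3 axis_def)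
    from arg_cong[OF this, of \<phi>] have "\<phi> y = (y$1) *\<^sub>R u + (y$3) *\<^sub>R v"
      unfolding u_def v_def linear_add[OF lin] linear_scale[OF lin] .
    with y show "\<exists>X Y. X\<^sup>2 / h1\<^sup>2 - Y\<^sup>2 / h3\<^sup>2 = 1 \<and> x = p + X *\<^sub>R u + Y *\<^sub>R v"
      by (intro exI[of _ "y$1"] exI[of _ "y$3"]) (simp add: standard_hyperbola_def add.assoc)
  next
    assume "\<exists>X Y. X\<^sup>2 / h1\<^sup>2 - Y\<^sup>2 / h3\<^sup>2 = 1 \<and> x = p + X *\<^sub>R u + Y *\<^sub>R v"
    then obtain X Y where XY: "X\<^sup>2 / h1\<^sup>2 - Y\<^sup>2 / h3\<^sup>2 = 1" "x = p + X *\<^sub>R u + Y *\<^sub>R v" by blast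
    let ?y = "X *\<^sub>R axis 1 1 + Y *\<^sub>R axis 3 1 :: real^3"
    have "?y \<in> standard_hyperbola h1 h3" using XY by (simp add: standard_hyperbola_def axis_def)
    moreover have "x = p + \<phi> ?y"
      unfolding XY u_def v_def using lin by (simp add: linear_add linear_scale)
    ultimately show "x \<in> H" unfolding H by (rule rev_image_eqI)
  qed
  define \<tau> where "\<tau> x = sgn ((h1 / h3 * ((x - p) \<bullet> v)) *\<^sub>R u + (h3 / h1 * ((x - p) \<bullet> u)) *\<^sub>R v)" for x
  have "\<exists>J W c. oriented_chart H \<tau> J W c \<and> q \<in> W" if qH: "q \<in> H" for q
  proof -
    obtain X0 Y0 where q: "X0\<^sup>2 / h1\<^sup>2 - Y0\<^sup>2 / h3\<^sup>2 = 1" "q = p + X0 *\<^sub>R u + Y0 *\<^sub>R v"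
      using iffD1[OF Heq qH] by blast
    have "X0 \<noteq> 0"
    proof
      assume "X0 = 0"
      then have "- (Y0\<^sup>2 / h3\<^sup>2) = 1" using q by simp
      moreover have "Y0\<^sup>2 / h3\<^sup>2 \<ge> 0" by simp
      ultimately show False by linarith
    qed
    define s where "s = sgn X0"
    have s: "s * s = 1" "s * X0 > 0" "s = 1 \<or> s = -1"
      using \<open>X0 \<noteq> 0\<close> by (auto simp: s_def sgn_if)
    define c where "c t = p + cosh t *\<^sub>R ((s * h1) *\<^sub>R u) + sinh t *\<^sub>R ((s * h3) *\<^sub>R v)" for t :: real
    define W where "W = {x. s * ((x - p) \<bullet> u) > 0}"
    define k where "k x = arsinh (s * ((x - p) \<bullet> v) / h3)" for x
    have cu: "(c t - p) \<bullet> u = s * h1 * cosh t" and cv: "(c t - p) \<bullet> v = s * h3 * sinh t" for t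
      by (simp_all add: c_def inner_add_left uv)
    have cD: "(c has_vector_derivative
        (s * h1 * sinh t) *\<^sub>R u + (s * h3 * cosh t) *\<^sub>R v) (at t)" for t
      unfolding c_def has_vector_derivative_def
      by (auto intro!: derivative_eq_intros simp: algebra_simps)
    have cVD: "vector_derivative c (at t) = (s * h1 * sinh t) *\<^sub>R u + (s * h3 * cosh t) *\<^sub>R v" for t
      using cD by (rule vector_derivative_at)
    have nz: "vector_derivative c (at t) \<noteq> 0" for t
    proof
      assume "vector_derivative c (at t) = 0"
      then have "vector_derivative c (at t) \<bullet> v = 0" by simp
      then show False using s h by (auto simp: cVD inner_add_left uv)
    qed
    have tau: "\<tau> (c t) = sgn (vector_derivative c (at t))" for t
      unfolding \<tau>_def cVD cu cv using h by (simp add: mult_ac)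
    have "homeomorphism UNIV (H \<inter> W) c k"
    proof (rule homeomorphismI)
      show "continuous_on UNIV c" unfolding c_def by (intro continuous_intros)
      show "continuous_on (H \<inter> W) k" unfolding k_def using h
        by (intro continuous_on_compose2[OF continuous_on_arsinh[of UNIV]] continuous_intros) auto
      have "c t \<in> H \<inter> W" for t
      proof -
        have "(s * h1 * cosh t)\<^sup>2 / h1\<^sup>2 - (s * h3 * sinh t)\<^sup>2 / h3\<^sup>2 = 1"
          using h s by (auto simp: power_mult_distrib cosh_square_eq)
        then have "c t \<in> H"
          unfolding Heq c_def
          by (intro exI[of _ "s * h1 * cosh t"] exI[of _ "s * h3 * sinh t"]) (simp add: mult_ac)
        moreover have "c t \<in> W" unfolding W_def using cu h s(3) by auto
        ultimately show "c t \<in> H \<inter> W" by blast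
      qed
      then show "c ` UNIV \<subseteq> H \<inter> W" by blast
      show "k ` (H \<inter> W) \<subseteq> UNIV" by simp
      show "k (c t) = t" for t
        unfolding k_def cv using h s(3) by (auto simp: arsinh_sinh_real)
      show "c (k x) = x" if x: "x \<in> H \<inter> W" for x
      proof -
        obtain X Y where XY: "X\<^sup>2 / h1\<^sup>2 - Y\<^sup>2 / h3\<^sup>2 = 1" "x = p + X *\<^sub>R u + Y *\<^sub>R v"
          using iffD1[OF Heq IntD1[OF x]] by blast
        have xu: "(x - p) \<bullet> u = X" "(x - p) \<bullet> v = Y" using XY by (simp_all add: inner_add_left uv)
        have pos: "s * X > 0" using x xu by (simp add: W_def)
        have sh: "sinh (k x) = s * Y / h3" unfolding k_def xu by simp
        have "(cosh (k x))\<^sup>2 = (s * X / h1)\<^sup>2"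
          unfolding cosh_square_eq sh using XY s by (auto simp: power_divide)
        then have "cosh (k x) = s * X / h1"
          by (rule power2_eq_imp_eq) (use pos h in auto)
        then have ch': "cosh (k x) * (s * h1) = X" using h s by auto
        have sh': "sinh (k x) * (s * h3) = Y" using sh h s by auto
        show "c (k x) = x"
          unfolding c_def scaleR_scaleR ch' sh' XY(2)[symmetric] ..
      qed
    qed
    moreover have "open W" unfolding W_def
      by (intro open_Collect_less continuous_intros)
    moreover have "smooth_on UNIV c"
    proof -
      have "Ck_on k UNIV c" for k unfolding c_def by (rule Ck_on_cosh_sinh)
      then show ?thesis unfolding smooth_on_def by (intro ballI exI[of _ UNIV] exI[of _ c]) simp
    qed
    moreover have "q \<in> W" unfolding W_def q using s by (simp add: inner_add_left uv)
    ultimately show ?thesis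
      unfolding oriented_chart_def using nz tau
      by (intro exI[of _ UNIV] exI[of _ W] exI[of _ c]) auto
  qed
  then show ?thesis unfolding oriented_curve_def by blast
qed

end

theory Submission
  imports Defs "HOL-Library.Landau_Symbols" "HOL-Complex_Analysis.Riemann_Mapping"
begin

text \<open>
  Put \<open>a = h1\<^sup>2\<close> and \<open>c = h3\<^sup>2\<close>. The hyperbola \<open>X1\<^sup>2 / a - X3\<^sup>2 / c = 1\<close>, \<open>X2 = 0\<close> is a focal conic
  of the confocal quadrics \<open>X1\<^sup>2 / (a - r) - X2\<^sup>2 / r - X3\<^sup>2 / (c + r) = 1\<close>: as \<open>r > 0\<close> tends to \<open>0\<close>,
  the quadric flattens to the part \<open>X1\<^sup>2 / a - X3\<^sup>2 / c \<ge> 1\<close> of the plane \<open>X2 = 0\<close>, whose edge is the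
  hyperbola. Each point with \<open>X1 \<noteq> 0\<close> determines one parameter \<open>r = u\<^sup>2\<close> in \<open>[0, a)\<close>
  (\<open>confocal_root_exists\<close>, \<open>confocal_root_unique\<close>). With \<open>w\<^sup>2 = X1\<^sup>2 / (a - u\<^sup>2) - X3\<^sup>2 / (c + u\<^sup>2) - 1\<close> this
  says \<open>u w = X2\<close>, once the signs are matched. The pair \<open>(u, w)\<close> is thus determined up to a common
  sign, and this sign is the double cover which is branched along the hyperbola: to leading order
  \<open>w + \<i> m u\<close> is a square root of \<open>2 m \<zeta>\<close>, where \<open>\<zeta>\<close> is the normal coordinate and \<open>m\<close> is half
  the length of the gradient of \<open>X1\<^sup>2 / a - X3\<^sup>2 / c\<close>.

  The interior potential of a homogeneous ellipsoid suggests a harmonic function which is odd in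
  \<open>(u, w)\<close>, namely the finite part of the integral from \<open>0\<close> to \<open>u\<close> of
  \<open>(1 - X1\<^sup>2 / (a - t\<^sup>2) + X2\<^sup>2 / t\<^sup>2 + X3\<^sup>2 / (c + t\<^sup>2)) / sqrt ((a - t\<^sup>2) (c + t\<^sup>2))\<close>.
  The integrand vanishes at \<open>t = u\<close>, so \<open>u\<close> contributes nothing to the first derivatives in \<open>x\<close>
  (\<open>has_derivative_potential\<close>), and for the second derivatives the boundary terms cancel
  (\<open>potential_gradient_harmonic\<close>). Expanding the elliptic integrals to third order in \<open>u\<close> gives
  \<open>- 2 / (3 sqrt (a c)) (3 u w\<^sup>2 - m\<^sup>2 u\<^sup>3)\<close> up to order \<open>5 / 2\<close> in the distance
  (\<open>branch_estimates\<close>). This is a nonzero multiple of the imaginary part of \<open>(w + \<i> m u)\<^sup>3\<close>, hence of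
  the form \<open>Re (B \<zeta>\<^sup>3\<^sup>/\<^sup>2)\<close> with \<open>B\<close> nowhere zero, and no term of order \<open>1 / 2\<close> occurs.

  The line bundle is trivialized on the sets \<open>w \<noteq> 0\<close> and \<open>u \<noteq> 0\<close> by choosing \<open>w > 0\<close> and \<open>u > 0\<close>; the
  transition function is the sign of \<open>X2\<close>. Correcting \<open>w + \<i> m u\<close> to an exact square root \<open>\<sigma>\<close> of
  \<open>\<zeta>\<close> (\<open>square_root_close\<close>) provides both the root in the expansion and the monodromy: divided by
  a continuous root of \<open>\<zeta>\<close> along a loop, \<open>\<sigma>\<close> becomes a parallel unit section
  (\<open>has_monodromy_minus_one\<close>).

  The coordinate \<open>u\<^sup>2\<close>, off the hyperbola, and the nearest point on the hyperbola solve scalar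
  equations with monotone left hand sides; they are smooth by \<open>Cinf_on_implicit\<close>.
\<close>

section \<open>Calculus of continuously differentiable functions\<close>

\<comment> \<open>Otherwise the simplifier unfolds \<open>Ck_on (Suc k)\<close> before the closure rules apply.\<close>
declare Ck_on.simps(2) [simp del]

lemma Ck_on_subset: "Ck_on k W f \<Longrightarrow> W' \<subseteq> W \<Longrightarrow> Ck_on k W' f"
  by (induction k arbitrary: f) (auto simp: Ck_on.simps(2) intro: continuous_on_subset)

lemma Ck_on_Suc_D: "Ck_on (Suc k) W f \<Longrightarrow> Ck_on k W f"
proof (induction k arbitrary: f)
  case 0
  then show ?case
    by (auto simp: Ck_on.simps(2) intro!: continuous_at_imp_continuous_on differentiable_imp_continuous_within)
next
  case (Suc k)
  then show ?case by (metis Ck_on.simps(2))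
qed

lemma Ck_on_imp_continuous_on: "Ck_on k W f \<Longrightarrow> continuous_on W f"
  by (induction k) (auto dest: Ck_on_Suc_D)

lemma Ck_on_cong:
  assumes "open W" "\<And>x. x \<in> W \<Longrightarrow> f x = g x" "Ck_on k W f"
  shows "Ck_on k W g"
  using assms(2,3)
proof (induction k arbitrary: f g)
  case 0
  then show ?case using continuous_on_cong[of W W f g] by auto
next
  case (Suc k)
  have D: "(g has_derivative frechet_derivative f (at x)) (at x)" if "x \<in> W" for x
  proof -
    have "(f has_derivative frechet_derivative f (at x)) (at x)"
      using Suc.prems that by (auto simp: Ck_on.simps(2) frechet_derivative_works[symmetric])
    then show ?thesis
      by (rule has_derivative_transform_within_open[OF _ assms(1) that]) (use Suc.prems in auto)
  qed
  have E: "frechet_derivative f (at x) v = frechet_derivative g (at x) v" if "x \<in> W" for x v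
    using frechet_derivative_at[OF D[OF that]] by simp
  have "Ck_on k W (\<lambda>x. frechet_derivative g (at x) v)" for v
    by (rule Suc.IH[where f = "\<lambda>x. frechet_derivative f (at x) v"]) (use Suc.prems E in \<open>auto simp: Ck_on.simps(2)\<close>)
  then show ?case using differentiableI[OF D] by (auto simp: Ck_on.simps(2))
qed

lemma Ck_on_SucI:
  assumes "open W" "\<And>x. x \<in> W \<Longrightarrow> (f has_derivative f' x) (at x)"
    "\<And>v. Ck_on k W (\<lambda>x. f' x v)"
  shows "Ck_on (Suc k) W f"
proof -
  have "Ck_on k W (\<lambda>x. frechet_derivative f (at x) v)" for v
    by (rule Ck_on_cong[OF assms(1) _ assms(3)[of v]])
      (use frechet_derivative_at[OF assms(2)] in auto)
  then show ?thesis using differentiableI[OF assms(2)] by (auto simp: Ck_on.simps(2))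
qed

lemma Ck_on_SucD:
  assumes "Ck_on (Suc k) W f"
  shows "x \<in> W \<Longrightarrow> (f has_derivative frechet_derivative f (at x)) (at x)"
    and "Ck_on k W (\<lambda>x. frechet_derivative f (at x) v)"
  using assms by (auto simp: Ck_on.simps(2) frechet_derivative_works[symmetric])

lemma Ck_on_const: "open W \<Longrightarrow> Ck_on k W (\<lambda>x. c)"
proof (induction k arbitrary: c)
  case (Suc k)
  then show ?case by (intro Ck_on_SucI[where f' = "\<lambda>_ _. 0"]) auto
qed auto

lemma Ck_on_linear:
  assumes "open W" "bounded_linear f"
  shows "Ck_on k W f"
proof (cases k)
  case 0
  then show ?thesis using assms(2) by (simp add: linear_continuous_on)
next
  case (Suc j)
  show ?thesis unfolding Suc
    by (rule Ck_on_SucI[OF assms(1) bounded_linear_imp_has_derivative[OF assms(2)]])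
      (rule Ck_on_const[OF assms(1)])
qed

lemma Ck_on_add:
  assumes "open W" "Ck_on k W f" "Ck_on k W g"
  shows "Ck_on k W (\<lambda>x. f x + g x)"
  using assms(2,3)
proof (induction k arbitrary: f g)
  case (Suc k)
  show ?case
    by (rule Ck_on_SucI[OF assms(1)
        has_derivative_add[OF Ck_on_SucD(1)[OF Suc.prems(1)] Ck_on_SucD(1)[OF Suc.prems(2)]]])
      (auto intro!: Suc.IH Ck_on_SucD(2)[OF Suc.prems(1)] Ck_on_SucD(2)[OF Suc.prems(2)])
qed (auto intro: continuous_on_add)

lemma Ck_on_bilinear:
  assumes "bounded_bilinear b" "open W" "Ck_on k W f" "Ck_on k W g"
  shows "Ck_on k W (\<lambda>x. b (f x) (g x))"
  using assms(3,4)
proof (induction k arbitrary: f g)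
  case 0
  then show ?case using bounded_bilinear.continuous_on[OF assms(1)] by auto
next
  case (Suc k)
  have "((\<lambda>x. b (f x) (g x)) has_derivative
      (\<lambda>h. b (f x) (frechet_derivative g (at x) h) + b (frechet_derivative f (at x) h) (g x))) (at x)"
    if "x \<in> W" for x
    by (rule bounded_bilinear.FDERIV[OF assms(1) Ck_on_SucD(1)[OF Suc.prems(1) that]
          Ck_on_SucD(1)[OF Suc.prems(2) that]])
  then show ?case
    by (rule Ck_on_SucI[OF assms(2)])
      (auto intro!: Ck_on_add[OF assms(2)] Suc.IH Ck_on_Suc_D[OF Suc.prems(1)]
        Ck_on_Suc_D[OF Suc.prems(2)] Ck_on_SucD(2)[OF Suc.prems(1)] Ck_on_SucD(2)[OF Suc.prems(2)])
qed

lemmas Ck_on_mult = Ck_on_bilinear[OF bounded_bilinear_mult]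
lemmas Ck_on_scaleR = Ck_on_bilinear[OF bounded_bilinear_scaleR]

lemma Ck_on_sum:
  assumes "open W" "finite I" "\<And>i. i \<in> I \<Longrightarrow> Ck_on k W (f i)"
  shows "Ck_on k W (\<lambda>x. \<Sum>i\<in>I. f i x)"
  using assms(2,3) by (induction I) (auto intro!: Ck_on_add Ck_on_const assms(1))

lemma Ck_on_compose:
  fixes f :: "'b::euclidean_space \<Rightarrow> 'c::real_normed_vector" and g :: "'a::euclidean_space \<Rightarrow> 'b"
  assumes "open S" "open W" "Ck_on k S f" "Ck_on k W g" "g ` W \<subseteq> S"
  shows "Ck_on k W (\<lambda>x. f (g x))"
  using assms(3,4)
proof (induction k arbitrary: f)
  case 0
  then show ?case using continuous_on_compose2[of S f W g] assms(5) by simp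
next
  case (Suc k)
  let ?F = "\<lambda>x. frechet_derivative f (at x)" and ?G = "\<lambda>x. frechet_derivative g (at x)"
  have F: "(f has_derivative ?F (g x)) (at (g x))" if "x \<in> W" for x
    using Ck_on_SucD(1)[OF Suc.prems(1)] that assms(5) by blast
  have D: "((\<lambda>x. f (g x)) has_derivative (\<lambda>v. \<Sum>b\<in>Basis. (?G x v \<bullet> b) *\<^sub>R ?F (g x) b)) (at x)"
    if "x \<in> W" for x
  proof -
    have "((\<lambda>x. f (g x)) has_derivative (\<lambda>v. ?F (g x) (?G x v))) (at x)"
      using has_derivative_compose[OF Ck_on_SucD(1)[OF Suc.prems(2) that] F[OF that]] by simp
    moreover have "?F (g x) v = (\<Sum>b\<in>Basis. (v \<bullet> b) *\<^sub>R ?F (g x) b)" for v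
    proof -
      have l: "linear (?F (g x))" using F[OF that] by (rule has_derivative_linear)
      have "?F (g x) v = ?F (g x) (\<Sum>b\<in>Basis. (v \<bullet> b) *\<^sub>R b)" by (simp add: euclidean_representation)
      then show ?thesis by (simp only: linear_sum[OF l] linear_scale[OF l])
    qed
    ultimately show ?thesis by (rule has_derivative_eq_rhs[OF _ ext])
  qed
  show ?case
  proof (rule Ck_on_SucI[OF assms(2) D])
    fix v
    have "Ck_on k W (\<lambda>x. (?G x v \<bullet> b) *\<^sub>R ?F (g x) b)" for b
      by (rule Ck_on_scaleR[OF assms(2) Ck_on_bilinear[OF bounded_bilinear_inner assms(2)
              Ck_on_SucD(2)[OF Suc.prems(2)] Ck_on_const[OF assms(2)]]
            Suc.IH[OF Ck_on_SucD(2)[OF Suc.prems(1)] Ck_on_Suc_D[OF Suc.prems(2)]]])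
    then show "Ck_on k W (\<lambda>x. \<Sum>b\<in>Basis. (?G x v \<bullet> b) *\<^sub>R ?F (g x) b)"
      by (intro Ck_on_sum[OF assms(2) finite_Basis])
  qed
qed

lemma Ck_on_Pair:
  fixes f :: "'a::euclidean_space \<Rightarrow> 'b::real_normed_vector" and g :: "'a \<Rightarrow> 'c::real_normed_vector"
  assumes "open W" "Ck_on k W f" "Ck_on k W g"
  shows "Ck_on k W (\<lambda>x. (f x, g x))"
  using assms(2,3)
proof (induction k arbitrary: f g)
  case 0
  then show ?case by (simp add: continuous_on_Pair)
next
  case (Suc k)
  have C: "Ck_on k W (\<lambda>x. (frechet_derivative f (at x) v, frechet_derivative g (at x) v))" for v
    by (rule Suc.IH[OF Ck_on_SucD(2)[OF Suc.prems(1)] Ck_on_SucD(2)[OF Suc.prems(2)]])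
  show ?case
    by (rule Ck_on_SucI[OF assms(1)
        has_derivative_Pair[OF Ck_on_SucD(1)[OF Suc.prems(1)] Ck_on_SucD(1)[OF Suc.prems(2)]] C])
qed

text \<open>On an open set one global extension suffices in \<open>smooth_on\<close>, namely the function itself; this
  form is stable under the operations below, by inductions on the order.\<close>

definition Cinf_on :: "'a::euclidean_space set \<Rightarrow> ('a \<Rightarrow> 'b::real_normed_vector) \<Rightarrow> bool" where
  "Cinf_on W f \<longleftrightarrow> open W \<and> (\<forall>k. Ck_on k W f)"

lemma Cinf_on_I: "open W \<Longrightarrow> (\<And>k. Ck_on k W f) \<Longrightarrow> Cinf_on W f"
  by (simp add: Cinf_on_def)

lemma Cinf_on_D:
  assumes "Cinf_on W f"
  shows "open W" "Ck_on k W f" "continuous_on W f" "x \<in> W \<Longrightarrow> f differentiable (at x)"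
proof -
  show "open W" and Ck: "Ck_on k W f" for k using assms by (simp_all add: Cinf_on_def)
  show "continuous_on W f" using Ck by (rule Ck_on_imp_continuous_on)
  show "f differentiable (at x)" if "x \<in> W"
    using Ck_on_SucD(1)[OF Ck that] by (rule differentiableI)
qed

lemma Cinf_on_subset: "Cinf_on W f \<Longrightarrow> open W' \<Longrightarrow> W' \<subseteq> W \<Longrightarrow> Cinf_on W' f"
  by (rule Cinf_on_I, assumption, rule Ck_on_subset[of _ W]) (simp_all add: Cinf_on_D)

lemma Cinf_on_cong: "Cinf_on W f \<Longrightarrow> (\<And>x. x \<in> W \<Longrightarrow> f x = g x) \<Longrightarrow> Cinf_on W g"
  by (rule Cinf_on_I, erule Cinf_on_D(1), rule Ck_on_cong[of _ f]) (simp_all add: Cinf_on_D)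

lemma Cinf_on_imp_smooth_on: "Cinf_on W f \<Longrightarrow> S \<subseteq> W \<Longrightarrow> smooth_on S f"
  unfolding Cinf_on_def smooth_on_def
  by (intro ballI exI[of _ W] exI[of _ f]) (auto simp: subset_eq)

lemma Cinf_on_const [intro!]: "open W \<Longrightarrow> Cinf_on W (\<lambda>x. c)"
  by (intro Cinf_on_I Ck_on_const)

lemma Cinf_on_linear: "open W \<Longrightarrow> bounded_linear f \<Longrightarrow> Cinf_on W f"
  by (intro Cinf_on_I Ck_on_linear)

lemma Cinf_on_id [intro!]: "open W \<Longrightarrow> Cinf_on W (\<lambda>x. x)"
  by (rule Cinf_on_linear[OF _ bounded_linear_ident])

lemma Cinf_on_add [intro!]: "Cinf_on W f \<Longrightarrow> Cinf_on W g \<Longrightarrow> Cinf_on W (\<lambda>x. f x + g x)"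
  by (intro Cinf_on_I Ck_on_add) (simp_all add: Cinf_on_D)

lemma Cinf_on_scaleR [intro!]: "Cinf_on W f \<Longrightarrow> Cinf_on W g \<Longrightarrow> Cinf_on W (\<lambda>x. f x *\<^sub>R g x)"
  by (intro Cinf_on_I Ck_on_scaleR) (simp_all add: Cinf_on_D)

lemma Cinf_on_mult [intro!]:
  fixes f g :: "'a::euclidean_space \<Rightarrow> 'b::real_normed_algebra"
  shows "Cinf_on W f \<Longrightarrow> Cinf_on W g \<Longrightarrow> Cinf_on W (\<lambda>x. f x * g x)"
  by (intro Cinf_on_I Ck_on_mult) (simp_all add: Cinf_on_D)

lemma Cinf_on_minus [intro!]:
  fixes f :: "'a::euclidean_space \<Rightarrow> 'b::real_normed_vector"
  assumes "Cinf_on W f" shows "Cinf_on W (\<lambda>x. - f x)"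
  using Cinf_on_scaleR[OF Cinf_on_const[OF Cinf_on_D(1)[OF assms], of "-1"] assms] by simp

lemma Cinf_on_diff [intro!]:
  fixes f g :: "'a::euclidean_space \<Rightarrow> 'b::real_normed_vector"
  shows "Cinf_on W f \<Longrightarrow> Cinf_on W g \<Longrightarrow> Cinf_on W (\<lambda>x. f x - g x)"
  using Cinf_on_add[OF _ Cinf_on_minus, of W f g] by simp

lemma Cinf_on_power [intro!]:
  fixes f :: "'a::euclidean_space \<Rightarrow> 'b::real_normed_algebra_1"
  assumes "Cinf_on W f" shows "Cinf_on W (\<lambda>x. f x ^ n)"
proof (induction n)
  case (Suc n)
  show ?case unfolding power_Suc by (rule Cinf_on_mult[OF assms Suc])
qed (simp add: Cinf_on_const Cinf_on_D(1)[OF assms])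

lemma Cinf_on_compose:
  fixes f :: "'b::euclidean_space \<Rightarrow> 'c::real_normed_vector" and g :: "'a::euclidean_space \<Rightarrow> 'b"
  assumes "Cinf_on S f" "Cinf_on W g" "\<And>x. x \<in> W \<Longrightarrow> g x \<in> S"
  shows "Cinf_on W (\<lambda>x. f (g x))"
proof (rule Cinf_on_I[OF Cinf_on_D(1)[OF assms(2)]])
  fix k
  have "g ` W \<subseteq> S" using assms(3) by blast
  then show "Ck_on k W (\<lambda>x. f (g x))"
    by (rule Ck_on_compose[OF Cinf_on_D(1)[OF assms(1)] Cinf_on_D(1)[OF assms(2)]
          Cinf_on_D(2)[OF assms(1)] Cinf_on_D(2)[OF assms(2)]])
qed

text \<open>If the derivative of \<open>f\<close> is a smooth expression in the point \<^emph>\<open>and in \<open>f\<close> itself\<close>, then each order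
  of differentiability of \<open>f\<close> yields the next one. This gives the smoothness of the inverse, of
  the square root, of primitives and of implicitly defined functions.\<close>

lemma Cinf_on_bootstrap:
  fixes f :: "'a::euclidean_space \<Rightarrow> 'b::euclidean_space"
  assumes W: "open W" and D: "\<And>x. x \<in> W \<Longrightarrow> (f has_derivative f' x) (at x)"
    and G: "\<And>v. Cinf_on D (G v)" "\<And>x v. x \<in> W \<Longrightarrow> f' x v = G v (x, f x)"
    and dom: "\<And>x. x \<in> W \<Longrightarrow> (x, f x) \<in> D"
  shows "Cinf_on W f"
proof -
  have "Ck_on k W f" for k
  proof (induction k)
    case 0
    have "continuous_on W f"
      by (intro continuous_at_imp_continuous_on ballI has_derivative_continuous[OF D])
    then show ?case by simp
  next
    case (Suc k)
    have "Ck_on k W (\<lambda>x. G v (x, f x))" for v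
      using dom by (intro Ck_on_compose[OF Cinf_on_D(1)[OF G(1)] W Cinf_on_D(2)[OF G(1)]
            Ck_on_Pair[OF W Ck_on_linear[OF W bounded_linear_ident] Suc]]) blast
    then have C: "Ck_on k W (\<lambda>x. f' x v)" for v
      by (rule Ck_on_cong[OF W, rotated]) (simp add: G(2))
    show ?case by (rule Ck_on_SucI[OF W D C])
  qed
  then show ?thesis unfolding Cinf_on_def using W by blast
qed

lemma Cinf_on_fst: "open W \<Longrightarrow> Cinf_on W fst" and Cinf_on_snd: "open W \<Longrightarrow> Cinf_on W snd"
  by (auto intro!: Cinf_on_linear bounded_linear_fst bounded_linear_snd)

lemma Cinf_on_inverse_real: "Cinf_on (- {0}) (inverse :: real \<Rightarrow> real)"
proof (rule Cinf_on_bootstrap[where D = UNIV and G = "\<lambda>v q. - (v * (snd q * snd q))"])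
  show "(inverse has_derivative (\<lambda>v. - (v * (inverse x * inverse x)))) (at x)" if "x \<in> - {0}" for x :: real
    using that has_derivative_inverse'[of x UNIV] by (simp add: algebra_simps)
qed (auto intro!: Cinf_on_snd)

lemma Cinf_on_inverse [intro!]:
  fixes f :: "'a::euclidean_space \<Rightarrow> real"
  assumes "Cinf_on W f" "\<And>x. x \<in> W \<Longrightarrow> f x \<noteq> 0"
  shows "Cinf_on W (\<lambda>x. inverse (f x))"
  by (rule Cinf_on_compose[OF Cinf_on_inverse_real assms(1)]) (use assms(2) in auto)

lemma Cinf_on_divide [intro!]:
  fixes f g :: "'a::euclidean_space \<Rightarrow> real"
  assumes "Cinf_on W f" "Cinf_on W g" "\<And>x. x \<in> W \<Longrightarrow> g x \<noteq> 0"
  shows "Cinf_on W (\<lambda>x. f x / g x)"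
  unfolding divide_inverse using assms by auto

lemma Cinf_on_sqrt_real: "Cinf_on {0<..} sqrt"
proof (rule Cinf_on_bootstrap[where D = "{q. snd q > 0}" and G = "\<lambda>v q. v * (inverse (snd q) / 2)"])
  show "(sqrt has_derivative (\<lambda>v. v * (inverse (sqrt x) / 2))) (at x)" if "x \<in> {0<..}" for x :: real
  proof -
    have "(sqrt has_derivative (*) (inverse (sqrt x) / 2)) (at x)"
      using DERIV_real_sqrt[of x] that by (simp add: has_field_derivative_def)
    then show ?thesis by (rule has_derivative_eq_rhs) (simp add: fun_eq_iff)
  qed
  have "open {q::real \<times> real. snd q > 0}" by (intro open_Collect_less continuous_intros)
  then show "Cinf_on {q::real \<times> real. snd q > 0} (\<lambda>q. v * (inverse (snd q) / 2))" for v
    by (auto intro!: Cinf_on_snd)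
qed auto

lemma Cinf_on_sqrt [intro!]:
  assumes "Cinf_on W f" "\<And>x. x \<in> W \<Longrightarrow> f x > 0"
  shows "Cinf_on W (\<lambda>x. sqrt (f x))"
  by (rule Cinf_on_compose[OF Cinf_on_sqrt_real assms(1)]) (use assms(2) in auto)

text \<open>Continuity of \<open>y\<close> keeps \<open>(x', y x')\<close> within reach of the linear approximation of \<open>\<Phi>\<close>. There
  the equation \<open>\<Phi> = 0\<close> first bounds the increment of \<open>y\<close> by a
  multiple \<open>C\<close> of the increment of \<open>x\<close>, and then identifies its linear part.\<close>

lemma has_derivative_implicit:
  fixes y :: "'a::real_normed_vector \<Rightarrow> real"
  assumes D: "(\<Phi> has_derivative (\<lambda>(h, k). A h + d * k)) (at (x, y x))"
    and d: "d \<noteq> 0" and W: "open W" "x \<in> W" and cont: "continuous (at x) y"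
    and eq: "\<And>x'. x' \<in> W \<Longrightarrow> \<Phi> (x', y x') = 0"
  shows "(y has_derivative (\<lambda>h. - A h / d)) (at x)"
proof -
  let ?L = "\<lambda>(h, k). A h + d * k"
  have bl: "bounded_linear ?L" using D by (rule has_derivative_bounded_linear)
  have A: "bounded_linear A"
    using bounded_linear_compose[OF bl bounded_linear_Pair[OF bounded_linear_ident bounded_linear_zero]]
    by simp
  obtain M where M: "M > 0" "\<And>h. norm (A h) \<le> norm h * M"
    using bounded_linear.pos_bounded[OF A] by blast
  define C where "C = 2 * M / \<bar>d\<bar> + 1"
  have C: "C > 0" unfolding C_def using M d by (auto intro!: add_nonneg_pos)
  show ?thesis unfolding has_derivative_within_alt2
  proof (intro conjI allI impI)
    show "bounded_linear (\<lambda>h. - A h / d)"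
      using bounded_linear_divide[THEN bounded_linear_compose, OF bounded_linear_minus[OF A]] by simp
    fix e :: real assume e: "e > 0"
    \<comment> \<open>The first bound on \<open>e'\<close> gives the final estimate; the second one absorbs half of \<open>\<bar>k\<bar>\<close> below.\<close>
    define e' where "e' = min (e * \<bar>d\<bar> / (1 + C)) (\<bar>d\<bar> / 2)"
    have e': "e' > 0" "e' \<le> \<bar>d\<bar> / 2" "e' * (1 + C) \<le> e * \<bar>d\<bar>"
    proof -
      show "e' > 0" using e d C by (simp add: e'_def)
      show "e' \<le> \<bar>d\<bar> / 2" unfolding e'_def by (rule min.cobounded2)
      have "e' \<le> e * \<bar>d\<bar> / (1 + C)" by (simp add: e'_def)
      then show "e' * (1 + C) \<le> e * \<bar>d\<bar>" using C by (simp add: pos_le_divide_eq)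
    qed
    have "\<forall>\<^sub>F q in nhds (x, y x). norm (\<Phi> q - \<Phi> (x, y x) - ?L (q - (x, y x))) \<le> e' * norm (q - (x, y x))"
      using D e'(1) linear_0[OF has_derivative_linear[OF D]]
      unfolding has_derivative_within_alt2 eventually_nhds_conv_at by auto
    moreover have "filterlim (\<lambda>x'. (x', y x')) (nhds (x, y x)) (at x)"
      unfolding nhds_prod[symmetric] using cont
      by (intro tendsto_Pair tendsto_ident_at) (simp add: continuous_at)
    ultimately have "\<forall>\<^sub>F x' in at x. norm (\<Phi> (x', y x') - \<Phi> (x, y x) - ?L ((x', y x') - (x, y x)))
        \<le> e' * norm ((x', y x') - (x, y x))"
      by (rule eventually_compose_filterlim)
    moreover have "\<forall>\<^sub>F x' in at x. x' \<in> W" using W by (rule eventually_at_in_open')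
    ultimately show "\<forall>\<^sub>F x' in at x. norm (y x' - y x - - A (x' - x) / d) \<le> e * norm (x' - x)"
    proof eventually_elim
      case (elim x')
      define h k where "h = x' - x" and "k = y x' - y x"
      have 1: "\<bar>A h + d * k\<bar> \<le> e' * (norm h + \<bar>k\<bar>)"
      proof -
        have "\<bar>A h + d * k\<bar> \<le> e' * norm (h, k)"
          using elim eq[OF W(2)] eq[OF elim(2)] by (simp add: h_def k_def abs_minus_commute)
        also have "\<dots> \<le> e' * (norm h + \<bar>k\<bar>)"
          using e' norm_Pair_le[of h k] by (intro mult_left_mono) auto
        finally show ?thesis .
      qed
      have 2: "\<bar>k\<bar> \<le> C * norm h"
      proof -
        have "\<bar>d\<bar> * \<bar>k\<bar> \<le> \<bar>A h + d * k\<bar> + \<bar>A h\<bar>" unfolding abs_mult[symmetric] by linarith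
        also have "\<dots> \<le> \<bar>d\<bar> / 2 * (norm h + \<bar>k\<bar>) + norm h * M"
          using 1 M(2)[of h] mult_right_mono[OF e'(2), of "norm h + \<bar>k\<bar>"] by simp
        finally have "\<bar>d\<bar> * \<bar>k\<bar> \<le> norm h * (\<bar>d\<bar> + 2 * M)"
          by (simp add: algebra_simps add_divide_distrib)
        then show ?thesis unfolding C_def using d by (simp add: field_simps)
      qed
      have "\<bar>k + A h / d\<bar> = \<bar>A h + d * k\<bar> / \<bar>d\<bar>" using d by (simp add: field_simps flip: abs_divide)
      also have "\<dots> \<le> e' * (norm h + C * norm h) / \<bar>d\<bar>"
        using 1 2 e'(1) by (intro divide_right_mono order_trans[OF 1] mult_left_mono) auto
      also have "\<dots> = (e' * (1 + C)) * norm h / \<bar>d\<bar>" by (simp add: algebra_simps)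
      also have "\<dots> \<le> (e * \<bar>d\<bar>) * norm h / \<bar>d\<bar>" using e'(3) by (intro divide_right_mono mult_right_mono) auto
      also have "\<dots> = e * norm h" using d by simp
      finally show ?case by (simp add: h_def k_def)
    qed
  qed
qed

lemma Cinf_on_frechet_derivative:
  assumes "Cinf_on W f" shows "Cinf_on W (\<lambda>x. frechet_derivative f (at x) v)"
  by (rule Cinf_on_I[OF Cinf_on_D(1)[OF assms] Ck_on_SucD(2)[OF Cinf_on_D(2)[OF assms]]])

text \<open>The implicit function \<open>y\<close> and its continuity are given; in the applications both come from a
  monotone scalar equation. The formula for the derivative of \<open>y\<close> is smooth in \<open>(x, y)\<close> near the graph,
  which starts the bootstrap.\<close>

lemma Cinf_on_implicit:
  fixes y :: "'a::euclidean_space \<Rightarrow> real"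
    and \<Phi> :: "'a \<times> real \<Rightarrow> real"
  assumes \<Phi>: "Cinf_on D \<Phi>" and W: "open W" and cont: "continuous_on W y"
    and dom: "\<And>x. x \<in> W \<Longrightarrow> (x, y x) \<in> D" and eq: "\<And>x. x \<in> W \<Longrightarrow> \<Phi> (x, y x) = 0"
    and partial: "\<And>x. x \<in> W \<Longrightarrow> ((\<lambda>t. \<Phi> (x, t)) has_real_derivative d x) (at (y x))"
    and d: "\<And>x. x \<in> W \<Longrightarrow> d x \<noteq> 0"
  shows "Cinf_on W y"
proof -
  let ?F = "\<lambda>q. frechet_derivative \<Phi> (at q)"
  have nz: "?F (x, y x) (0, 1) \<noteq> 0" if x: "x \<in> W" for x
  proof -
    have "(\<Phi> has_derivative ?F (x, y x)) (at (x, y x))"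
      using Cinf_on_D(4)[OF \<Phi> dom[OF x]] by (simp add: frechet_derivative_works)
    then have "((\<lambda>t. \<Phi> (x, t)) has_derivative (\<lambda>k. ?F (x, y x) (0, k))) (at (y x))"
      by (rule has_derivative_compose[OF has_derivative_Pair[OF has_derivative_const has_derivative_ident]])
    then have "(\<lambda>k. ?F (x, y x) (0, k)) = (*) (d x)"
      by (rule has_derivative_unique[OF _ partial[OF x, unfolded has_field_derivative_def]])
    from fun_cong[OF this, of 1] show ?thesis using d[OF x] by simp
  qed
  define D' where "D' = {q \<in> D. ?F q (0, 1) \<noteq> 0}"
  have F1: "Cinf_on D (\<lambda>q. ?F q v)" for v by (rule Cinf_on_frechet_derivative[OF \<Phi>])
  have "open D'" unfolding D'_def
    using continuous_open_preimage[OF Cinf_on_D(3)[OF F1[of "(0, 1)"]] Cinf_on_D(1)[OF \<Phi>], of "- {0}"]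
    by (simp add: vimage_def Int_def open_Compl)
  then have F: "Cinf_on D' (\<lambda>q. ?F q v)" for v
    by (rule Cinf_on_subset[OF F1]) (auto simp: D'_def)
  show ?thesis
  proof (rule Cinf_on_bootstrap[OF W, where D = D' and G = "\<lambda>v q. - ?F q (v, 0) / ?F q (0, 1)"])
    fix x assume x: "x \<in> W"
    have D: "(\<Phi> has_derivative ?F (x, y x)) (at (x, y x))"
      using Cinf_on_D(4)[OF \<Phi> dom[OF x]] by (simp add: frechet_derivative_works)
    have dec: "?F (x, y x) (h, k) = ?F (x, y x) (h, 0) + ?F (x, y x) (0, 1) * k" for h k
    proof -
      have l: "linear (?F (x, y x))" using D by (rule has_derivative_linear)
      have "?F (x, y x) ((h, 0) + k *\<^sub>R (0, 1)) = ?F (x, y x) (h, 0) + ?F (x, y x) (0, 1) * k"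
        unfolding linear_add[OF l] linear_scale[OF l] by simp
      then show ?thesis by (simp only: add_Pair scaleR_Pair) simp
    qed
    have lin: "?F (x, y x) q = (case q of (h, k) \<Rightarrow> ?F (x, y x) (h, 0) + ?F (x, y x) (0, 1) * k)" for q
    proof (cases q)
      case (Pair h k)
      show ?thesis unfolding Pair case_prod_conv by (rule dec)
    qed
    have HD: "(\<Phi> has_derivative (\<lambda>(h, k). ?F (x, y x) (h, 0) + ?F (x, y x) (0, 1) * k)) (at (x, y x))"
      by (rule has_derivative_eq_rhs[OF D ext[OF lin]])
    have HC: "continuous (at x) y" using cont W x by (simp add: continuous_on_eq_continuous_at)
    show "(y has_derivative (\<lambda>h. - ?F (x, y x) (h, 0) / ?F (x, y x) (0, 1))) (at x)"
      by (rule has_derivative_implicit[OF HD nz[OF x] W x HC eq])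
    show "(x, y x) \<in> D'" using dom[OF x] nz[OF x] by (simp add: D'_def)
  next
    show "Cinf_on D' (\<lambda>q. - ?F q (v, 0) / ?F q (0, 1))" for v
      by (intro Cinf_on_divide Cinf_on_minus F) (simp add: D'_def)
  qed simp
qed

section \<open>Confocal coordinates around a hyperbola\<close>

text \<open>Orthonormal coordinates in which the hyperbola has semi-axes \<open>sqrt a\<close> and \<open>sqrt c\<close>. The
  handedness of the frame is left open; it only enters through the signs \<open>eps\<close> below.\<close>

locale hyperbola_coordinates =
  fixes p u1 u2 u3 :: "real^3" and a c :: real
  assumes unit: "u1 \<bullet> u1 = 1" "u2 \<bullet> u2 = 1" "u3 \<bullet> u3 = 1"
    and orth: "u1 \<bullet> u2 = 0" "u1 \<bullet> u3 = 0" "u2 \<bullet> u3 = 0"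
    and expand: "\<And>x. x = (x \<bullet> u1) *\<^sub>R u1 + (x \<bullet> u2) *\<^sub>R u2 + (x \<bullet> u3) *\<^sub>R u3"
    and a: "a > 0" and c: "c > 0"
begin

lemma orth' [simp]: "u2 \<bullet> u1 = 0" "u3 \<bullet> u1 = 0" "u3 \<bullet> u2 = 0"
  using orth by (simp_all add: inner_commute)

declare unit [simp] orth [simp]

definition X1 :: "real^3 \<Rightarrow> real" where "X1 x = (x - p) \<bullet> u1"
definition X2 :: "real^3 \<Rightarrow> real" where "X2 x = (x - p) \<bullet> u2"
definition X3 :: "real^3 \<Rightarrow> real" where "X3 x = (x - p) \<bullet> u3"

lemma X_expand: "x = p + X1 x *\<^sub>R u1 + X2 x *\<^sub>R u2 + X3 x *\<^sub>R u3"
  using expand[of "x - p"] by (simp add: X1_def X2_def X3_def algebra_simps)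

lemma X_of [simp]:
  "X1 (p + s *\<^sub>R u1 + t *\<^sub>R u3) = s" "X2 (p + s *\<^sub>R u1 + t *\<^sub>R u3) = 0"
  "X3 (p + s *\<^sub>R u1 + t *\<^sub>R u3) = t"
  by (simp_all add: X1_def X2_def X3_def inner_add_left)

lemma X_deriv [derivative_intros]:
  "(X1 has_derivative (\<lambda>h. h \<bullet> u1)) (at x within S)"
  "(X2 has_derivative (\<lambda>h. h \<bullet> u2)) (at x within S)"
  "(X3 has_derivative (\<lambda>h. h \<bullet> u3)) (at x within S)"
  unfolding X1_def[abs_def] X2_def[abs_def] X3_def[abs_def]
  by (auto intro!: derivative_eq_intros)

lemma Cinf_X [intro!]:
  assumes "open W" shows "Cinf_on W X1" "Cinf_on W X2" "Cinf_on W X3"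
proof -
  have "Cinf_on W (\<lambda>x. (x - p) \<bullet> v)" for v
    unfolding inner_diff_left using assms
    by (intro Cinf_on_diff Cinf_on_const Cinf_on_linear bounded_linear_inner_left)
  then show "Cinf_on W X1" "Cinf_on W X2" "Cinf_on W X3"
    by (simp_all add: X1_def[abs_def] X2_def[abs_def] X3_def[abs_def])
qed

lemma continuous_X [continuous_intros]:
  "continuous_on S X1" "continuous_on S X2" "continuous_on S X3"
  unfolding X1_def[abs_def] X2_def[abs_def] X3_def[abs_def] by (auto intro!: continuous_intros)

definition H :: "(real^3) set" where "H = {x. (X1 x)\<^sup>2 / a - (X3 x)\<^sup>2 / c = 1 \<and> X2 x = 0}"

lemma closed_H: "closed H"
  unfolding H_def divide_inverse by (intro closed_Collect_conj closed_Collect_eq continuous_intros)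

lemma X1_nonzero_on_H: "x \<in> H \<Longrightarrow> X1 x \<noteq> 0"
proof
  assume "x \<in> H" "X1 x = 0"
  then have "- ((X3 x)\<^sup>2 / c) = 1" by (simp add: H_def)
  moreover have "(X3 x)\<^sup>2 / c \<ge> 0" using c by simp
  ultimately show False by linarith
qed

lemma open_X1_nonzero: "open {x. X1 x \<noteq> 0}"
  by (intro open_Collect_neq continuous_intros)

text \<open>For \<open>r \<noteq> 0\<close> the equation \<open>psi x r = (X2 x)\<^sup>2 / r\<close> says that \<open>x\<close> lies on the confocal quadric
  \<open>X1\<^sup>2 / (a - r) - X2\<^sup>2 / r - X3\<^sup>2 / (c + r) = 1\<close>.\<close>

definition psi :: "real^3 \<Rightarrow> real \<Rightarrow> real" where
  "psi x r = (X1 x)\<^sup>2 / (a - r) - (X3 x)\<^sup>2 / (c + r) - 1"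

lemma psi_strict_mono:
  assumes "X1 x \<noteq> 0" "- c < r" "r < s" "s < a"
  shows "psi x r < psi x s"
proof -
  have "(X1 x)\<^sup>2 / (a - r) < (X1 x)\<^sup>2 / (a - s)"
    using assms by (intro divide_strict_left_mono mult_pos_pos) auto
  moreover have "(X3 x)\<^sup>2 / (c + s) \<le> (X3 x)\<^sup>2 / (c + r)"
    using assms by (intro divide_left_mono mult_pos_pos) auto
  ultimately show ?thesis by (simp add: psi_def)
qed

lemma psi_mono: "X1 x \<noteq> 0 \<Longrightarrow> - c < r \<Longrightarrow> r \<le> s \<Longrightarrow> s < a \<Longrightarrow> psi x r \<le> psi x s"
  using psi_strict_mono[of x r s] by (cases "r = s") auto

lemma psi_deriv:
  assumes "- c < r" "r < a"
  shows "(psi x has_real_derivative (X1 x)\<^sup>2 / (a - r)\<^sup>2 + (X3 x)\<^sup>2 / (c + r)\<^sup>2) (at r)"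
  unfolding psi_def[abs_def] using assms
  by (auto intro!: derivative_eq_intros simp: power2_eq_square)

lemma continuous_psi: "- c < r \<Longrightarrow> s < a \<Longrightarrow> continuous_on {r..s} (psi x)"
  unfolding psi_def[abs_def] by (auto intro!: continuous_intros)

text \<open>Multiplied by \<open>r\<close>, the equation of the quadric also covers the limit \<open>r = 0\<close>, which occurs for the
  points of the plane \<open>X2 = 0\<close> on one side of the hyperbola and for the hyperbola itself.
  The condition \<open>psi x r \<ge> 0\<close> excludes the spurious solution \<open>r = 0\<close> on the other side.\<close>

definition confocal_root :: "real^3 \<Rightarrow> real \<Rightarrow> bool" where
  "confocal_root x r \<longleftrightarrow> 0 \<le> r \<and> r < a \<and> psi x r \<ge> 0 \<and> r * psi x r = (X2 x)\<^sup>2"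

text \<open>Where \<open>r\<close> and \<open>psi x r\<close> are nonnegative, their product is increasing in \<open>r\<close>. It starts at \<open>0\<close>, either
  at \<open>r = 0\<close> or at the zero of \<open>psi x\<close>, and is unbounded as \<open>r\<close> tends to \<open>a\<close>.\<close>

lemma confocal_root_exists:
  assumes x: "X1 x \<noteq> 0" shows "\<exists>r. confocal_root x r"
proof -
  \<comment> \<open>\<open>M\<close> and \<open>d\<close> are chosen so that \<open>psi x s \<ge> 2 X2\<^sup>2 / a\<close> and \<open>s \<ge> a / 2\<close> at \<open>s = a - d\<close>.\<close>
  define M where "M = (X3 x)\<^sup>2 / c + 1 + 2 * (X2 x)\<^sup>2 / a"
  have M: "M > 0" unfolding M_def using a c by (intro add_pos_nonneg add_nonneg_pos) auto
  define d where "d = min (a / 2) ((X1 x)\<^sup>2 / M)"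
  have d: "d > 0" "d \<le> a / 2" using a x M by (simp add: d_def) (unfold d_def, rule min.cobounded1)
  have dM: "M \<le> (X1 x)\<^sup>2 / d"
  proof -
    have "d \<le> (X1 x)\<^sup>2 / M" unfolding d_def by simp
    then show ?thesis using d M by (simp add: field_simps)
  qed
  define s where "s = a - d"
  have s: "a / 2 \<le> s" "s < a" unfolding s_def using d by auto
  have ps: "psi x s \<ge> 2 * (X2 x)\<^sup>2 / a"
  proof -
    have "(X3 x)\<^sup>2 / (c + s) \<le> (X3 x)\<^sup>2 / c"
      using a c s by (intro divide_left_mono mult_pos_pos) auto
    then show ?thesis using dM by (simp add: psi_def M_def s_def)
  qed
  have ps0: "psi x s \<ge> 0" using order_trans[OF _ ps] a by simp
  have ends: "(X2 x)\<^sup>2 \<le> s * psi x s"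
    using mult_mono[OF s(1) ps] s a ps0 by simp
  obtain t where t: "0 \<le> t" "t \<le> s" "psi x t \<ge> 0" "t * psi x t \<le> (X2 x)\<^sup>2"
  proof (cases "psi x 0 \<ge> 0")
    case True
    then show ?thesis using that[of 0] s a by auto
  next
    case False
    then obtain t where "0 \<le> t" "t \<le> s" "psi x t = 0"
      using IVT'[of "psi x" 0 0 s] ps0 s a c continuous_psi[of 0 s x] by force
    then show ?thesis using that[of t] by auto
  qed
  have "continuous_on {t..s} (\<lambda>r. r * psi x r)"
    using t s a c by (intro continuous_intros continuous_psi) auto
  then obtain r where r: "t \<le> r" "r \<le> s" "r * psi x r = (X2 x)\<^sup>2"
    using IVT'[of "\<lambda>r. r * psi x r" t "(X2 x)\<^sup>2" s] t(2,4) ends by blast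
  then have "psi x t \<le> psi x r" using t s c by (intro psi_mono[OF x]) auto
  then have "confocal_root x r" using r t s by (auto simp: confocal_root_def)
  then show ?thesis by blast
qed

lemma confocal_root_less:
  assumes x: "X1 x \<noteq> 0" and r: "confocal_root x r" "r < s" "s < a"
  shows "psi x s > 0" "s * psi x s > (X2 x)\<^sup>2"
proof -
  have 1: "psi x r < psi x s" using r c by (intro psi_strict_mono[OF x]) (auto simp: confocal_root_def)
  then show "psi x s > 0" using r by (auto simp: confocal_root_def)
  have "r * psi x r \<le> r * psi x s" using 1 r by (intro mult_left_mono) (auto simp: confocal_root_def)
  also have "\<dots> < s * psi x s" using r \<open>psi x s > 0\<close> by (intro mult_strict_right_mono) auto
  finally show "s * psi x s > (X2 x)\<^sup>2" using r by (simp add: confocal_root_def)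
qed

lemma confocal_root_unique:
  assumes x: "X1 x \<noteq> 0" and "confocal_root x r" "confocal_root x s" shows "r = s"
  using confocal_root_less(2)[OF x, of r s] confocal_root_less(2)[OF x, of s r] assms(2,3)
  by (cases r s rule: linorder_cases) (auto simp: confocal_root_def)

definition rho :: "real^3 \<Rightarrow> real" where "rho x = (THE r. confocal_root x r)"

lemma rho_eqI: "X1 x \<noteq> 0 \<Longrightarrow> confocal_root x r \<Longrightarrow> rho x = r"
  unfolding rho_def using confocal_root_unique by blast

lemma rho:
  assumes "X1 x \<noteq> 0"
  shows "confocal_root x (rho x)" "0 \<le> rho x" "rho x < a" "psi x (rho x) \<ge> 0"
    "rho x * psi x (rho x) = (X2 x)\<^sup>2"
proof -
  show *: "confocal_root x (rho x)" using confocal_root_exists[OF assms] rho_eqI[OF assms] by metis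
  then show "0 \<le> rho x" "rho x < a" "psi x (rho x) \<ge> 0" "rho x * psi x (rho x) = (X2 x)\<^sup>2"
    by (auto simp: confocal_root_def)
qed

lemma H_iff_rho: "X1 x \<noteq> 0 \<Longrightarrow> x \<in> H \<longleftrightarrow> rho x = 0 \<and> psi x (rho x) = 0"
proof
  assume x: "X1 x \<noteq> 0" and "x \<in> H"
  then have "psi x 0 = 0" "X2 x = 0" by (simp_all add: H_def psi_def)
  then have "confocal_root x 0" using a by (simp add: confocal_root_def)
  from rho_eqI[OF x this] \<open>psi x 0 = 0\<close> show "rho x = 0 \<and> psi x (rho x) = 0" by simp
next
  assume x: "X1 x \<noteq> 0" and "rho x = 0 \<and> psi x (rho x) = 0"
  then show "x \<in> H" using rho(5)[OF x] by (auto simp: H_def psi_def)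
qed

lemma continuous_on_psi_fixed: "continuous_on S (\<lambda>x. psi x r)"
  unfolding psi_def divide_inverse by (intro continuous_intros)

text \<open>Strict inequalities in the equation at fixed \<open>r\<close> persist for nearby points and confine the root. A lower
  bound needs \<open>r > 0\<close>, since at the hyperbola the left hand side degenerates at \<open>r = 0\<close>; there
  \<open>rho\<close> is still continuous, though not smooth.\<close>

lemma continuous_on_rho: "continuous_on {x. X1 x \<noteq> 0} rho"
proof (rule continuous_at_imp_continuous_on, clarify)
  fix x assume x: "X1 x \<noteq> 0"
  have ev: "\<forall>\<^sub>F y in at x. X1 y \<noteq> 0"
    using eventually_at_in_open'[OF open_X1_nonzero, of x] x by simp
  define Ph where "Ph r y = r * psi y r - (X2 y)\<^sup>2" for r y
  have cont: "(Ph r \<longlongrightarrow> Ph r x) (at x)" for r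
  proof -
    have "continuous_on UNIV (Ph r)" unfolding Ph_def[abs_def]
      by (intro continuous_intros continuous_on_psi_fixed)
    then show ?thesis by (simp add: continuous_on_eq_continuous_at continuous_at)
  qed
  have "(rho \<longlongrightarrow> rho x) (at x)"
  proof (rule order_tendstoI)
    fix l assume l: "l < rho x"
    show "\<forall>\<^sub>F y in at x. l < rho y"
    proof (cases "l < 0")
      case True
      from ev show ?thesis
      proof eventually_elim
        case (elim y)
        then show ?case using rho(2)[of y] True by simp
      qed
    next
      case False
      define m where "m = (l + rho x) / 2"
      have m: "l < m" "0 < m" "m < rho x" "m < a" using l False rho(3)[OF x] by (auto simp: m_def)
      have pm: "psi x m < psi x (rho x)" using m c rho(3)[OF x] by (intro psi_strict_mono[OF x]) auto
      have "m * psi x m < (X2 x)\<^sup>2"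
      proof (cases "psi x (rho x) = 0")
        case True
        then have "m * psi x m < 0" using pm m by (simp add: mult_pos_neg)
        then show ?thesis using zero_le_power2[of "X2 x"] by linarith
      next
        case False
        then have "psi x (rho x) > 0" using rho(4)[OF x] by simp
        have "m * psi x m < m * psi x (rho x)" using pm m by simp
        also have "\<dots> < rho x * psi x (rho x)" using m \<open>psi x (rho x) > 0\<close> by simp
        finally show ?thesis using rho(5)[OF x] by simp
      qed
      then have "Ph m x < 0" by (simp add: Ph_def)
      from order_tendstoD(2)[OF cont this] ev show ?thesis
      proof eventually_elim
        case (elim y)
        show ?case
        proof (rule ccontr)
          assume "\<not> l < rho y"
          then have "rho y < m" using m by simp
          from confocal_root_less(2)[OF elim(2) rho(1)[OF elim(2)] this m(4)] elim(1)
          show False by (simp add: Ph_def)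
        qed
      qed
    qed
  next
    fix u assume u: "rho x < u"
    define m where "m = min u ((rho x + a) / 2)"
    have m: "rho x < m" "m \<le> u" "m < a" using u rho(3)[OF x] by (auto simp: m_def min_def)
    have "Ph m x > 0" using confocal_root_less(2)[OF x rho(1)[OF x] m(1,3)] by (simp add: Ph_def)
    from order_tendstoD(1)[OF cont this] ev show "\<forall>\<^sub>F y in at x. rho y < u"
    proof eventually_elim
      case (elim y)
      show ?case
      proof (rule ccontr)
        assume "\<not> rho y < u"
        then have le: "m \<le> rho y" using m by simp
        have m0: "m > 0" using m rho(2)[OF x] by simp
        have "m * psi y m > 0" 
          using elim(1) zero_le_power2[of "X2 y"] unfolding Ph_def by linarith
        then have pm: "psi y m > 0" using m0 by (simp add: zero_less_mult_iff)
        have "psi y m \<le> psi y (rho y)" using le m0 c rho(3)[OF elim(2)] by (intro psi_mono[OF elim(2)]) auto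
        then have "m * psi y m \<le> rho y * psi y (rho y)" using le m0 pm by (intro mult_mono) auto
        then show False using elim rho(5)[OF elim(2)] by (simp add: Ph_def)
      qed
    qed
  qed
  then show "continuous (at x) rho" by (simp add: continuous_at)
qed

text \<open>The derivative of \<open>r psi x r\<close> at the root is \<open>psi x r\<close> plus \<open>r\<close> times a positive number, and it vanishes
  only if both \<open>r\<close> and \<open>psi x r\<close> do, that is, on the hyperbola.\<close>

lemma Cinf_rho: "Cinf_on ({x. X1 x \<noteq> 0} - H) rho"
proof -
  have W: "open ({x. X1 x \<noteq> 0} - H)" by (rule open_Diff[OF open_X1_nonzero closed_H])
  define D :: "((real^3) \<times> real) set" where "D = {q. - c < snd q} \<inter> {q. snd q < a}"
  have D: "open D" unfolding D_def by (intro open_Int open_Collect_less continuous_intros)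
  have C: "Cinf_on D (\<lambda>q. X1 (fst q))" "Cinf_on D (\<lambda>q. X2 (fst q))" "Cinf_on D (\<lambda>q. X3 (fst q))"
    "Cinf_on D (\<lambda>q. snd q)"
    by (rule Cinf_on_compose[OF _ Cinf_on_fst[OF D]], rule Cinf_X, rule open_UNIV, simp)+
      (rule Cinf_on_snd[OF D])
  show ?thesis
  proof (rule Cinf_on_implicit[OF _ W, where \<Phi> = "\<lambda>q. snd q * psi (fst q) (snd q) - (X2 (fst q))\<^sup>2"
        and D = D and d = "\<lambda>x. psi x (rho x) + rho x * ((X1 x)\<^sup>2 / (a - rho x)\<^sup>2 + (X3 x)\<^sup>2 / (c + rho x)\<^sup>2)"])
    show "Cinf_on D (\<lambda>q. snd q * psi (fst q) (snd q) - (X2 (fst q))\<^sup>2)"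
      unfolding psi_def
      by (intro Cinf_on_diff Cinf_on_mult Cinf_on_power Cinf_on_divide Cinf_on_add C Cinf_on_const D)
        (auto simp: D_def)
    show "continuous_on ({x. X1 x \<noteq> 0} - H) rho" by (rule continuous_on_subset[OF continuous_on_rho]) auto
  next
    fix x assume "x \<in> {x. X1 x \<noteq> 0} - H"
    then have x: "X1 x \<noteq> 0" "x \<notin> H" by auto
    note r = rho[OF x(1)]
    show "(x, rho x) \<in> D" using r c by (simp add: D_def)
    show "snd (x, rho x) * psi (fst (x, rho x)) (snd (x, rho x)) - (X2 (fst (x, rho x)))\<^sup>2 = 0"
      using r by simp
    show "((\<lambda>t. snd (x, t) * psi (fst (x, t)) (snd (x, t)) - (X2 (fst (x, t)))\<^sup>2) has_real_derivative
        psi x (rho x) + rho x * ((X1 x)\<^sup>2 / (a - rho x)\<^sup>2 + (X3 x)\<^sup>2 / (c + rho x)\<^sup>2)) (at (rho x))"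
      using r c by (auto intro!: derivative_eq_intros psi_deriv)
    have Q: "(X1 x)\<^sup>2 / (a - rho x)\<^sup>2 + (X3 x)\<^sup>2 / (c + rho x)\<^sup>2 > 0"
      using x r by (intro add_pos_nonneg divide_pos_pos) auto
    show "psi x (rho x) + rho x * ((X1 x)\<^sup>2 / (a - rho x)\<^sup>2 + (X3 x)\<^sup>2 / (c + rho x)\<^sup>2) \<noteq> 0"
    proof (cases "rho x = 0")
      case True
      then show ?thesis using H_iff_rho[OF x(1)] x(2) by simp
    next
      case False
      then have "rho x * ((X1 x)\<^sup>2 / (a - rho x)\<^sup>2 + (X3 x)\<^sup>2 / (c + rho x)\<^sup>2) > 0"
        using r Q by (intro mult_pos_pos) auto
      then show ?thesis using r(4) by linarith
    qed
  qed
qed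

section \<open>The orthogonal projection onto the hyperbola\<close>

text \<open>The point \<open>(P1, P3)\<close> of the hyperbola is the foot of a normal through \<open>(X1, X3)\<close> if
  \<open>X1 = P1 (1 + y / a)\<close> and \<open>X3 = P3 (1 - y / c)\<close> for some \<open>y\<close>. Solving for \<open>P1\<close> and \<open>P3\<close>, the equation
  of the hyperbola becomes an equation for \<open>y\<close>, which is monotone for \<open>- a < y < c\<close>.\<close>

definition foot_eqn :: "real^3 \<Rightarrow> real \<Rightarrow> real" where
  "foot_eqn x y = a * (X1 x)\<^sup>2 / (a + y)\<^sup>2 - c * (X3 x)\<^sup>2 / (c - y)\<^sup>2 - 1"

lemma foot_eqn_strict_antimono:
  assumes "X1 x \<noteq> 0" "- a < y" "y < z" "z < c"
  shows "foot_eqn x z < foot_eqn x y"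
proof -
  have "a * (X1 x)\<^sup>2 / (a + z)\<^sup>2 < a * (X1 x)\<^sup>2 / (a + y)\<^sup>2"
    using assms a by (intro divide_strict_left_mono mult_pos_pos power_strict_mono) auto
  moreover have "c * (X3 x)\<^sup>2 / (c - y)\<^sup>2 \<le> c * (X3 x)\<^sup>2 / (c - z)\<^sup>2"
    using assms c by (intro divide_left_mono mult_pos_pos power_mono) auto
  ultimately show ?thesis by (simp add: foot_eqn_def)
qed

text \<open>The left hand side of the equation for \<open>y\<close> decreases from \<open>\<infinity>\<close>, so a solution exists as soon as it
  becomes negative. In this form the condition is visibly open.\<close>

definition U :: "(real^3) set" where
  "U = {x. X1 x \<noteq> 0} \<inter> (\<Union>y\<in>{- a<..<c}. {x. foot_eqn x y < 0})"

lemma U_X1: "x \<in> U \<Longrightarrow> X1 x \<noteq> 0" by (simp add: U_def)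

lemma continuous_on_foot_eqn_fixed: "continuous_on S (\<lambda>x. foot_eqn x y)"
  unfolding foot_eqn_def divide_inverse by (intro continuous_intros)

lemma open_U: "open U"
  unfolding U_def
  by (intro open_Int open_X1_nonzero open_UN ballI open_Collect_less continuous_on_foot_eqn_fixed continuous_intros)

definition offset :: "real^3 \<Rightarrow> real" where
  "offset x = (THE y. - a < y \<and> y < c \<and> foot_eqn x y = 0)"

lemma offset_eqI:
  assumes "X1 x \<noteq> 0" "- a < y" "y < c" "foot_eqn x y = 0" shows "offset x = y"
  unfolding offset_def
proof (rule the_equality)
  show "z = y" if "- a < z \<and> z < c \<and> foot_eqn x z = 0" for z
    using foot_eqn_strict_antimono[OF assms(1), of z y] foot_eqn_strict_antimono[OF assms(1), of y z] assms that
    by (cases z y rule: linorder_cases) auto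
qed (use assms in auto)

lemma offset:
  assumes xU: "x \<in> U" shows "- a < offset x" "offset x < c" "foot_eqn x (offset x) = 0"
proof -
  have x: "X1 x \<noteq> 0" using U_X1[OF xU] .
  obtain z where z: "- a < z" "z < c" "foot_eqn x z < 0" using xU by (auto simp: U_def)
  \<comment> \<open>The constants make the left hand side nonnegative at \<open>- a + d\<close>; \<open>d \<le> 1\<close> serves to replace
    \<open>d\<^sup>2\<close> by \<open>d\<close>.\<close>
  define M where "M = (X3 x)\<^sup>2 / c + 1"
  have M: "M > 0" unfolding M_def using c by (intro add_nonneg_pos) auto
  define d where "d = min (min 1 (a / 2)) (a * (X1 x)\<^sup>2 / M)"
  have d: "d > 0" using a x M by (simp add: d_def)
  have d1: "d \<le> 1" "d \<le> a / 2" unfolding d_def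
    by (rule min.coboundedI1[OF min.cobounded1], rule min.coboundedI1[OF min.cobounded2])
  have "foot_eqn x (- a + d) \<ge> 0"
  proof -
    have "d \<le> a * (X1 x)\<^sup>2 / M" by (simp add: d_def)
    then have "M * d \<le> a * (X1 x)\<^sup>2" using M by (simp add: field_simps)
    moreover have "M * d\<^sup>2 \<le> M * d" using d d1 M by (simp add: power2_eq_square)
    ultimately have "M \<le> a * (X1 x)\<^sup>2 / d\<^sup>2" using d by (simp add: field_simps)
    moreover have "c * (X3 x)\<^sup>2 / (c + a - d)\<^sup>2 \<le> c * (X3 x)\<^sup>2 / c\<^sup>2"
      using d d1 a c by (intro divide_left_mono mult_pos_pos power_mono) auto
    moreover have "c * (X3 x)\<^sup>2 / c\<^sup>2 = (X3 x)\<^sup>2 / c" using c by (simp add: power2_eq_square)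
    ultimately show ?thesis by (simp add: foot_eqn_def M_def algebra_simps)
  qed
  moreover have "- a + d \<le> z"
  proof (rule ccontr)
    assume "\<not> - a + d \<le> z"
    then have "foot_eqn x (- a + d) < foot_eqn x z" using d d1 z a c by (intro foot_eqn_strict_antimono[OF x]) auto
    then show False using calculation z by simp
  qed
  moreover have "continuous_on {- a + d..z} (foot_eqn x)"
    unfolding foot_eqn_def[abs_def] using d z by (intro continuous_intros) auto
  ultimately obtain y where y: "- a + d \<le> y" "y \<le> z" "foot_eqn x y = 0"
    using IVT2'[of "foot_eqn x" z 0 "- a + d"] z(3) by force
  then have "offset x = y" using d z by (intro offset_eqI[OF x]) auto
  then show "- a < offset x" "offset x < c" "foot_eqn x (offset x) = 0" using y d z by auto
qed

lemma H_subset_U: "H \<subseteq> U" and offset_on_H: "x \<in> H \<Longrightarrow> offset x = 0"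
proof -
  have t: "foot_eqn x 0 = 0" if "x \<in> H" for x
    using that a c by (simp add: H_def foot_eqn_def power2_eq_square)
  show "H \<subseteq> U"
  proof
    fix x assume x: "x \<in> H"
    have "foot_eqn x (c / 2) < foot_eqn x 0" using c a by (intro foot_eqn_strict_antimono[OF X1_nonzero_on_H[OF x]]) auto
    then have "\<exists>y\<in>{- a<..<c}. foot_eqn x y < 0" using t[OF x] a c by (intro bexI[of _ "c / 2"]) auto
    then show "x \<in> U" using X1_nonzero_on_H[OF x] by (auto simp: U_def)
  qed
  show "offset x = 0" if "x \<in> H"
    using offset_eqI[OF X1_nonzero_on_H[OF that], of 0] t[OF that] a c by simp
qed

lemma continuous_on_offset: "continuous_on U offset"
proof (rule continuous_at_imp_continuous_on, clarify)
  fix x assume x: "x \<in> U"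
  have ev: "\<forall>\<^sub>F y in at x. y \<in> U" using eventually_at_in_open'[OF open_U x] .
  have cont: "((\<lambda>y. foot_eqn y r) \<longlongrightarrow> foot_eqn x r) (at x)" for r
    using continuous_on_foot_eqn_fixed[of UNIV r] by (simp add: continuous_on_eq_continuous_at continuous_at)
  note x1 = U_X1[OF x] and ox = offset[OF x]
  have "(offset \<longlongrightarrow> offset x) (at x)"
  proof (rule order_tendstoI)
    fix l assume l: "l < offset x"
    define m where "m = max l ((offset x - a) / 2)"
    have m: "l \<le> m" "- a < m" "m < offset x" using l ox by (auto simp: m_def max_def)
    have "foot_eqn x m > 0" using foot_eqn_strict_antimono[OF x1 m(2,3) ox(2)] ox by simp
    from order_tendstoD(1)[OF cont this] ev show "\<forall>\<^sub>F y in at x. l < offset y"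
    proof eventually_elim
      case (elim y)
      have "m < offset y"
        using foot_eqn_strict_antimono[OF U_X1[OF elim(2)], of "offset y" m] offset[OF elim(2)] elim(1) m ox
        by (cases "offset y" m rule: linorder_cases) auto
      then show ?case using m by simp
    qed
  next
    fix u assume u: "offset x < u"
    define m where "m = min u ((offset x + c) / 2)"
    have m: "m \<le> u" "offset x < m" "m < c" using u ox by (auto simp: m_def min_def)
    have "foot_eqn x m < 0" using foot_eqn_strict_antimono[OF x1 ox(1) m(2,3)] ox by simp
    from order_tendstoD(2)[OF cont this] ev show "\<forall>\<^sub>F y in at x. offset y < u"
    proof eventually_elim
      case (elim y)
      have "offset y < m"
        using foot_eqn_strict_antimono[OF U_X1[OF elim(2)], of m "offset y"] offset[OF elim(2)] elim(1) m ox
        by (cases "offset y" m rule: linorder_cases) auto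
      then show ?case using m by simp
    qed
  qed
  then show "continuous (at x) offset" by (simp add: continuous_at)
qed

lemma Cinf_offset: "Cinf_on U offset"
proof -
  define D :: "((real^3) \<times> real) set" where "D = {q. - a < snd q} \<inter> {q. snd q < c}"
  have D: "open D" unfolding D_def by (intro open_Int open_Collect_less continuous_intros)
  have C: "Cinf_on D (\<lambda>q. X1 (fst q))" "Cinf_on D (\<lambda>q. X3 (fst q))" "Cinf_on D (\<lambda>q. snd q)"
    by (rule Cinf_on_compose[OF _ Cinf_on_fst[OF D]], rule Cinf_X, rule open_UNIV, simp)+
      (rule Cinf_on_snd[OF D])
  show ?thesis
  proof (rule Cinf_on_implicit[OF _ open_U continuous_on_offset, where \<Phi> = "\<lambda>q. foot_eqn (fst q) (snd q)"
        and D = D and d = "\<lambda>x. - (2 * a * (X1 x)\<^sup>2 / (a + offset x) ^ 3 + 2 * c * (X3 x)\<^sup>2 / (c - offset x) ^ 3)"])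
    show "Cinf_on D (\<lambda>q. foot_eqn (fst q) (snd q))"
      unfolding foot_eqn_def
      by (intro Cinf_on_diff Cinf_on_mult Cinf_on_power Cinf_on_divide Cinf_on_add C Cinf_on_const D)
        (auto simp: D_def)
  next
    fix x assume x: "x \<in> U"
    note o = offset[OF x] and x1 = U_X1[OF x]
    show "(x, offset x) \<in> D" using o by (simp add: D_def)
    show "foot_eqn (fst (x, offset x)) (snd (x, offset x)) = 0" using o by simp
    show "((\<lambda>t. foot_eqn (fst (x, t)) (snd (x, t))) has_real_derivative
        - (2 * a * (X1 x)\<^sup>2 / (a + offset x) ^ 3 + 2 * c * (X3 x)\<^sup>2 / (c - offset x) ^ 3)) (at (offset x))"
    proof -
      have q: "((\<lambda>t. k / (g t)\<^sup>2) has_real_derivative - (2 * k * g') / g t ^ 3) (at t)"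
        if "(g has_real_derivative g') (at t)" "g t \<noteq> 0" for g g' k t
        using that by (auto intro!: derivative_eq_intros simp: field_simps eval_nat_numeral)
      have "((\<lambda>t. a * (X1 x)\<^sup>2 / (a + t)\<^sup>2 - c * (X3 x)\<^sup>2 / (c - t)\<^sup>2 - 1) has_real_derivative
          - (2 * (a * (X1 x)\<^sup>2) * 1) / (a + offset x) ^ 3 - - (2 * (c * (X3 x)\<^sup>2) * - 1) / (c - offset x) ^ 3 - 0)
          (at (offset x))"
        using o by (intro DERIV_diff q DERIV_const) (auto intro!: derivative_eq_intros)
      then show ?thesis by (simp add: foot_eqn_def algebra_simps)
    qed
    have "2 * a * (X1 x)\<^sup>2 / (a + offset x) ^ 3 > 0" using x1 o a by (intro divide_pos_pos) auto
    moreover have "2 * c * (X3 x)\<^sup>2 / (c - offset x) ^ 3 \<ge> 0" using o c by (intro divide_nonneg_pos) auto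
    ultimately show "- (2 * a * (X1 x)\<^sup>2 / (a + offset x) ^ 3 + 2 * c * (X3 x)\<^sup>2 / (c - offset x) ^ 3) \<noteq> 0"
      by linarith
  qed
qed

end

section \<open>The harmonic function in confocal coordinates\<close>

text \<open>The odd part of any primitive will do. Oddness is what makes the potential change sign together with
  \<open>u\<close> and \<open>w\<close>.\<close>

lemma odd_primitive_exists:
  fixes \<phi> :: "real \<Rightarrow> real"
  assumes a: "a > 0" and cont: "continuous_on {u. u\<^sup>2 < a} \<phi>" and even: "\<And>u. \<phi> (- u) = \<phi> u"
  shows "\<exists>K. (\<forall>u. K (- u) = - K u) \<and> (\<forall>u. u\<^sup>2 < a \<longrightarrow> (K has_real_derivative \<phi> u) (at u))"
proof -
  have dom: "- sqrt a < u \<and> u < sqrt a \<longleftrightarrow> u\<^sup>2 < a" for u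
    by (metis abs_less_iff minus_less_iff real_sqrt_abs real_sqrt_less_iff)
  have "open {u. u\<^sup>2 < a}" by (intro open_Collect_less continuous_intros)
  then have "isCont \<phi> u" if "u\<^sup>2 < a" for u
    using cont that by (simp add: continuous_on_eq_continuous_at)
  then have "\<exists>G. \<forall>u. ereal (- sqrt a) < ereal u \<longrightarrow> ereal u < ereal (sqrt a) \<longrightarrow>
      (G has_vector_derivative \<phi> u) (at u)"
    using a dom by (intro einterval_antiderivative) auto
  then obtain G where "\<And>u. - sqrt a < u \<and> u < sqrt a \<Longrightarrow> (G has_vector_derivative \<phi> u) (at u)"
    by auto
  then have G: "(G has_real_derivative \<phi> u) (at u)" if "u\<^sup>2 < a" for u
    using that dom by (simp add: has_real_derivative_iff_has_vector_derivative)
  define K where "K u = (G u - G (- u)) / 2" for u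
  have "(K has_real_derivative \<phi> u) (at u)" if u: "u\<^sup>2 < a" for u
  proof -
    have "((\<lambda>u. G (- u)) has_real_derivative \<phi> (- u) * - 1) (at u)"
      by (rule DERIV_chain2[OF G]) (use u in \<open>auto intro!: derivative_eq_intros\<close>)
    from DERIV_cdivide[OF DERIV_diff[OF G[OF u] this], of 2] show ?thesis
      by (simp add: K_def[abs_def] even)
  qed
  then show ?thesis by (intro exI[of _ K]) (auto simp: K_def field_simps)
qed

lemma Cinf_on_antiderivative:
  fixes f g :: "real \<Rightarrow> real"
  assumes "Cinf_on W g" "\<And>x. x \<in> W \<Longrightarrow> (f has_real_derivative g x) (at x)"
  shows "Cinf_on W f"
proof (rule Cinf_on_bootstrap[where D = "W \<times> UNIV" and G = "\<lambda>v q. g (fst q) * v"])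
  show W: "open W" using assms(1) by (rule Cinf_on_D)
  have "open (W \<times> (UNIV::real set))" using W by (intro open_Times) auto
  then show "Cinf_on (W \<times> (UNIV::real set)) (\<lambda>q. g (fst q) * (v::real))" for v
    by (intro Cinf_on_mult Cinf_on_const Cinf_on_compose[OF assms(1) Cinf_on_fst]) auto
  show "(f has_derivative (*) (g x)) (at x)" if "x \<in> W" for x
    using assms(2)[OF that] by (simp add: has_field_derivative_def)
qed auto

context hyperbola_coordinates
begin

text \<open>Gradient and Laplacian are defined by the standard basis; the sums over that basis collapse in the
  orthonormal frame.\<close>

lemma orthonormal_gradient_laplacian:
  assumes W: "open W" "x \<in> W"
    and f: "\<And>y. y \<in> W \<Longrightarrow> (f has_derivative (\<lambda>h. g1 y * (h \<bullet> u1) + g2 y * (h \<bullet> u2) + g3 y * (h \<bullet> u3))) (at y)"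
    and g: "(g1 has_derivative G1) (at x)" "(g2 has_derivative G2) (at x)" "(g3 has_derivative G3) (at x)"
  shows "gradient f x = g1 x *\<^sub>R u1 + g2 x *\<^sub>R u2 + g3 x *\<^sub>R u3"
    and "laplacian f x = G1 u1 + G2 u2 + G3 u3"
proof -
  have F: "frechet_derivative f (at y) b = g1 y * (b \<bullet> u1) + g2 y * (b \<bullet> u2) + g3 y * (b \<bullet> u3)"
    if "y \<in> W" for y b
    using fun_cong[OF frechet_derivative_at[OF f[OF that]], of b] by simp
  have rep: "(\<Sum>b\<in>Basis. (b \<bullet> v) *\<^sub>R b) = v" for v :: "real^3"
    using euclidean_representation[of v] by (simp add: inner_commute)
  have "gradient f x = g1 x *\<^sub>R (\<Sum>b\<in>Basis. (b \<bullet> u1) *\<^sub>R b) + g2 x *\<^sub>R (\<Sum>b\<in>Basis. (b \<bullet> u2) *\<^sub>R b)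
      + g3 x *\<^sub>R (\<Sum>b\<in>Basis. (b \<bullet> u3) *\<^sub>R b)"
    unfolding gradient_def F[OF W(2)] by (simp add: scaleR_add_left sum.distrib scaleR_sum_right)
  then show "gradient f x = g1 x *\<^sub>R u1 + g2 x *\<^sub>R u2 + g3 x *\<^sub>R u3" unfolding rep .
  have D: "frechet_derivative (\<lambda>y. frechet_derivative f (at y) b) (at x) b =
      G1 b * (b \<bullet> u1) + G2 b * (b \<bullet> u2) + G3 b * (b \<bullet> u3)" for b
  proof -
    have "((\<lambda>y. g1 y * (b \<bullet> u1) + g2 y * (b \<bullet> u2) + g3 y * (b \<bullet> u3)) has_derivative
        (\<lambda>h. G1 h * (b \<bullet> u1) + G2 h * (b \<bullet> u2) + G3 h * (b \<bullet> u3))) (at x)"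
      by (intro has_derivative_add has_derivative_mult_left g)
    then have "((\<lambda>y. frechet_derivative f (at y) b) has_derivative
        (\<lambda>h. G1 h * (b \<bullet> u1) + G2 h * (b \<bullet> u2) + G3 h * (b \<bullet> u3))) (at x)"
      by (rule has_derivative_transform_within_open[OF _ W]) (simp add: F)
    from fun_cong[OF frechet_derivative_at[OF this], of b] show ?thesis by simp
  qed
  have L: "(\<Sum>b\<in>Basis. G b * (b \<bullet> v)) = G v" if "(g has_derivative G) (at x)" for g G and v :: "real^3"
  proof -
    have l: "linear G" using that by (rule has_derivative_linear)
    have "G v = G (\<Sum>b\<in>Basis. (b \<bullet> v) *\<^sub>R b)" unfolding rep ..
    then show ?thesis by (simp add: linear_sum[OF l] linear_scale[OF l] mult.commute)
  qed
  show "laplacian f x = G1 u1 + G2 u2 + G3 u3"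
    unfolding laplacian_def D by (simp add: sum.distrib L[OF g(1)] L[OF g(2)] L[OF g(3)])
qed

text \<open>The weight of the elliptic integrals \<open>K0\<close>, \<open>K1\<close>, \<open>K3\<close> below.\<close>

definition I :: "real \<Rightarrow> real" where "I u = 1 / sqrt ((a - u\<^sup>2) * (c + u\<^sup>2))"

definition primitive :: "(real \<Rightarrow> real) \<Rightarrow> real \<Rightarrow> real" where
  "primitive \<phi> = (SOME K. (\<forall>u. K (- u) = - K u) \<and>
     (\<forall>u. u\<^sup>2 < a \<longrightarrow> (K has_real_derivative \<phi> u) (at u)))"

definition K0 :: "real \<Rightarrow> real" where "K0 = primitive I"
definition K1 :: "real \<Rightarrow> real" where "K1 = primitive (\<lambda>u. I u / (a - u\<^sup>2))"
definition K3 :: "real \<Rightarrow> real" where "K3 = primitive (\<lambda>u. I u / (c + u\<^sup>2))"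

lemma open_dom: "open {u. u\<^sup>2 < a}"
  by (intro open_Collect_less continuous_intros)

lemma c_plus_pos: "c + (u::real)\<^sup>2 > 0" using c by (intro add_pos_nonneg) auto

lemma Cinf_I: "Cinf_on {u. u\<^sup>2 < a} I"
  unfolding I_def[abs_def] using c_plus_pos
  by (intro Cinf_on_divide Cinf_on_sqrt Cinf_on_mult Cinf_on_diff Cinf_on_add Cinf_on_power
      Cinf_on_const Cinf_on_id open_dom) (auto simp: less_imp_neq[symmetric])

lemma I_even [simp]: "I (- u) = I u" by (simp add: I_def)

lemma DERIV_I:
  assumes "u\<^sup>2 < a"
  shows "(I has_real_derivative I u * u * (1 / (a - u\<^sup>2) - 1 / (c + u\<^sup>2))) (at u)"
proof -
  define P where "P = (a - u\<^sup>2) * (c + u\<^sup>2)"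
  have P: "P > 0" using assms c_plus_pos[of u] by (simp add: P_def)
  have "((\<lambda>u. (a - u\<^sup>2) * (c + u\<^sup>2)) has_real_derivative (a - u\<^sup>2) * (2 * u) - 2 * u * (c + u\<^sup>2)) (at u)"
    by (auto intro!: derivative_eq_intros)
  then have "((\<lambda>u. sqrt ((a - u\<^sup>2) * (c + u\<^sup>2))) has_real_derivative
      inverse (sqrt P) / 2 * ((a - u\<^sup>2) * (2 * u) - 2 * u * (c + u\<^sup>2))) (at u)"
    using P unfolding P_def by (intro DERIV_chain2[OF DERIV_real_sqrt])
  then have "(I has_real_derivative - (inverse (sqrt P) * (inverse (sqrt P) / 2 *
      ((a - u\<^sup>2) * (2 * u) - 2 * u * (c + u\<^sup>2))) * inverse (sqrt P))) (at u)"
    unfolding I_def[abs_def] inverse_eq_divide[symmetric] P_def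
    by (rule DERIV_inverse') (use assms c_plus_pos[of u] in auto)
  also have "- (inverse (sqrt P) * (inverse (sqrt P) / 2 * ((a - u\<^sup>2) * (2 * u) - 2 * u * (c + u\<^sup>2)))
        * inverse (sqrt P)) = I u * u * (((c + u\<^sup>2) - (a - u\<^sup>2)) / P)"
  proof -
    define s where "s = sqrt P"
    have s: "s > 0" "P = s * s" using P by (simp_all add: s_def)
    show ?thesis unfolding I_def P_def[symmetric] s_def[symmetric] unfolding s(2)
      using s(1) by (simp add: field_simps)
  qed
  also have "((c + u\<^sup>2) - (a - u\<^sup>2)) / P = 1 / (a - u\<^sup>2) - 1 / (c + u\<^sup>2)"
    using assms c_plus_pos[of u] by (simp add: P_def diff_frac_eq)
  finally show ?thesis .
qed

lemma primitive:
  assumes "Cinf_on {u. u\<^sup>2 < a} \<phi>" "\<And>u. \<phi> (- u) = \<phi> u"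
  shows "primitive \<phi> (- u) = - primitive \<phi> u"
    and "u\<^sup>2 < a \<Longrightarrow> (primitive \<phi> has_real_derivative \<phi> u) (at u)"
    and "Cinf_on {u. u\<^sup>2 < a} (primitive \<phi>)"
proof -
  have *: "(\<forall>u. primitive \<phi> (- u) = - primitive \<phi> u) \<and>
     (\<forall>u. u\<^sup>2 < a \<longrightarrow> (primitive \<phi> has_real_derivative \<phi> u) (at u))"
    unfolding primitive_def
    by (rule someI_ex[OF odd_primitive_exists[OF a Cinf_on_D(3)[OF assms(1)] assms(2)]])
  then show "primitive \<phi> (- u) = - primitive \<phi> u"
    and "u\<^sup>2 < a \<Longrightarrow> (primitive \<phi> has_real_derivative \<phi> u) (at u)" by blast+
  show "Cinf_on {u. u\<^sup>2 < a} (primitive \<phi>)"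
    by (rule Cinf_on_antiderivative[OF assms(1)]) (use * in blast)
qed

lemma Cinf_integrands:
  "Cinf_on {u. u\<^sup>2 < a} (\<lambda>u. I u / (a - u\<^sup>2))" "Cinf_on {u. u\<^sup>2 < a} (\<lambda>u. I u / (c + u\<^sup>2))"
  using c_plus_pos
  by (intro Cinf_on_divide Cinf_I Cinf_on_diff Cinf_on_add Cinf_on_power
      Cinf_on_const Cinf_on_id open_dom; auto simp: less_imp_neq[symmetric])+

lemma K_odd [simp]: "K0 (- u) = - K0 u" "K1 (- u) = - K1 u" "K3 (- u) = - K3 u"
  unfolding K0_def K1_def K3_def by (rule primitive(1); simp add: Cinf_I Cinf_integrands)+

lemma DERIV_K:
  assumes "u\<^sup>2 < a"
  shows "(K0 has_real_derivative I u) (at u)"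
    "(K1 has_real_derivative I u / (a - u\<^sup>2)) (at u)" "(K3 has_real_derivative I u / (c + u\<^sup>2)) (at u)"
  unfolding K0_def K1_def K3_def
  using primitive(2)[OF Cinf_I I_even assms] primitive(2)[OF Cinf_integrands(1) _ assms]
    primitive(2)[OF Cinf_integrands(2) _ assms] by simp_all

lemma Cinf_K: "Cinf_on {u. u\<^sup>2 < a} K0" "Cinf_on {u. u\<^sup>2 < a} K1" "Cinf_on {u. u\<^sup>2 < a} K3"
  unfolding K0_def K1_def K3_def by (rule primitive(3); simp add: Cinf_I Cinf_integrands)+

text \<open>The finite part at \<open>t = 0\<close> of the integral from \<open>0\<close> to \<open>u\<close> of \<open>(X2\<^sup>2 / t\<^sup>2 - psi x (t\<^sup>2)) I t\<close>. The identity
  \<open>(I t / t)' = I t / (a - t\<^sup>2) - I t / (c + t\<^sup>2) - I t / t\<^sup>2\<close> removes the singular term, and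
  \<open>X2 = u w\<close> then removes the division by \<open>u\<close>.\<close>

definition potential :: "real^3 \<Rightarrow> real \<Rightarrow> real \<Rightarrow> real" where
  "potential x u w = K0 u + ((X2 x)\<^sup>2 - (X1 x)\<^sup>2) * K1 u + ((X3 x)\<^sup>2 - (X2 x)\<^sup>2) * K3 u - X2 x * w * I u"

text \<open>A smooth choice of the sign of \<open>(u, w)\<close> on the open set \<open>W\<close>.\<close>

definition branch :: "(real^3) set \<Rightarrow> (real^3 \<Rightarrow> real) \<Rightarrow> (real^3 \<Rightarrow> real) \<Rightarrow> bool" where
  "branch W u w \<longleftrightarrow> Cinf_on W u \<and> Cinf_on W w \<and>
    (\<forall>x\<in>W. X1 x \<noteq> 0 \<and> x \<notin> H \<and> (u x)\<^sup>2 < a \<and> u x * w x = X2 x \<and> (w x)\<^sup>2 = psi x ((u x)\<^sup>2))"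

lemma branchD:
  assumes "branch W u w"
  shows "open W" "Cinf_on W u" "Cinf_on W w"
    and "x \<in> W \<Longrightarrow> X1 x \<noteq> 0" "x \<in> W \<Longrightarrow> x \<notin> H" "x \<in> W \<Longrightarrow> (u x)\<^sup>2 < a"
      "x \<in> W \<Longrightarrow> u x * w x = X2 x" "x \<in> W \<Longrightarrow> (w x)\<^sup>2 = psi x ((u x)\<^sup>2)"
  using assms Cinf_on_D(1)[of W u] unfolding branch_def by auto

lemma branch_rho:
  assumes "branch W u w" "x \<in> W" shows "rho x = (u x)\<^sup>2" "psi x (rho x) = (w x)\<^sup>2"
proof -
  note b = branchD(4-8)[OF assms]
  have "confocal_root x ((u x)\<^sup>2)"
    unfolding confocal_root_def b(5)[symmetric] b(4)[symmetric] using b(3) by (simp add: power_mult_distrib)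
  then show "rho x = (u x)\<^sup>2" by (rule rho_eqI[OF b(1)])
  then show "psi x (rho x) = (w x)\<^sup>2" using b by simp
qed

lemma Cinf_potential:
  assumes "branch W u w" shows "Cinf_on W (\<lambda>x. potential x (u x) (w x))"
proof -
  note b = branchD[OF assms]
  have "Cinf_on W (\<lambda>x. F (u x))" if "Cinf_on {u. u\<^sup>2 < a} F" for F
    by (rule Cinf_on_compose[OF that b(2)]) (use b(6) in auto)
  note Cu = this[OF Cinf_K(1)] this[OF Cinf_K(2)] this[OF Cinf_K(3)] this[OF Cinf_I]
  show ?thesis unfolding potential_def
    by (intro Cinf_on_diff Cinf_on_add Cinf_on_mult Cinf_on_power Cinf_X Cu b(1,2,3))
qed

text \<open>Differentiating \<open>u w = X2\<close> and \<open>w\<^sup>2 = psi x (u\<^sup>2)\<close> gives two linear equations for the differentials of \<open>u\<close>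
  and \<open>w\<close>; their determinant is positive off the hyperbola.\<close>

lemma branch_derivatives:
  fixes u w :: "real^3 \<Rightarrow> real"
  assumes br: "branch W u w" and x: "x \<in> W"
  defines "Du \<equiv> frechet_derivative u (at x)" and "Dw \<equiv> frechet_derivative w (at x)"
    and "a1 \<equiv> X1 x / (a - (u x)\<^sup>2)" and "a3 \<equiv> X3 x / (c + (u x)\<^sup>2)"
  shows "(u has_derivative Du) (at x)" "(w has_derivative Dw) (at x)"
    and "w x * Du h + u x * Dw h = h \<bullet> u2"
    and "w x * Dw h - u x * (a1\<^sup>2 + a3\<^sup>2) * Du h = a1 * (h \<bullet> u1) - a3 * (h \<bullet> u3)"
    and "(w x)\<^sup>2 + (u x)\<^sup>2 * (a1\<^sup>2 + a3\<^sup>2) > 0"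
proof -
  note b = branchD(4-8)[OF br]
  show Du: "(u has_derivative Du) (at x)" and Dw: "(w has_derivative Dw) (at x)"
    unfolding Du_def Dw_def
    using Cinf_on_D(4)[OF branchD(2)[OF br] x] Cinf_on_D(4)[OF branchD(3)[OF br] x]
    by (simp_all add: frechet_derivative_works)
  have "((\<lambda>y. u y * w y) has_derivative (\<lambda>h. u x * Dw h + Du h * w x)) (at x)"
    by (rule has_derivative_mult[OF Du Dw])
  then have "(X2 has_derivative (\<lambda>h. u x * Dw h + Du h * w x)) (at x)"
    by (rule has_derivative_transform_within_open[OF _ branchD(1)[OF br] x]) (use b in auto)
  from fun_cong[OF has_derivative_unique[OF this X_deriv(2)], of h]
  show "w x * Du h + u x * Dw h = h \<bullet> u2" by (simp add: algebra_simps)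
  have ne: "a - (u x)\<^sup>2 \<noteq> 0" "c + (u x)\<^sup>2 \<noteq> 0" using b(3)[OF x] c_plus_pos[of "u x"] by auto
  have "((\<lambda>y. X1 y * X1 y / (a - u y * u y) - X3 y * X3 y / (c + u y * u y) - 1) has_derivative
      (\<lambda>h. 2 * a1 * (h \<bullet> u1) + 2 * u x * a1\<^sup>2 * Du h - (2 * a3 * (h \<bullet> u3) - 2 * u x * a3\<^sup>2 * Du h))) (at x)"
  proof -
    have qa: "((\<lambda>t. 1 / (a - t * t)) has_real_derivative 2 * u x / (a - (u x)\<^sup>2)\<^sup>2) (at (u x))"
      using ne by (auto intro!: derivative_eq_intros simp: power2_eq_square)
    have qc: "((\<lambda>t. 1 / (c + t * t)) has_real_derivative - 2 * u x / (c + (u x)\<^sup>2)\<^sup>2) (at (u x))"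
      using ne by (auto intro!: derivative_eq_intros simp: power2_eq_square)
    have "((\<lambda>y. X1 y * X1 y * (1 / (a - u y * u y)) - X3 y * X3 y * (1 / (c + u y * u y)) - 1) has_derivative
      (\<lambda>h. (X1 x * X1 x * (Du h * (2 * u x / (a - (u x)\<^sup>2)\<^sup>2)) + (X1 x * (h \<bullet> u1) + (h \<bullet> u1) * X1 x) * (1 / (a - u x * u x)))
       - (X3 x * X3 x * (Du h * (- 2 * u x / (c + (u x)\<^sup>2)\<^sup>2)) + (X3 x * (h \<bullet> u3) + (h \<bullet> u3) * X3 x) * (1 / (c + u x * u x))) - 0)) (at x)"
      by (intro has_derivative_diff has_derivative_mult X_deriv has_derivative_const
          DERIV_compose_FDERIV[OF qa Du] DERIV_compose_FDERIV[OF qc Du])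
    then show ?thesis
      by (simp add: a1_def a3_def power_divide) (simp add: power2_eq_square algebra_simps)
  qed
  then have "((\<lambda>y. w y * w y) has_derivative
      (\<lambda>h. 2 * a1 * (h \<bullet> u1) + 2 * u x * a1\<^sup>2 * Du h - (2 * a3 * (h \<bullet> u3) - 2 * u x * a3\<^sup>2 * Du h))) (at x)"
    by (rule has_derivative_transform_within_open[OF _ branchD(1)[OF br] x])
      (use b(5) in \<open>simp add: psi_def power2_eq_square\<close>)
  from fun_cong[OF has_derivative_unique[OF this has_derivative_mult[OF Dw Dw]], of h]
  show "w x * Dw h - u x * (a1\<^sup>2 + a3\<^sup>2) * Du h = a1 * (h \<bullet> u1) - a3 * (h \<bullet> u3)"
    by (simp add: algebra_simps)
  have Q: "a1\<^sup>2 + a3\<^sup>2 > 0" using b(1)[OF x] ne by (auto simp: a1_def intro!: add_pos_nonneg)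
  have "w x \<noteq> 0 \<or> u x \<noteq> 0"
    using H_iff_rho[OF b(1)[OF x]] b(2)[OF x] branch_rho[OF br x] by auto
  then show "(w x)\<^sup>2 + (u x)\<^sup>2 * (a1\<^sup>2 + a3\<^sup>2) > 0"
    using Q add_pos_nonneg[of "(w x)\<^sup>2" "(u x)\<^sup>2 * (a1\<^sup>2 + a3\<^sup>2)"]
      add_nonneg_pos[of "(w x)\<^sup>2" "(u x)\<^sup>2 * (a1\<^sup>2 + a3\<^sup>2)"] by auto
qed

text \<open>The integrand vanishes at the upper limit: the partial derivative of the potential by \<open>u\<close> is
  \<open>- w\<^sup>2 I u\<close>, the one by \<open>w\<close> is \<open>- u w I u\<close>, and \<open>w Du + u Dw\<close> is the differential of \<open>X2\<close>.
  Hence the derivatives of \<open>u\<close> and \<open>w\<close> drop out of the gradient.\<close>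

lemma has_derivative_potential:
  assumes br: "branch W u w" and x: "x \<in> W"
  shows "((\<lambda>x. potential x (u x) (w x)) has_derivative
    (\<lambda>h. - 2 * X1 x * K1 (u x) * (h \<bullet> u1) + (2 * X2 x * (K1 (u x) - K3 (u x)) - 2 * w x * I (u x)) * (h \<bullet> u2)
      + 2 * X3 x * K3 (u x) * (h \<bullet> u3))) (at x)"
proof -
  note d = branch_derivatives[OF br x]
  define Du Dw where "Du = frechet_derivative u (at x)" and "Dw = frechet_derivative w (at x)"
  define al ga i where "al = 1 / (a - (u x)\<^sup>2)" and "ga = 1 / (c + (u x)\<^sup>2)" and "i = I (u x)"
  have u: "(u x)\<^sup>2 < a" using branchD(6)[OF br x] .
  have [derivative_intros]: "(u has_derivative Du) (at x)" "(w has_derivative Dw) (at x)"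
    using d(1,2) by (simp_all add: Du_def Dw_def)
  note DK = DERIV_compose_FDERIV[OF DERIV_K(1)[OF u] d(1)] DERIV_compose_FDERIV[OF DERIV_K(2)[OF u] d(1)]
    DERIV_compose_FDERIV[OF DERIV_K(3)[OF u] d(1)] DERIV_compose_FDERIV[OF DERIV_I[OF u] d(1)]
  have [derivative_intros]:
    "((\<lambda>x. K0 (u x)) has_derivative (\<lambda>h. Du h * i)) (at x)"
    "((\<lambda>x. K1 (u x)) has_derivative (\<lambda>h. Du h * (i * al))) (at x)"
    "((\<lambda>x. K3 (u x)) has_derivative (\<lambda>h. Du h * (i * ga))) (at x)"
    "((\<lambda>x. I (u x)) has_derivative (\<lambda>h. Du h * (i * u x * (al - ga)))) (at x)"
    using DK by (simp_all add: Du_def al_def ga_def i_def)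
  have r1: "w x * Du h + u x * Dw h = h \<bullet> u2" for h using d(3)[of h] by (simp add: Du_def Dw_def)
  have r2: "u x * w x = X2 x" using branchD(7)[OF br x] .
  have r3: "(w x)\<^sup>2 = (X1 x)\<^sup>2 * al - (X3 x)\<^sup>2 * ga - 1"
    using branchD(8)[OF br x] by (simp add: psi_def al_def ga_def)
  have alg: "Du h * i + (((X2 x)\<^sup>2 - (X1 x)\<^sup>2) * (Du h * (i * al)) + (2 * X2 x * (h \<bullet> u2) - 2 * X1 x * (h \<bullet> u1)) * K1 (u x))
      + (((X3 x)\<^sup>2 - (X2 x)\<^sup>2) * (Du h * (i * ga)) + (2 * X3 x * (h \<bullet> u3) - 2 * X2 x * (h \<bullet> u2)) * K3 (u x))
      - (X2 x * w x * (Du h * (i * u x * (al - ga))) + (X2 x * Dw h + (h \<bullet> u2) * w x) * i)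
    = - 2 * X1 x * K1 (u x) * (h \<bullet> u1) + (2 * X2 x * (K1 (u x) - K3 (u x)) - 2 * w x * i) * (h \<bullet> u2)
      + 2 * X3 x * K3 (u x) * (h \<bullet> u3)" for h
  proof -
    have t: "((X2 x)\<^sup>2 - (X1 x)\<^sup>2) * (Du h * (i * al)) = (X2 x)\<^sup>2 * Du h * i * al - Du h * i * ((w x)\<^sup>2 + 1 + (X3 x)\<^sup>2 * ga)"
      unfolding r3 by (simp add: algebra_simps)
    show ?thesis unfolding t unfolding r2[symmetric] r1[symmetric] by (simp add: algebra_simps power2_eq_square)
  qed
  have "((\<lambda>x. potential x (u x) (w x)) has_derivative (\<lambda>h.
      Du h * i + (((X2 x)\<^sup>2 - (X1 x)\<^sup>2) * (Du h * (i * al)) + (2 * X2 x * (h \<bullet> u2) - 2 * X1 x * (h \<bullet> u1)) * K1 (u x))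
      + (((X3 x)\<^sup>2 - (X2 x)\<^sup>2) * (Du h * (i * ga)) + (2 * X3 x * (h \<bullet> u3) - 2 * X2 x * (h \<bullet> u2)) * K3 (u x))
      - (X2 x * w x * (Du h * (i * u x * (al - ga))) + (X2 x * Dw h + (h \<bullet> u2) * w x) * i))) (at x)"
    unfolding potential_def i_def[symmetric]
    by (auto intro!: derivative_eq_intros simp: i_def fun_eq_iff algebra_simps)
  then show ?thesis unfolding alg unfolding i_def .
qed

text \<open>The terms with elliptic integrals in the Laplacian cancel identically. The remaining boundary terms
  cancel because the linear equations for the differentials of \<open>u\<close> and \<open>w\<close> can be solved for the
  three directional derivatives which occur.\<close>

lemma potential_gradient_harmonic:
  assumes br: "branch W u w" and x: "x \<in> W"
  shows "gradient (\<lambda>x. potential x (u x) (w x)) x = (- 2 * X1 x * K1 (u x)) *\<^sub>R u1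
      + (2 * X2 x * (K1 (u x) - K3 (u x)) - 2 * w x * I (u x)) *\<^sub>R u2 + (2 * X3 x * K3 (u x)) *\<^sub>R u3"
    and "laplacian (\<lambda>x. potential x (u x) (w x)) x = 0"
proof -
  note d = branch_derivatives[OF br x]
  define Du Dw where "Du = frechet_derivative u (at x)" and "Dw = frechet_derivative w (at x)"
  define al ga i where "al = 1 / (a - (u x)\<^sup>2)" and "ga = 1 / (c + (u x)\<^sup>2)" and "i = I (u x)"
  have u: "(u x)\<^sup>2 < a" using branchD(6)[OF br x] .
  have [derivative_intros]: "(u has_derivative Du) (at x)" "(w has_derivative Dw) (at x)"
    using d(1,2) by (simp_all add: Du_def Dw_def)
  note DK = DERIV_compose_FDERIV[OF DERIV_K(2)[OF u] d(1)]
    DERIV_compose_FDERIV[OF DERIV_K(3)[OF u] d(1)] DERIV_compose_FDERIV[OF DERIV_I[OF u] d(1)]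
  have [derivative_intros]:
    "((\<lambda>x. K1 (u x)) has_derivative (\<lambda>h. Du h * (i * al))) (at x)"
    "((\<lambda>x. K3 (u x)) has_derivative (\<lambda>h. Du h * (i * ga))) (at x)"
    "((\<lambda>x. I (u x)) has_derivative (\<lambda>h. Du h * (i * u x * (al - ga)))) (at x)"
    using DK by (simp_all add: Du_def al_def ga_def i_def)
  have g1: "((\<lambda>x. - 2 * X1 x * K1 (u x)) has_derivative
      (\<lambda>h. - 2 * (h \<bullet> u1) * K1 (u x) - 2 * X1 x * (Du h * (i * al)))) (at x)"
    by (auto intro!: derivative_eq_intros simp: fun_eq_iff)
  have g2: "((\<lambda>x. 2 * X2 x * (K1 (u x) - K3 (u x)) - 2 * w x * I (u x)) has_derivative
      (\<lambda>h. 2 * (h \<bullet> u2) * (K1 (u x) - K3 (u x)) + 2 * X2 x * (Du h * (i * al) - Du h * (i * ga))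
        - (2 * Dw h * i + 2 * w x * (Du h * (i * u x * (al - ga)))))) (at x)"
    by (auto intro!: derivative_eq_intros simp: fun_eq_iff i_def)
  have g3: "((\<lambda>x. 2 * X3 x * K3 (u x)) has_derivative
      (\<lambda>h. 2 * (h \<bullet> u3) * K3 (u x) + 2 * X3 x * (Du h * (i * ga)))) (at x)"
    by (auto intro!: derivative_eq_intros simp: fun_eq_iff)
  note gl = orthonormal_gradient_laplacian[OF branchD(1)[OF br] x has_derivative_potential[OF br] g1 g2 g3]
  show "gradient (\<lambda>x. potential x (u x) (w x)) x = (- 2 * X1 x * K1 (u x)) *\<^sub>R u1
      + (2 * X2 x * (K1 (u x) - K3 (u x)) - 2 * w x * I (u x)) *\<^sub>R u2 + (2 * X3 x * K3 (u x)) *\<^sub>R u3"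
    by (rule gl(1))
  define a1 a3 N where "a1 = X1 x * al" and "a3 = X3 x * ga" and "N = (w x)\<^sup>2 + (u x)\<^sup>2 * (a1\<^sup>2 + a3\<^sup>2)"
  have N: "N > 0" using d(5) by (simp add: N_def a1_def a3_def al_def ga_def)
  have e1: "w x * Du h + u x * Dw h = h \<bullet> u2" for h using d(3)[of h] by (simp add: Du_def Dw_def)
  have e2: "w x * Dw h - u x * (a1\<^sup>2 + a3\<^sup>2) * Du h = a1 * (h \<bullet> u1) - a3 * (h \<bullet> u3)" for h
    using d(4)[of h] by (simp add: Du_def Dw_def a1_def a3_def al_def ga_def)
  have s1: "N * Du u1 = - u x * a1" using e1[of u1] e2[of u1] unfolding N_def orth unit by algebra
  have s3: "N * Du u3 = u x * a3" using e1[of u3] e2[of u3] unfolding N_def orth' unit by (simp; algebra)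
  have s2: "N * Dw u2 = u x * (a1\<^sup>2 + a3\<^sup>2)" using e1[of u2] e2[of u2] unfolding N_def by (simp; algebra)
  have r2: "u x * w x = X2 x" using branchD(7)[OF br x] .
  have L: "laplacian (\<lambda>x. potential x (u x) (w x)) x =
      2 * i * (- a1 * Du u1 + a3 * Du u3 - Dw u2)"
    by (rule trans[OF gl(2)]) (simp_all add: a1_def a3_def r2[symmetric] algebra_simps)
  have "N * (- a1 * Du u1 + a3 * Du u3 - Dw u2) = - a1 * (N * Du u1) + a3 * (N * Du u3) - N * Dw u2"
    by (simp add: algebra_simps)
  also have "\<dots> = 0" unfolding s1 s2 s3 by (simp add: algebra_simps power2_eq_square)
  finally show "laplacian (\<lambda>x. potential x (u x) (w x)) x = 0" unfolding L using N by simp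
qed

end

section \<open>The tubular neighbourhood\<close>

text \<open>Near each point a smooth curve agrees with a \<open>C\<^sup>1\<close> function on an open set, and the
  derivatives of the two coincide there.\<close>

lemma smooth_curve_derivative:
  fixes \<gamma> :: "real \<Rightarrow> 'b::real_normed_vector"
  assumes J: "open J" and smooth: "smooth_on J \<gamma>"
  shows "t \<in> J \<Longrightarrow> (\<gamma> has_vector_derivative vector_derivative \<gamma> (at t)) (at t)"
    and "continuous_on J (\<lambda>t. vector_derivative \<gamma> (at t))"
proof -
  have local: "\<exists>W d. open W \<and> t \<in> W \<and> W \<subseteq> J \<and> continuous_on W d \<and>
      (\<forall>s\<in>W. (\<gamma> has_vector_derivative d s) (at s))" if t: "t \<in> J" for t
  proof -
    obtain W F where W: "open W" "t \<in> W" and Ck: "\<And>k. Ck_on k W F" and eq: "\<And>s. s \<in> J \<inter> W \<Longrightarrow> F s = \<gamma> s"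
      using bspec[OF smooth[unfolded smooth_on_def] t] by auto
    note F = Ck_on_SucD[OF Ck[of "Suc 0"]]
    have "(\<gamma> has_vector_derivative frechet_derivative F (at s) 1) (at s)" if s: "s \<in> J \<inter> W" for s
    proof -
      have "(F has_derivative frechet_derivative F (at s)) (at s)" using F(1) s by blast
      then have D: "(\<gamma> has_derivative frechet_derivative F (at s)) (at s)"
        by (rule has_derivative_transform_within_open[OF _ open_Int[OF J W(1)] s eq])
      have l: "linear (frechet_derivative F (at s))" using D by (rule has_derivative_linear)
      have "frechet_derivative F (at s) h = h *\<^sub>R frechet_derivative F (at s) 1" for h
        using linear_scale[OF l, of h 1] by simp
      from has_derivative_eq_rhs[OF D ext[OF this]] show ?thesis
        unfolding has_vector_derivative_def .
    qed
    moreover have "continuous_on (J \<inter> W) (\<lambda>s. frechet_derivative F (at s) 1)"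
      by (rule continuous_on_subset[OF Ck_on_imp_continuous_on[OF F(2)]]) auto
    ultimately show ?thesis
      using t W J by (intro exI[of _ "J \<inter> W"] exI[of _ "\<lambda>s. frechet_derivative F (at s) 1"]) auto
  qed
  show "(\<gamma> has_vector_derivative vector_derivative \<gamma> (at t)) (at t)" if "t \<in> J" for t
    using local[OF that] by (auto dest!: bspec[where x = t] simp: vector_derivative_at)
  show "continuous_on J (\<lambda>t. vector_derivative \<gamma> (at t))"
  proof (rule continuous_at_imp_continuous_on, rule ballI)
    fix t assume "t \<in> J"
    from local[OF this] obtain W d where W: "open W" "t \<in> W" "continuous_on W d"
      and d: "\<And>s. s \<in> W \<Longrightarrow> (\<gamma> has_vector_derivative d s) (at s)" by blast
    have "continuous_on W (\<lambda>t. vector_derivative \<gamma> (at t))"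
      by (rule continuous_on_eq[OF W(3)]) (simp add: vector_derivative_at[OF d])
    then show "continuous (at t) (\<lambda>t. vector_derivative \<gamma> (at t))"
      using W(1,2) by (simp add: continuous_on_eq_continuous_at)
  qed
qed

lemma oriented_curve_continuous:
  assumes "oriented_curve \<Sigma> \<tau>" shows "continuous_on \<Sigma> \<tau>"
  unfolding continuous_on_eq_continuous_within
proof
  fix q assume q: "q \<in> \<Sigma>"
  then obtain J W \<gamma> where ch: "oriented_chart \<Sigma> \<tau> J W \<gamma>" and qW: "q \<in> W"
    using assms unfolding oriented_curve_def by blast
  then obtain k where hom: "homeomorphism J (\<Sigma> \<inter> W) \<gamma> k" unfolding oriented_chart_def by blast
  have J: "open J" and W: "open W" and sm: "smooth_on J \<gamma>"
    and tau: "\<And>t. t \<in> J \<Longrightarrow> vector_derivative \<gamma> (at t) \<noteq> 0 \<and> \<tau> (\<gamma> t) = sgn (vector_derivative \<gamma> (at t))"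
    using ch by (auto simp: oriented_chart_def)
  have "continuous_on J (\<lambda>t. sgn (vector_derivative \<gamma> (at t)))"
    using tau by (intro continuous_on_sgn smooth_curve_derivative(2)[OF J sm]) auto
  then have "continuous_on (\<Sigma> \<inter> W) (\<lambda>x. sgn (vector_derivative \<gamma> (at (k x))))"
    by (rule continuous_on_compose2) (use hom in \<open>auto simp: homeomorphism_def\<close>)
  then have "continuous_on (\<Sigma> \<inter> W) \<tau>"
  proof (rule continuous_on_eq)
    fix x assume "x \<in> \<Sigma> \<inter> W"
    then have "k x \<in> J" "\<gamma> (k x) = x" using hom by (auto simp: homeomorphism_def)
    then show "sgn (vector_derivative \<gamma> (at (k x))) = \<tau> x" using tau[of "k x"] by simp
  qed
  then have "continuous (at q within \<Sigma> \<inter> W) \<tau>"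
    using q qW by (auto simp: continuous_on_eq_continuous_within)
  moreover have "at q within \<Sigma> \<inter> W = at q within \<Sigma>"
    by (rule at_within_nhd[OF qW W]) auto
  ultimately show "continuous (at q within \<Sigma>) \<tau>" by simp
qed

context hyperbola_coordinates
begin

text \<open>Half the length of the gradient of \<open>X1\<^sup>2 / a - X3\<^sup>2 / c\<close>. The foot point satisfies
  \<open>x = proj x + (offset x * slope (proj x)) *\<^sub>R normal (proj x) + X2 x *\<^sub>R u2\<close>.\<close>

definition slope :: "real^3 \<Rightarrow> real" where "slope q = sqrt ((X1 q / a)\<^sup>2 + (X3 q / c)\<^sup>2)"

definition normal :: "real^3 \<Rightarrow> real^3" where
  "normal q = (1 / slope q) *\<^sub>R ((X1 q / a) *\<^sub>R u1 - (X3 q / c) *\<^sub>R u3)"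

definition proj :: "real^3 \<Rightarrow> real^3" where
  "proj x = p + (a * X1 x / (a + offset x)) *\<^sub>R u1 + (c * X3 x / (c - offset x)) *\<^sub>R u3"

lemma slope_sq: "(slope q)\<^sup>2 = (X1 q / a)\<^sup>2 + (X3 q / c)\<^sup>2"
  by (simp add: slope_def)

lemma slope_pos: "X1 q \<noteq> 0 \<Longrightarrow> slope q > 0"
  unfolding slope_def using a by (auto intro!: add_pos_nonneg)

lemma normal_unit: assumes "X1 q \<noteq> 0" shows "norm (normal q) = 1"
proof -
  have "normal q \<bullet> normal q = (1 / slope q)\<^sup>2 * (slope q)\<^sup>2"
    unfolding slope_sq normal_def by (simp add: inner_diff power2_eq_square add_divide_distrib mult_ac)
  then show ?thesis using slope_pos[OF assms] by (simp add: norm_eq_sqrt_inner power_divide)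
qed

lemma normal_u2: "normal q \<bullet> u2 = 0"
  by (simp add: normal_def inner_diff)

lemma slope_normal: "X1 q \<noteq> 0 \<Longrightarrow> (s * slope q) *\<^sub>R normal q = (s * X1 q / a) *\<^sub>R u1 - (s * X3 q / c) *\<^sub>R u3"
  using slope_pos[of q] by (simp add: normal_def scaleR_diff_right)

lemma X_proj:
  "X1 (proj x) = a * X1 x / (a + offset x)" "X2 (proj x) = 0" "X3 (proj x) = c * X3 x / (c - offset x)"
  by (simp_all add: proj_def)

lemma X_from_proj:
  assumes "x \<in> U"
  shows "X1 x = X1 (proj x) * (1 + offset x / a)" "X3 x = X3 (proj x) * (1 - offset x / c)"
proof -
  have "1 + offset x / a = (a + offset x) / a" "1 - offset x / c = (c - offset x) / c"
    using a c by (simp_all add: field_simps)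
  then show "X1 x = X1 (proj x) * (1 + offset x / a)" "X3 x = X3 (proj x) * (1 - offset x / c)"
    using offset[OF assms] a c by (simp_all add: X_proj)
qed

lemma proj_in_H: "x \<in> U \<Longrightarrow> proj x \<in> H"
  using offset[of x] a c
  by (simp add: H_def X_proj foot_eqn_def power_divide power_mult_distrib power2_eq_square mult_ac)

lemma proj_on_H:
  assumes "q \<in> H" shows "proj q = q"
proof -
  have "X2 q = 0" using assms by (simp add: H_def)
  then have "q = p + X1 q *\<^sub>R u1 + X3 q *\<^sub>R u3" using X_expand[of q] by simp
  then show ?thesis using a c by (simp add: proj_def offset_on_H[OF assms])
qed

lemma X1_proj_nonzero: "x \<in> U \<Longrightarrow> X1 (proj x) \<noteq> 0"
  using X1_nonzero_on_H[OF proj_in_H] .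

lemma X1_proj_pos_iff: "x \<in> U \<Longrightarrow> X1 (proj x) > 0 \<longleftrightarrow> X1 x > 0"
  using offset[of x] a by (simp add: X_proj zero_less_divide_iff zero_less_mult_iff)

lemma normal_decomposition:
  assumes "x \<in> U"
  shows "x = proj x + (offset x * slope (proj x)) *\<^sub>R normal (proj x) + X2 x *\<^sub>R u2"
proof -
  note x = X_from_proj[OF assms]
  have "proj x + (offset x * slope (proj x)) *\<^sub>R normal (proj x) =
      p + X1 (proj x) *\<^sub>R u1 + X3 (proj x) *\<^sub>R u3
      + ((offset x * X1 (proj x) / a) *\<^sub>R u1 - (offset x * X3 (proj x) / c) *\<^sub>R u3)"
    unfolding slope_normal[OF X1_proj_nonzero[OF assms]] unfolding X_proj unfolding proj_def ..
  also have "\<dots> = p + (X1 (proj x) * (1 + offset x / a)) *\<^sub>R u1 + (X3 (proj x) * (1 - offset x / c)) *\<^sub>R u3"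
    by (simp add: algebra_simps scaleR_add_left scaleR_diff_left)
  also have "\<dots> = p + X1 x *\<^sub>R u1 + X3 x *\<^sub>R u3" unfolding x[symmetric] ..
  finally show ?thesis using X_expand[of x] by (simp add: algebra_simps)
qed

lemma Cinf_proj: "Cinf_on U proj"
  unfolding proj_def[abs_def] using offset
  by (intro Cinf_on_add Cinf_on_scaleR Cinf_on_divide Cinf_on_mult Cinf_on_diff Cinf_X Cinf_offset
      Cinf_on_const open_U) force+

lemma Cinf_slope: "Cinf_on {x. X1 x \<noteq> 0} slope"
  unfolding slope_def[abs_def] using a c
  by (intro Cinf_on_sqrt Cinf_on_add Cinf_on_power Cinf_on_divide Cinf_X Cinf_on_const open_X1_nonzero)
    (auto intro!: add_pos_nonneg)

lemma Cinf_normal: "Cinf_on {x. X1 x \<noteq> 0} normal"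
  unfolding normal_def[abs_def] using a c slope_pos
  by (intro Cinf_on_scaleR Cinf_on_divide Cinf_on_diff Cinf_slope Cinf_X Cinf_on_const open_X1_nonzero)
    (auto simp: less_imp_neq[symmetric])

lemma Cinf_slope_proj: "Cinf_on U (\<lambda>x. slope (proj x))"
  by (rule Cinf_on_compose[OF Cinf_slope Cinf_proj]) (simp add: X1_proj_nonzero)

lemma connected_branches:
  assumes "s = 1 \<or> s = - 1" shows "connected {q \<in> H. s * X1 q > 0}"
proof -
  define \<gamma> where "\<gamma> t = p + (s * sqrt a * cosh t) *\<^sub>R u1 + (sqrt c * sinh t) *\<^sub>R u3" for t :: real
  have "{q \<in> H. s * X1 q > 0} = range \<gamma>"
  proof (intro equalityI subsetI)
    fix q assume "q \<in> range \<gamma>"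
    then obtain t where q: "q = \<gamma> t" by blast
    have "(cosh t)\<^sup>2 - (sinh t)\<^sup>2 = 1" for t :: real by (simp add: cosh_square_eq)
    then show "q \<in> {q \<in> H. s * X1 q > 0}" using assms a c
      by (auto simp: q \<gamma>_def H_def power_mult_distrib)
  next
    fix q assume "q \<in> {q \<in> H. s * X1 q > 0}"
    then have q: "(X1 q)\<^sup>2 / a - (X3 q)\<^sup>2 / c = 1" "X2 q = 0" "s * X1 q > 0" by (auto simp: H_def)
    define t where "t = arsinh (X3 q / sqrt c)"
    have sh: "sinh t = X3 q / sqrt c" by (simp add: t_def)
    have "(cosh t)\<^sup>2 = (s * X1 q / sqrt a)\<^sup>2"
      unfolding cosh_square_eq sh using q a c assms by (auto simp: power_divide)
    then have "cosh t = s * X1 q / sqrt a"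
      by (rule power2_eq_imp_eq) (use q a in auto)
    then have "s * sqrt a * cosh t = X1 q" using a assms by auto
    moreover have "sqrt c * sinh t = X3 q" using c by (simp add: sh)
    ultimately have "\<gamma> t = q" using X_expand[of q] q(2) by (simp add: \<gamma>_def)
    then show "q \<in> range \<gamma>" by blast
  qed
  moreover have "continuous_on UNIV \<gamma>" unfolding \<gamma>_def by (intro continuous_intros)
  ultimately show ?thesis using connected_continuous_image[of UNIV \<gamma>] by simp
qed

lemma tangent_to_H:
  assumes or: "oriented_curve H \<tau>" and q: "q \<in> H"
  shows "norm (\<tau> q) = 1" "\<tau> q \<bullet> u2 = 0" "\<tau> q \<bullet> normal q = 0"
proof -
  obtain J W \<gamma> where ch: "oriented_chart H \<tau> J W \<gamma>" and qW: "q \<in> W"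
    using assms unfolding oriented_curve_def by blast
  then obtain k where hom: "homeomorphism J (H \<inter> W) \<gamma> k" unfolding oriented_chart_def by blast
  define t v where "t = k q" and "v = vector_derivative \<gamma> (at t)"
  have t: "t \<in> J" "\<gamma> t = q" using hom q qW by (auto simp: t_def homeomorphism_def)
  have J: "open J" and sm: "smooth_on J \<gamma>" and tau: "v \<noteq> 0" "\<tau> q = sgn v"
    using ch t by (auto simp: oriented_chart_def v_def)
  have D: "(\<gamma> has_derivative (\<lambda>h. h *\<^sub>R v)) (at t)"
    using smooth_curve_derivative(1)[OF J sm t(1)] by (simp add: v_def has_vector_derivative_def)
  have in_H: "\<gamma> s \<in> H" if "s \<in> J" for s using hom that by (auto simp: homeomorphism_def)
  have "((\<lambda>s. X2 (\<gamma> s)) has_derivative (\<lambda>h. (h *\<^sub>R v) \<bullet> u2)) (at t)"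
    by (rule has_derivative_compose[OF D X_deriv(2)])
  moreover have "((\<lambda>s. X2 (\<gamma> s)) has_derivative (\<lambda>h. 0)) (at t)"
    by (rule has_derivative_transform_within_open[OF has_derivative_const J t(1), of 0])
      (use in_H in \<open>auto simp: H_def\<close>)
  ultimately have "(1 *\<^sub>R v) \<bullet> u2 = 0" by (rule has_derivative_unique[THEN fun_cong])
  then have v2: "v \<bullet> u2 = 0" by simp
  have "((\<lambda>s. X1 (\<gamma> s) * X1 (\<gamma> s) / a - X3 (\<gamma> s) * X3 (\<gamma> s) / c) has_derivative
      (\<lambda>h. 2 * X1 q * ((h *\<^sub>R v) \<bullet> u1) / a - 2 * X3 q * ((h *\<^sub>R v) \<bullet> u3) / c)) (at t)"
    using a c by (auto intro!: derivative_eq_intros has_derivative_compose[OF D X_deriv(1)]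
        has_derivative_compose[OF D X_deriv(3)] simp: t fun_eq_iff field_simps)
  moreover have "((\<lambda>s. X1 (\<gamma> s) * X1 (\<gamma> s) / a - X3 (\<gamma> s) * X3 (\<gamma> s) / c) has_derivative (\<lambda>h. 0)) (at t)"
    by (rule has_derivative_transform_within_open[OF has_derivative_const J t(1), of 1])
      (use in_H in \<open>auto simp: H_def power2_eq_square\<close>)
  ultimately have "2 * X1 q * ((1 *\<^sub>R v) \<bullet> u1) / a - 2 * X3 q * ((1 *\<^sub>R v) \<bullet> u3) / c = 0"
    by (rule has_derivative_unique[THEN fun_cong])
  then have "v \<bullet> ((X1 q / a) *\<^sub>R u1 - (X3 q / c) *\<^sub>R u3) = 0"
    by (simp add: inner_diff_right)
  then have vn: "v \<bullet> normal q = 0" by (simp add: normal_def)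
  show "norm (\<tau> q) = 1" using tau by (simp add: norm_sgn)
  show "\<tau> q \<bullet> u2 = 0" "\<tau> q \<bullet> normal q = 0" using v2 vn by (simp_all add: tau sgn_div_norm)
qed

text \<open>Both vectors are unit vectors in the plane of \<open>u1\<close> and \<open>u3\<close> and orthogonal to each other.\<close>

lemma rotated_normal:
  assumes or: "oriented_curve H \<tau>" and q: "q \<in> H"
  shows "cross3 (\<tau> q) (normal q) = (cross3 (\<tau> q) (normal q) \<bullet> u2) *\<^sub>R u2"
    and "cross3 (\<tau> q) (normal q) \<bullet> u2 \<in> {1, -1}"
proof -
  note t = tangent_to_H[OF assms]
  define s n where "s = \<tau> q" and "n = normal q"
  have s: "s = (s \<bullet> u1) *\<^sub>R u1 + (s \<bullet> u3) *\<^sub>R u3" using expand[of s] t(2) by (simp add: s_def)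
  have n: "n = (n \<bullet> u1) *\<^sub>R u1 + (n \<bullet> u3) *\<^sub>R u3" using expand[of n] normal_u2[of q] by (simp add: n_def)
  have "cross3 s n = cross3 ((s \<bullet> u1) *\<^sub>R u1 + (s \<bullet> u3) *\<^sub>R u3) ((n \<bullet> u1) *\<^sub>R u1 + (n \<bullet> u3) *\<^sub>R u3)"
    using arg_cong2[OF s n, of cross3] .
  also have "\<dots> = ((s \<bullet> u1) * (n \<bullet> u3) - (s \<bullet> u3) * (n \<bullet> u1)) *\<^sub>R cross3 u1 u3"
    by (simp add: cross_add_left cross_add_right cross_mult_left cross_mult_right cross_refl
        scaleR_diff_left cross_skew[of u3 u1] mult.commute)
  finally have e: "cross3 s n = ((s \<bullet> u1) * (n \<bullet> u3) - (s \<bullet> u3) * (n \<bullet> u1)) *\<^sub>R cross3 u1 u3" .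
  have "cross3 s n \<bullet> u1 = 0" "cross3 s n \<bullet> u3 = 0" unfolding e by (simp_all add: dot_cross_self)
  with expand[of "cross3 s n"] have 1: "cross3 s n = (cross3 s n \<bullet> u2) *\<^sub>R u2"
    by (simp only: scaleR_zero_left add_0_left add_0_right)
  then show "cross3 (\<tau> q) (normal q) = (cross3 (\<tau> q) (normal q) \<bullet> u2) *\<^sub>R u2" unfolding s_def n_def .
  have "(norm (cross3 s n))\<^sup>2 = (norm s)\<^sup>2 * (norm n)\<^sup>2 - (s \<bullet> n)\<^sup>2"
    using norm_cross[of s n] .
  then have "(norm (cross3 s n))\<^sup>2 = 1"
    using t normal_unit[OF X1_nonzero_on_H[OF q]] by (simp add: s_def n_def)
  moreover have "(norm (cross3 s n))\<^sup>2 = (cross3 s n \<bullet> u2)\<^sup>2"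
    by (rule arg_cong[OF 1, of "\<lambda>v. (norm v)\<^sup>2", THEN trans]) (simp add: power_mult_distrib norm_eq_sqrt_inner)
  ultimately have "(cross3 s n \<bullet> u2)\<^sup>2 = 1" by simp
  then show "cross3 (\<tau> q) (normal q) \<bullet> u2 \<in> {1, -1}" by (auto simp: power2_eq_1_iff s_def n_def)
qed

text \<open>The sign of the rotated normal is continuous because the orientation \<open>\<tau>\<close> is, hence constant on each
  of the two connected branches. The two branches may be oriented independently of each other.\<close>

lemma orientation_signs:
  assumes or: "oriented_curve H \<tau>"
  shows "\<exists>ep\<in>{1, -1}. \<exists>em\<in>{1, -1}. \<forall>q\<in>H.
    cross3 (\<tau> q) (normal q) = (if X1 q > 0 then ep else em) *\<^sub>R u2"
proof -
  define f where "f q = cross3 (\<tau> q) (normal q) \<bullet> u2" for q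
  have "continuous_on H normal"
    by (rule continuous_on_subset[OF Cinf_on_D(3)[OF Cinf_normal]]) (use X1_nonzero_on_H in auto)
  then have cont: "continuous_on H f" unfolding f_def
    by (intro continuous_intros continuous_on_cross oriented_curve_continuous[OF or])
  have pm: "f q \<in> {1, -1}" if "q \<in> H" for q using rotated_normal(2)[OF or that] by (simp add: f_def)
  have "\<exists>e\<in>{1, -1}. \<forall>q\<in>{q \<in> H. s * X1 q > 0}. f q = e" if "s = 1 \<or> s = - 1" for s
  proof (cases "{q \<in> H. s * X1 q > 0} = {}")
    case False
    have "finite (f ` {q \<in> H. s * X1 q > 0})"
      by (rule finite_subset[of _ "{1, -1}"]) (use pm in auto)
    then have "f constant_on {q \<in> H. s * X1 q > 0}"
      by (rule continuous_finite_range_constant[OF connected_branches[OF that]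
            continuous_on_subset[OF cont], rotated]) auto
    then obtain e where "\<forall>q\<in>{q \<in> H. s * X1 q > 0}. f q = e" unfolding constant_on_def by blast
    with False pm show ?thesis by (intro bexI[of _ e]) auto
  qed blast
  from this[of 1] this[of "- 1"] obtain ep em where
    e: "ep \<in> {1, -1}" "em \<in> {1, -1}" "\<And>q. q \<in> H \<Longrightarrow> X1 q > 0 \<Longrightarrow> f q = ep" "\<And>q. q \<in> H \<Longrightarrow> X1 q < 0 \<Longrightarrow> f q = em"
    by auto
  have "cross3 (\<tau> q) (normal q) = (if X1 q > 0 then ep else em) *\<^sub>R u2" if q: "q \<in> H" for q
  proof -
    have "f q = (if X1 q > 0 then ep else em)"
      using e(3,4)[OF q] X1_nonzero_on_H[OF q] by auto
    then show ?thesis using rotated_normal(1)[OF or q] by (simp only: f_def)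
  qed
  with e(1,2) show ?thesis by blast
qed

end

locale oriented_hyperbola = hyperbola_coordinates +
  fixes \<tau> :: "real^3 \<Rightarrow> real^3" and ep em :: real
  assumes oriented: "oriented_curve H \<tau>"
    and signs: "ep \<in> {1, -1}" "em \<in> {1, -1}"
    and rotate: "\<And>q. q \<in> H \<Longrightarrow> cross3 (\<tau> q) (normal q) = (if X1 q > 0 then ep else em) *\<^sub>R u2"
begin

definition eps :: "real^3 \<Rightarrow> real" where "eps x = (if X1 x > 0 then ep else em)"

lemma eps: "eps x = 1 \<or> eps x = - 1" "eps x * eps x = 1" "\<bar>eps x\<bar> = 1"
  using signs by (auto simp: eps_def)

lemma eps_proj: "x \<in> U \<Longrightarrow> eps (proj x) = eps x"
  by (simp add: eps_def X1_proj_pos_iff)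

lemma Cinf_eps: "Cinf_on {x. X1 x \<noteq> 0} eps"
proof (rule Cinf_on_bootstrap[OF open_X1_nonzero, where D = UNIV and G = "\<lambda>v q. 0"])
  fix x assume x: "x \<in> {x. X1 x \<noteq> 0}"
  have o: "open {y. X1 y * X1 x > 0}" by (intro open_Collect_less continuous_intros)
  have e: "eps x = eps y" if "y \<in> {y. X1 y * X1 x > 0}" for y
    using that by (auto simp: eps_def zero_less_mult_iff)
  have "x \<in> {y. X1 y * X1 x > 0}" using x by (auto simp: zero_less_mult_iff)
  then show "(eps has_derivative (\<lambda>_. 0)) (at x)"
    by (rule has_derivative_transform_within_open[OF has_derivative_const o _ e])
qed auto

text \<open>The fibre coordinate with respect to the frame \<open>normal\<close>, with \<open>cross3 \<tau> normal = eps *\<^sub>R u2\<close> as the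
  second frame vector.\<close>

definition zeta :: "real^3 \<Rightarrow> complex" where
  "zeta x = Complex (offset x * slope (proj x)) (eps x * X2 x)"

lemma Cinf_zeta: "Cinf_on U zeta"
proof -
  have "Cinf_on U eps" by (rule Cinf_on_subset[OF Cinf_eps open_U]) (auto simp: U_X1)
  then have "Cinf_on U (\<lambda>x. (offset x * slope (proj x)) *\<^sub>R (1::complex) + (eps x * X2 x) *\<^sub>R \<i>)"
    by (intro Cinf_on_add Cinf_on_scaleR Cinf_on_mult Cinf_offset Cinf_slope_proj Cinf_X
        Cinf_on_const open_U)
  then show ?thesis by (rule Cinf_on_cong) (simp add: zeta_def complex_eq_iff)
qed

lemma tubular: "tubular_neighbourhood U H \<tau> normal U proj zeta"
  unfolding tubular_neighbourhood_def
proof (intro conjI ballI)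
  show "normal_frame H \<tau> normal" unfolding normal_frame_def
  proof (intro conjI ballI)
    show "smooth_on H normal" by (rule Cinf_on_imp_smooth_on[OF Cinf_normal]) (auto simp: X1_nonzero_on_H)
    show "norm (normal q) = 1" if "q \<in> H" for q by (rule normal_unit[OF X1_nonzero_on_H[OF that]])
    show "normal q \<bullet> \<tau> q = 0" if "q \<in> H" for q
      using tangent_to_H(3)[OF oriented that] by (simp add: inner_commute)
  qed
  show "smooth_on U proj" "smooth_on U zeta"
    by (rule Cinf_on_imp_smooth_on[OF Cinf_proj order_refl],
        rule Cinf_on_imp_smooth_on[OF Cinf_zeta order_refl])
  show "proj x \<in> H" if "x \<in> U" for x using proj_in_H[OF that] .
  show "normal_exp \<tau> normal (proj x) (zeta x) = x" if x: "x \<in> U" for x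
  proof -
    have "cross3 (\<tau> (proj x)) (normal (proj x)) = eps x *\<^sub>R u2"
      using rotate[OF proj_in_H[OF x]] eps_proj[OF x] by (simp add: eps_def)
    then have "normal_exp \<tau> normal (proj x) (zeta x) =
        proj x + (offset x * slope (proj x)) *\<^sub>R normal (proj x) + (eps x * eps x * X2 x) *\<^sub>R u2"
      by (simp add: normal_exp_def frame_vector_def zeta_def mult_ac)
    also have "\<dots> = x" unfolding eps(2) mult_1_left by (rule normal_decomposition[OF x, symmetric])
    finally show ?thesis .
  qed
  show "proj q = q" "zeta q = 0" if "q \<in> H" for q
    using proj_on_H[OF that] offset_on_H[OF that] that by (simp_all add: zeta_def H_def complex_eq_iff)
qed (use open_U H_subset_U in auto)

lemma zeta_eq_0: assumes "x \<in> U" shows "zeta x = 0 \<longleftrightarrow> x \<in> H"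
proof
  assume "zeta x = 0"
  then have "offset x = 0" "X2 x = 0"
    using slope_pos[OF X1_proj_nonzero[OF assms]] eps(1)[of x] by (auto simp: zeta_def complex_eq_iff)
  then have "proj x = x" using normal_decomposition[OF assms, symmetric] by simp
  then show "x \<in> H" using proj_in_H[OF assms] by simp
qed (use tubular in \<open>auto simp: tubular_neighbourhood_def\<close>)

end

section \<open>Expansion of the harmonic function at the hyperbola\<close>

lemma bigo_square_cancel:
  fixes f g :: "'a \<Rightarrow> real"
  assumes "(\<lambda>x. (f x)\<^sup>2) \<in> O[F](\<lambda>x. (g x)\<^sup>2)" shows "f \<in> O[F](g)"
proof -
  obtain C where C: "C > 0" "\<forall>\<^sub>F x in F. norm ((f x)\<^sup>2) \<le> C * norm ((g x)\<^sup>2)"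
    using assms by (auto elim: landau_o.bigE)
  show ?thesis
  proof (rule bigoI)
    show "\<forall>\<^sub>F x in F. norm (f x) \<le> sqrt C * norm (g x)"
      using C(2)
    proof eventually_elim
      case (elim x)
      then have "(f x)\<^sup>2 \<le> (sqrt C * \<bar>g x\<bar>)\<^sup>2" using C by (simp add: power_mult_distrib)
      then have "\<bar>f x\<bar> \<le> \<bar>sqrt C * \<bar>g x\<bar>\<bar>" by (simp only: abs_le_square_iff)
      then show ?case using C by (simp add: abs_mult)
    qed
  qed
qed

lemma bigo_tendsto:
  fixes f :: "'a \<Rightarrow> real"
  assumes "(f \<longlongrightarrow> l) F" shows "f \<in> O[F](\<lambda>_. 1)"
proof (rule bigoI)
  have "\<forall>\<^sub>F x in F. dist (f x) l < 1" using tendstoD[OF assms] by simp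
  then show "\<forall>\<^sub>F x in F. norm (f x) \<le> (\<bar>l\<bar> + 1) * norm (1::real)"
    by eventually_elim (auto simp: dist_real_def)
qed

text \<open>This is the mean value inequality on the interval of radius \<open>\<bar>t\<bar>\<close> around \<open>0\<close>.\<close>

lemma bigo_integrate:
  fixes f f' :: "real \<Rightarrow> real"
  assumes D: "\<forall>\<^sub>F t in nhds 0. (f has_real_derivative f' t) (at t)" and f0: "f 0 = 0"
    and f': "f' \<in> O[nhds 0](\<lambda>t. t ^ n)"
  shows "f \<in> O[nhds 0](\<lambda>t. t ^ Suc n)"
proof -
  obtain C where C: "C > 0" "\<forall>\<^sub>F t in nhds 0. norm (f' t) \<le> C * norm (t ^ n)"
    using f' by (auto elim: landau_o.bigE)
  from eventually_conj[OF D C(2)] obtain r where r: "r > 0"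
    and b: "\<And>t. dist t 0 < r \<Longrightarrow> (f has_real_derivative f' t) (at t) \<and> norm (f' t) \<le> C * norm (t ^ n)"
    unfolding eventually_nhds_metric by blast
  show ?thesis
  proof (rule bigoI[where c = C])
    have "\<forall>\<^sub>F t::real in nhds 0. dist t 0 < r" using r by (auto simp: eventually_nhds_metric)
    then show "\<forall>\<^sub>F t in nhds 0. norm (f t) \<le> C * norm (t ^ Suc n)"
    proof eventually_elim
      case (elim t)
      have "norm (f t - f 0) \<le> (C * norm t ^ n) * norm (t - 0)"
      proof (rule field_differentiable_bound[where S = "cball 0 (norm t)" and f' = f'])
        fix s :: real assume "s \<in> cball 0 (norm t)"
        then have s: "norm s \<le> norm t" by simp
        then have "dist s 0 < r" using elim by simp
        note bs = b[OF this]
        then show "(f has_real_derivative f' s) (at s within cball 0 (norm t))"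
          by (blast intro: has_field_derivative_at_within)
        have "norm (f' s) \<le> C * norm s ^ n" using bs by (simp add: power_abs)
        also have "\<dots> \<le> C * norm t ^ n" using s C by (intro mult_left_mono power_mono) auto
        finally show "norm (f' s) \<le> C * norm t ^ n" .
      qed auto
      then show ?case by (simp add: f0 power_abs abs_mult mult_ac)
    qed
  qed
qed

lemma Cinf_on_deriv:
  fixes g :: "real \<Rightarrow> real"
  assumes "Cinf_on W g"
  shows "x \<in> W \<Longrightarrow> (g has_real_derivative frechet_derivative g (at x) 1) (at x)"
    and "Cinf_on W (\<lambda>x. frechet_derivative g (at x) 1)"
proof -
  show "Cinf_on W (\<lambda>x. frechet_derivative g (at x) 1)" by (rule Cinf_on_frechet_derivative[OF assms])
  assume "x \<in> W"
  from Cinf_on_D(4)[OF assms this] have D: "(g has_derivative frechet_derivative g (at x)) (at x)"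
    by (simp add: frechet_derivative_works)
  have l: "linear (frechet_derivative g (at x))" using D by (rule has_derivative_linear)
  have "frechet_derivative g (at x) h = frechet_derivative g (at x) 1 * h" for h
    using linear_scale[OF l, of h 1] by (simp add: mult.commute)
  from has_derivative_eq_rhs[OF D ext[OF this]]
  show "(g has_real_derivative frechet_derivative g (at x) 1) (at x)"
    unfolding has_field_derivative_def .
qed

lemma Cinf_on_second_order:
  fixes g :: "real \<Rightarrow> real"
  assumes g: "Cinf_on W g" and W: "0 \<in> W" and b: "(g has_real_derivative b) (at 0)"
  shows "(\<lambda>t. g t - g 0 - b * t) \<in> O[nhds 0](\<lambda>t. t\<^sup>2)"
proof -
  let ?g1 = "\<lambda>t. frechet_derivative g (at t) 1"
  let ?g2 = "\<lambda>t. frechet_derivative ?g1 (at t) 1"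
  note g1 = Cinf_on_deriv[OF g] and evW = eventually_nhds_in_open[OF Cinf_on_D(1)[OF g] W]
  note g2 = Cinf_on_deriv[OF g1(2)]
  have b': "b = ?g1 0" using DERIV_unique[OF b g1(1)[OF W]] .
  have ic: "isCont ?g2 0" using Cinf_on_D(1,3)[OF g2(2)] W by (simp add: continuous_on_eq_continuous_at)
  have "(?g2 \<longlongrightarrow> ?g2 0) (nhds 0)"
    by (rule tendsto_at_iff_tendsto_nhds[THEN iffD1, OF ic[unfolded isCont_def]])
  then have o2: "?g2 \<in> O[nhds 0](\<lambda>t. t ^ 0)" using bigo_tendsto by simp
  have "(\<lambda>t. ?g1 t - b) \<in> O[nhds 0](\<lambda>t. t ^ Suc 0)"
  proof (rule bigo_integrate[OF _ _ o2])
    from evW show "\<forall>\<^sub>F t in nhds 0. ((\<lambda>t. ?g1 t - b) has_real_derivative ?g2 t) (at t)"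
      by eventually_elim (auto intro!: derivative_eq_intros g2(1))
  qed (simp add: b')
  then have "(\<lambda>t. g t - g 0 - b * t) \<in> O[nhds 0](\<lambda>t. t ^ Suc (Suc 0))"
  proof (rule bigo_integrate[rotated 2])
    from evW show "\<forall>\<^sub>F t in nhds 0. ((\<lambda>t. g t - g 0 - b * t) has_real_derivative ?g1 t - b) (at t)"
      by eventually_elim (auto intro!: derivative_eq_intros g1(1))
  qed simp
  then show ?thesis by (simp add: numeral_2_eq_2)
qed

text \<open>As a function of \<open>u\<^sup>2\<close>, the integrand has a second order expansion. Integration turns its error
  \<open>u\<^sup>4\<close> into \<open>u\<^sup>5\<close>.\<close>

lemma odd_primitive_expansion:
  fixes K \<phi> :: "real \<Rightarrow> real"
  assumes \<phi>: "Cinf_on W \<phi>" "0 \<in> W" and b: "(\<phi> has_real_derivative b) (at 0)"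
    and K0: "K 0 = 0" and K: "\<forall>\<^sub>F u in nhds 0. (K has_real_derivative \<phi> (u\<^sup>2)) (at u)"
  shows "(\<lambda>u. K u - \<phi> 0 * u - b / 3 * u ^ 3) \<in> O[nhds 0](\<lambda>u. u ^ 5)"
proof -
  have "filterlim (\<lambda>u::real. u\<^sup>2) (nhds 0) (nhds 0)"
    using tendsto_power[OF filterlim_ident[of "nhds (0::real)"], of 2] by simp
  from landau_o.big.compose[OF Cinf_on_second_order[OF \<phi> b] this]
  have o: "(\<lambda>u. \<phi> (u\<^sup>2) - \<phi> 0 - b * u\<^sup>2) \<in> O[nhds 0](\<lambda>u. u ^ 4)"
    by (simp flip: power_mult)
  have "(\<lambda>u. K u - \<phi> 0 * u - b / 3 * u ^ 3) \<in> O[nhds 0](\<lambda>u. u ^ Suc 4)"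
  proof (rule bigo_integrate[OF _ _ o])
    from K show "\<forall>\<^sub>F u in nhds 0. ((\<lambda>u. K u - \<phi> 0 * u - b / 3 * u ^ 3) has_real_derivative
        \<phi> (u\<^sup>2) - \<phi> 0 - b * u\<^sup>2) (at u)"
      by eventually_elim (auto intro!: derivative_eq_intros)
  qed (simp add: K0)
  then show ?thesis by simp
qed

text \<open>The estimates near the hyperbola are bookkeeping of orders of vanishing with respect to one function
  \<open>d\<close>, which will be the square root of the distance to the hyperbola.\<close>

definition order_ge :: "'a filter \<Rightarrow> ('a \<Rightarrow> real) \<Rightarrow> nat \<Rightarrow> ('a \<Rightarrow> real) \<Rightarrow> bool" where
  "order_ge F d n f \<longleftrightarrow> f \<in> O[F](\<lambda>x. d x ^ n)"

lemma order_ge_add: "order_ge F d n f \<Longrightarrow> order_ge F d n g \<Longrightarrow> order_ge F d n (\<lambda>x. f x + g x)"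
  and order_ge_diff: "order_ge F d n f \<Longrightarrow> order_ge F d n g \<Longrightarrow> order_ge F d n (\<lambda>x. f x - g x)"
  unfolding order_ge_def by (auto intro: sum_in_bigo)

lemma order_ge_mult:
  "order_ge F d j f \<Longrightarrow> order_ge F d k g \<Longrightarrow> n = j + k \<Longrightarrow> order_ge F d n (\<lambda>x. f x * g x)"
  unfolding order_ge_def using landau_o.big.mult[of f F "\<lambda>x. d x ^ j" g "\<lambda>x. d x ^ k"]
  by (simp add: power_add)

lemma order_ge_power:
  assumes "order_ge F d j f" "k = j * n" shows "order_ge F d k (\<lambda>x. f x ^ n)"
  using assms landau_o.big_power[of f F "\<lambda>x. d x ^ j" n]
  unfolding order_ge_def by (simp add: power_mult)

lemma order_ge_tendsto: "(f \<longlongrightarrow> l) F \<Longrightarrow> order_ge F d 0 f"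
  unfolding order_ge_def using bigo_tendsto by simp

lemma order_ge_weaken:
  assumes d: "(d \<longlongrightarrow> 0) F" and f: "order_ge F d k f" and "j \<le> k"
  shows "order_ge F d j f"
proof -
  have A: "order_ge F d 0 (\<lambda>x. d x ^ (k - j))" by (rule order_ge_tendsto[OF tendsto_power[OF d]])
  have "order_ge F d j (\<lambda>x. d x ^ j)" by (simp add: order_ge_def)
  from order_ge_mult[OF this A, of j] have "order_ge F d j (\<lambda>x. d x ^ j * d x ^ (k - j))"
    by simp
  then have "(\<lambda>x. d x ^ k) \<in> O[F](\<lambda>x. d x ^ j)"
    using \<open>j \<le> k\<close> by (simp add: order_ge_def flip: power_add)
  then show ?thesis using f unfolding order_ge_def by (rule landau_o.big_trans[rotated])
qed

lemma order_ge_mono: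
  assumes "\<forall>\<^sub>F x in F. \<bar>f x\<bar> \<le> \<bar>g x\<bar>" "order_ge F d n g" shows "order_ge F d n f"
  using landau_o.big_trans[OF landau_o.big_mono[of f g F] assms(2)[unfolded order_ge_def]] assms(1)
  unfolding order_ge_def by simp

lemma order_ge_compose:
  assumes "h \<in> O[nhds 0](\<lambda>t. t ^ n)" "order_ge F d 1 u" "(u \<longlongrightarrow> 0) F"
  shows "order_ge F d n (\<lambda>x. h (u x))"
  using landau_o.big_trans[OF landau_o.big.compose[OF assms(1,3)] order_ge_power[OF assms(2), of n n, unfolded order_ge_def]]
  unfolding order_ge_def by simp

context hyperbola_coordinates
begin

text \<open>\<open>I\<close> as a function of \<open>u\<^sup>2\<close>.\<close>

definition J :: "real \<Rightarrow> real" where "J r = 1 / sqrt ((a - r) * (c + r))"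

lemma I_J: "I u = J (u\<^sup>2)" by (simp add: I_def J_def)

lemma Cinf_J:
  "Cinf_on {- c<..<a} J" "Cinf_on {- c<..<a} (\<lambda>r. J r / (a - r))" "Cinf_on {- c<..<a} (\<lambda>r. J r / (c + r))"
proof -
  have o: "open {- c<..<a}" by simp
  show J: "Cinf_on {- c<..<a} J" unfolding J_def[abs_def]
    by (intro Cinf_on_divide Cinf_on_sqrt Cinf_on_mult Cinf_on_diff Cinf_on_add
      Cinf_on_const Cinf_on_id o) auto
  show "Cinf_on {- c<..<a} (\<lambda>r. J r / (a - r))" "Cinf_on {- c<..<a} (\<lambda>r. J r / (c + r))"
    by (intro Cinf_on_divide J Cinf_on_diff Cinf_on_add Cinf_on_const Cinf_on_id o; auto)+
qed

text \<open>Only the relations between the coefficients matter: the derivative \<open>b\<close> of \<open>J\<close> at \<open>0\<close> will cancel in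
  the expansion of the potential, up to higher order.\<close>

lemma K_expansion:
  obtains b where
    "(\<lambda>u. I u - J 0) \<in> O[nhds 0](\<lambda>u. u\<^sup>2)"
    "(\<lambda>u. K0 u - J 0 * u - b / 3 * u ^ 3) \<in> O[nhds 0](\<lambda>u. u ^ 5)"
    "(\<lambda>u. K1 u - J 0 / a * u - (b / a + J 0 / a\<^sup>2) / 3 * u ^ 3) \<in> O[nhds 0](\<lambda>u. u ^ 5)"
    "(\<lambda>u. K3 u - J 0 / c * u - (b / c - J 0 / c\<^sup>2) / 3 * u ^ 3) \<in> O[nhds 0](\<lambda>u. u ^ 5)"
proof -
  have 0: "0 \<in> {- c<..<a}" using a c by simp
  define b where "b = frechet_derivative J (at 0) 1"
  have b: "(J has_real_derivative b) (at 0)" unfolding b_def by (rule Cinf_on_deriv(1)[OF Cinf_J(1) 0])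
  have b1: "((\<lambda>r. J r / (a - r)) has_real_derivative b / a + J 0 / a\<^sup>2) (at 0)"
    using a by (auto intro!: derivative_eq_intros b simp: field_simps power2_eq_square)
  have b3: "((\<lambda>r. J r / (c + r)) has_real_derivative b / c - J 0 / c\<^sup>2) (at 0)"
    using c by (auto intro!: derivative_eq_intros b simp: field_simps power2_eq_square)
  have ev: "\<forall>\<^sub>F u in nhds 0. u\<^sup>2 < a"
    using eventually_nhds_in_open[OF open_dom, of 0] a by simp
  have K00: "K0 0 = 0" "K1 0 = 0" "K3 0 = 0" using K_odd[of 0] by simp_all
  have e0: "\<forall>\<^sub>F u in nhds 0. (K0 has_real_derivative J (u\<^sup>2)) (at u)"
    using ev by eventually_elim (simp add: DERIV_K flip: I_J)
  have e1: "\<forall>\<^sub>F u in nhds 0. (K1 has_real_derivative J (u\<^sup>2) / (a - u\<^sup>2)) (at u)"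
    using ev by eventually_elim (simp add: DERIV_K flip: I_J)
  have e3: "\<forall>\<^sub>F u in nhds 0. (K3 has_real_derivative J (u\<^sup>2) / (c + u\<^sup>2)) (at u)"
    using ev by eventually_elim (simp add: DERIV_K flip: I_J)
  have "filterlim (\<lambda>u::real. u\<^sup>2) (nhds 0) (nhds 0)"
    using tendsto_power[OF filterlim_ident[of "nhds (0::real)"], of 2] by simp
  moreover have "(\<lambda>r. J r - J 0) \<in> O[nhds 0](\<lambda>r. r)"
  proof -
    have "(\<lambda>r. (J r - J 0 - b * r) + b * r) \<in> O[nhds 0](\<lambda>r. r)"
    proof (rule sum_in_bigo)
      have "(\<lambda>r::real. r\<^sup>2) \<in> O[nhds 0](\<lambda>r. r)"
        unfolding power2_eq_square
        using landau_o.big.mult[OF bigo_tendsto[OF filterlim_ident] landau_o.big_refl[of "\<lambda>r::real. r" "nhds 0"]]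
        by simp
      then show "(\<lambda>r. J r - J 0 - b * r) \<in> O[nhds 0](\<lambda>r. r)"
        by (rule landau_o.big_trans[OF Cinf_on_second_order[OF Cinf_J(1) 0 b]])
    qed simp
    then show ?thesis by simp
  qed
  ultimately have "(\<lambda>u. J (u\<^sup>2) - J 0) \<in> O[nhds 0](\<lambda>u. u\<^sup>2)"
    by (rule landau_o.big.compose[rotated])
  then show thesis
    using odd_primitive_expansion[OF Cinf_J(1) 0 b K00(1) e0] odd_primitive_expansion[OF Cinf_J(2) 0 b1 K00(2) e1]
      odd_primitive_expansion[OF Cinf_J(3) 0 b3 K00(3) e3]
    by (intro that) (simp_all add: I_J)
qed

text \<open>The difference quotient of \<open>psi x\<close> between \<open>0\<close> and \<open>r\<close>. At \<open>r = 0\<close> it is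
  \<open>(slope x)\<^sup>2\<close>.\<close>

definition psi1 :: "real^3 \<Rightarrow> real \<Rightarrow> real" where
  "psi1 x r = (X1 x)\<^sup>2 / (a * (a - r)) + (X3 x)\<^sup>2 / (c * (c + r))"

lemma psi_psi1:
  assumes "- c < r" "r < a" shows "psi x r = psi x 0 + r * psi1 x r"
proof -
  have d: "(d - e) * (C / (e * d)) = C / e - C / d" if "d \<noteq> 0" "e \<noteq> 0" for C d e :: real
    using that by (simp add: field_simps)
  have "A / (a - r) = A / a + r * (A / (a * (a - r)))" "C / (c + r) = C / c - r * (C / (c * (c + r)))" for A C
    using d[of "a - r" a A] d[of "c + r" c C] assms a c by simp_all
  then have "psi x r = (X1 x)\<^sup>2 / a + r * ((X1 x)\<^sup>2 / (a * (a - r))) - ((X3 x)\<^sup>2 / c - r * ((X3 x)\<^sup>2 / (c * (c + r)))) - 1"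
    unfolding psi_def by simp
  then show ?thesis unfolding psi_def psi1_def by (simp add: algebra_simps)
qed

lemma psi_0_expansion:
  assumes "x \<in> U"
  shows "psi x 0 = 2 * offset x * (slope (proj x))\<^sup>2
    + (offset x)\<^sup>2 * ((X1 (proj x))\<^sup>2 / a ^ 3 - (X3 (proj x))\<^sup>2 / c ^ 3)"
proof -
  have H: "(X1 (proj x))\<^sup>2 / a - (X3 (proj x))\<^sup>2 / c = 1"
    using proj_in_H[OF assms] by (simp add: H_def)
  have "psi x 0 = (X1 (proj x))\<^sup>2 * (1 + offset x / a)\<^sup>2 / a - (X3 (proj x))\<^sup>2 * (1 - offset x / c)\<^sup>2 / c
      - ((X1 (proj x))\<^sup>2 / a - (X3 (proj x))\<^sup>2 / c)"
    unfolding psi_def X_from_proj[OF assms] H by (simp add: power_mult_distrib)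
  moreover have "P\<^sup>2 * (1 + y / e)\<^sup>2 / e = P\<^sup>2 / e + 2 * y * (P / e)\<^sup>2 + y\<^sup>2 * (P\<^sup>2 / e ^ 3)"
    if "e \<noteq> 0" for P y e :: real
    using that by (simp add: field_simps eval_nat_numeral)
  from this[of a "X1 (proj x)" "offset x"] this[of c "X3 (proj x)" "- offset x"] a c
  have "(X1 (proj x))\<^sup>2 * (1 + offset x / a)\<^sup>2 / a = (X1 (proj x))\<^sup>2 / a
      + 2 * offset x * (X1 (proj x) / a)\<^sup>2 + (offset x)\<^sup>2 * ((X1 (proj x))\<^sup>2 / a ^ 3)"
    "(X3 (proj x))\<^sup>2 * (1 - offset x / c)\<^sup>2 / c = (X3 (proj x))\<^sup>2 / c
      - 2 * offset x * (X3 (proj x) / c)\<^sup>2 + (offset x)\<^sup>2 * ((X3 (proj x))\<^sup>2 / c ^ 3)"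
    by simp_all
  ultimately show ?thesis unfolding slope_sq by (simp add: algebra_simps)
qed

lemma psi1_expansion:
  assumes "x \<in> U" "r < a" "- c < r"
  shows "psi1 x r - (slope (proj x))\<^sup>2 =
    (X1 (proj x))\<^sup>2 * ((2 * offset x / a + (offset x)\<^sup>2 / a\<^sup>2) / (a * (a - r)) + r / (a\<^sup>2 * (a - r)))
    + (X3 (proj x))\<^sup>2 * ((- 2 * offset x / c + (offset x)\<^sup>2 / c\<^sup>2) / (c * (c + r)) - r / (c\<^sup>2 * (c + r)))"
proof -
  have 1: "(P * (1 + y / a))\<^sup>2 / (a * (a - r)) - (P / a)\<^sup>2 =
      P\<^sup>2 * ((2 * y / a + y\<^sup>2 / a\<^sup>2) / (a * (a - r)) + r / (a\<^sup>2 * (a - r)))" for P y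
  proof -
    have "r / (a\<^sup>2 * (a - r)) = 1 / (a * (a - r)) - 1 / a\<^sup>2"
      using a assms by (simp add: field_simps power2_eq_square)
    moreover have "(P * (1 + y / a))\<^sup>2 = P\<^sup>2 * (1 + (2 * y / a + y\<^sup>2 / a\<^sup>2))"
      by (simp add: algebra_simps power2_eq_square)
    ultimately show ?thesis unfolding power_divide by (simp only:) (simp add: distrib_left right_diff_distrib add_divide_distrib)
  qed
  have d: "(d - e) / (e\<^sup>2 * d) = 1 / e\<^sup>2 - 1 / (e * d)" if "d \<noteq> 0" "e \<noteq> 0" for d e :: real
    using that by (simp add: field_simps power2_eq_square)
  have 3: "(P * (1 - y / c))\<^sup>2 / (c * (c + r)) - (P / c)\<^sup>2 =
      P\<^sup>2 * ((- 2 * y / c + y\<^sup>2 / c\<^sup>2) / (c * (c + r)) - r / (c\<^sup>2 * (c + r)))" for P y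
  proof -
    have "r / (c\<^sup>2 * (c + r)) = 1 / c\<^sup>2 - 1 / (c * (c + r))"
      using d[of "c + r" c] c assms by simp
    moreover have "(P * (1 - y / c))\<^sup>2 = P\<^sup>2 * (1 + (- 2 * y / c + y\<^sup>2 / c\<^sup>2))"
      by (simp add: algebra_simps power2_eq_square)
    ultimately show ?thesis unfolding power_divide by (simp only:) (simp add: distrib_left right_diff_distrib add_divide_distrib)
  qed
  show ?thesis unfolding psi1_def slope_sq unfolding X_from_proj[OF assms(1)]
    using 1[of "X1 (proj x)" "offset x"] 3[of "X3 (proj x)" "offset x"] by linarith
qed

end

context oriented_hyperbola
begin

text \<open>The norm of \<open>zeta\<close> is the distance to the nearest point \<open>proj x\<close>; \<open>u\<close> and \<open>w\<close> are of the order of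
  its square root.\<close>

definition sqrt_dist :: "real^3 \<Rightarrow> real" where "sqrt_dist x = sqrt (norm (zeta x))"

text \<open>Up to higher order, a square root of \<open>2 m \<zeta>\<close> with \<open>m = slope (proj x)\<close>.\<close>

definition approx_root :: "real \<Rightarrow> real^3 \<Rightarrow> real \<Rightarrow> complex" where
  "approx_root w x u = Complex w (eps x * slope (proj x) * u)"

text \<open>First \<open>(w\<^sup>2 + u\<^sup>2 psi1)\<^sup>2 = (psi 0)\<^sup>2 + 4 psi1 X2\<^sup>2\<close>, where \<open>psi 0\<close> and \<open>X2\<close> are of the order of the
  distance; so \<open>u\<close> and \<open>w\<close> are of the order of its square root. Then \<open>psi 0 = w\<^sup>2 - u\<^sup>2 psi1\<close> and
  \<open>psi1 = m\<^sup>2\<close> up to higher order, which gives the real part of the square of \<open>w + \<i> eps m u\<close>,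
  and turns the expansions of the elliptic integrals into the cubic form in \<open>u\<close> and \<open>w\<close>.\<close>

lemma branch_estimates:
  fixes u w :: "real^3 \<Rightarrow> real"
  assumes br: "branch W u w" and WU: "W \<subseteq> U" and q: "q \<in> H"
  defines "F \<equiv> at q within W"
  shows "order_ge F sqrt_dist 4 (\<lambda>x. norm ((approx_root (w x) x (u x))\<^sup>2 - 2 * of_real (slope (proj x)) * zeta x))"
    and "order_ge F sqrt_dist 5 (\<lambda>x. potential x (u x) (w x)
      + 2 * J 0 / 3 * (3 * u x * (w x)\<^sup>2 - (slope (proj x))\<^sup>2 * (u x) ^ 3))"
proof -
  let ?ord = "order_ge F sqrt_dist"
  define y m P1 P3 Q where "y = offset" and "m x = slope (proj x)" and "P1 x = X1 (proj x)"
    and "P3 x = X3 (proj x)" and "Q x = psi1 x (rho x)" for x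
  note defs = y_def m_def[abs_def] P1_def[abs_def] P3_def[abs_def] Q_def[abs_def]
  note b = branchD[OF br]
  have qU: "q \<in> U" using q H_subset_U by blast
  have x1: "X1 q \<noteq> 0" using X1_nonzero_on_H[OF q] .
  have evW: "\<forall>\<^sub>F x in F. x \<in> W" by (simp add: F_def eventually_at_filter)
  have T: "(G \<longlongrightarrow> G q) F" if "continuous_on U G" for G :: "real^3 \<Rightarrow> real"
    using that qU WU unfolding F_def continuous_on_def by (blast intro: tendsto_within_subset)
  have T0: "(sqrt_dist \<longlongrightarrow> 0) F"
  proof -
    have "continuous_on U sqrt_dist" unfolding sqrt_dist_def[abs_def]
      by (intro continuous_intros Cinf_on_D(3)[OF Cinf_zeta])
    from T[OF this] show ?thesis using zeta_eq_0[OF qU] q by (simp add: sqrt_dist_def)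
  qed
  have Trho: "(rho \<longlongrightarrow> 0) F"
  proof -
    have "continuous_on U rho" by (rule continuous_on_subset[OF continuous_on_rho]) (auto simp: U_X1)
    from T[OF this] show ?thesis using H_iff_rho[OF x1] q by simp
  qed
  have Ty: "(y \<longlongrightarrow> 0) F" using T[OF continuous_on_offset] offset_on_H[OF q] by (simp add: y_def)
  have TX: "(X1 \<longlongrightarrow> X1 q) F" "(X2 \<longlongrightarrow> 0) F" "(X3 \<longlongrightarrow> X3 q) F"
    using T[of X1] T[of X2] T[of X3] q by (auto simp: H_def intro: continuous_X)
  have Tm: "(m \<longlongrightarrow> slope q) F"
    using T[OF Cinf_on_D(3)[OF Cinf_slope_proj]] proj_on_H[OF q] by (simp add: m_def[abs_def])
  have TP: "(P1 \<longlongrightarrow> X1 q) F" "(P3 \<longlongrightarrow> X3 q) F"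
  proof -
    have "continuous_on U (\<lambda>x. X1 (proj x))" "continuous_on U (\<lambda>x. X3 (proj x))"
      using continuous_on_compose2[OF continuous_X(1)[of UNIV] Cinf_on_D(3)[OF Cinf_proj]]
        continuous_on_compose2[OF continuous_X(3)[of UNIV] Cinf_on_D(3)[OF Cinf_proj]] by simp_all
    from T[OF this(1)] T[OF this(2)] show "(P1 \<longlongrightarrow> X1 q) F" "(P3 \<longlongrightarrow> X3 q) F"
      using proj_on_H[OF q] by (simp_all add: defs)
  qed
  have TQ: "(Q \<longlongrightarrow> (slope q)\<^sup>2) F"
  proof -
    have "(Q \<longlongrightarrow> (X1 q)\<^sup>2 / (a * (a - 0)) + (X3 q)\<^sup>2 / (c * (c + 0))) F"
      unfolding Q_def[abs_def] psi1_def using a c by (intro tendsto_intros TX Trho) auto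
    moreover have "(X1 q)\<^sup>2 / (a * (a - 0)) + (X3 q)\<^sup>2 / (c * (c + 0)) = (slope q)\<^sup>2"
      unfolding slope_sq by (simp add: power_divide power2_eq_square)
    ultimately show ?thesis by simp
  qed
  note lims = tendsto_add tendsto_diff tendsto_mult tendsto_divide tendsto_power tendsto_const
    Ty TP Trho Tm
  have mq: "slope q > 0" using slope_pos[OF x1] .
  have const: "?ord 0 (\<lambda>x. k)" for k by (rule order_ge_tendsto[OF tendsto_const])
  have D: "norm (zeta x) = (sqrt_dist x)\<^sup>2" for x by (simp add: sqrt_dist_def)
  have oD: "?ord 2 (\<lambda>x. norm (zeta x))" by (simp add: order_ge_def D)
  have oX2: "?ord 2 X2"
  proof (rule order_ge_mono[OF always_eventually oD], rule allI)
    show "\<bar>X2 x\<bar> \<le> \<bar>norm (zeta x)\<bar>" for x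
      using abs_Im_le_cmod[of "zeta x"] eps(3)[of x] by (simp add: zeta_def abs_mult)
  qed
  have oy: "?ord 2 y"
  proof (rule order_ge_mono)
    show "?ord 2 (\<lambda>x. norm (zeta x) * (2 / slope q))"
      by (rule order_ge_mult[OF oD const]) simp
    have "\<forall>\<^sub>F x in F. m x > slope q / 2" using order_tendstoD(1)[OF Tm, of "slope q / 2"] mq by simp
    then show "\<forall>\<^sub>F x in F. \<bar>y x\<bar> \<le> \<bar>norm (zeta x) * (2 / slope q)\<bar>"
    proof eventually_elim
      case (elim x)
      have "\<bar>y x\<bar> * (slope q / 2) \<le> \<bar>y x\<bar> * m x" using elim by (intro mult_left_mono) auto
      also have "\<dots> = \<bar>Re (zeta x)\<bar>" using elim mq by (simp add: zeta_def y_def m_def abs_mult)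
      also have "\<dots> \<le> norm (zeta x)" by (rule abs_Re_le_cmod)
      finally show ?case using mq by (simp add: field_simps)
    qed
  qed
  have rW: "rho x = (u x)\<^sup>2" "psi x (rho x) = (w x)\<^sup>2" "- c < rho x" "rho x < a"
    "(w x)\<^sup>2 = psi x 0 + rho x * Q x" "x \<in> U" if x: "x \<in> W" for x
  proof -
    show r: "rho x = (u x)\<^sup>2" "psi x (rho x) = (w x)\<^sup>2" using branch_rho[OF br x] by simp_all
    show "rho x < a" using r b(6)[OF x] by simp
    show "- c < rho x" using c by (simp add: r less_le_trans[of _ 0])
    from psi_psi1[OF this \<open>rho x < a\<close>] r show "(w x)\<^sup>2 = psi x 0 + rho x * Q x" by (simp add: Q_def)
    show "x \<in> U" using x WU by blast
  qed
  have op0: "?ord 2 (\<lambda>x. psi x 0)"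
  proof (rule order_ge_mono)
    show "\<forall>\<^sub>F x in F. \<bar>psi x 0\<bar> \<le> \<bar>y x * (2 * (m x)\<^sup>2) + y x * (y x * ((P1 x)\<^sup>2 / a ^ 3 - (P3 x)\<^sup>2 / c ^ 3))\<bar>"
      using evW
    proof eventually_elim
      case (elim x)
      show ?case unfolding psi_0_expansion[OF rW(6)[OF elim]] defs
        by (rule eq_refl, rule arg_cong[of _ _ abs]) (simp add: algebra_simps power2_eq_square)
    qed
    show "?ord 2 (\<lambda>x. y x * (2 * (m x)\<^sup>2) + y x * (y x * ((P1 x)\<^sup>2 / a ^ 3 - (P3 x)\<^sup>2 / c ^ 3)))"
    proof (intro order_ge_add)
      show "?ord 2 (\<lambda>x. y x * (2 * (m x)\<^sup>2))"
        by (rule order_ge_mult[OF oy order_ge_tendsto], insert a c) (rule lims | simp; fail)+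
      show "?ord 2 (\<lambda>x. y x * (y x * ((P1 x)\<^sup>2 / a ^ 3 - (P3 x)\<^sup>2 / c ^ 3)))"
        by (rule order_ge_mult[OF oy order_ge_tendsto], insert a c) (rule lims | simp; fail)+
    qed
  qed
  have oh: "?ord 2 (\<lambda>x. (w x)\<^sup>2 + rho x * Q x)"
  proof (rule order_ge_mono)
    show "?ord 2 (\<lambda>x. \<bar>psi x 0\<bar> + 2 * sqrt (Q x) * \<bar>X2 x\<bar>)"
    proof (rule order_ge_add)
      show "?ord 2 (\<lambda>x. \<bar>psi x 0\<bar>)" using op0 by (simp add: order_ge_def)
      have "?ord 2 (\<lambda>x. \<bar>X2 x\<bar>)" using oX2 by (simp add: order_ge_def)
      then show "?ord 2 (\<lambda>x. 2 * sqrt (Q x) * \<bar>X2 x\<bar>)"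
        by (rule order_ge_mult[OF order_ge_tendsto[OF tendsto_mult[OF tendsto_const tendsto_real_sqrt[OF TQ]]]]) simp
    qed
    show "\<forall>\<^sub>F x in F. \<bar>(w x)\<^sup>2 + rho x * Q x\<bar> \<le> \<bar>\<bar>psi x 0\<bar> + 2 * sqrt (Q x) * \<bar>X2 x\<bar>\<bar>"
      using evW
    proof eventually_elim
      case (elim x)
      note r = rW[OF elim]
      have Q: "Q x \<ge> 0" using r(3,4) a c by (simp add: Q_def psi1_def)
      have "((w x)\<^sup>2 + rho x * Q x)\<^sup>2 = ((w x)\<^sup>2 - rho x * Q x)\<^sup>2 + 4 * Q x * (u x * w x)\<^sup>2"
        by (simp add: r(1) power2_eq_square algebra_simps)
      also have "\<dots> = (psi x 0)\<^sup>2 + 4 * Q x * (X2 x)\<^sup>2" using r(5) b(7)[OF elim] by simp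
      also have "\<dots> \<le> (\<bar>psi x 0\<bar> + 2 * sqrt (Q x) * \<bar>X2 x\<bar>)\<^sup>2"
        using Q by (simp add: power2_sum power_mult_distrib)
      finally show ?case by (simp only: abs_le_square_iff)
    qed
  qed
  have ow2: "?ord 2 (\<lambda>x. (w x)\<^sup>2)" and orQ: "?ord 2 (\<lambda>x. rho x * Q x)"
  proof -
    have *: "\<forall>\<^sub>F x in F. 0 \<le> rho x * Q x"
      using evW
    proof eventually_elim
      case (elim x)
      then show ?case using rW[OF elim] a c by (simp add: Q_def psi1_def)
    qed
    show "?ord 2 (\<lambda>x. (w x)\<^sup>2)" "?ord 2 (\<lambda>x. rho x * Q x)"
      by (rule order_ge_mono[OF _ oh], use * in eventually_elim, simp)+
  qed
  have ow: "?ord 1 w"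
    using bigo_square_cancel[of w F sqrt_dist] ow2 by (simp add: order_ge_def)
  have orho: "?ord 2 rho"
  proof (rule order_ge_mono)
    have "?ord 0 (\<lambda>x. 1 / Q x)"
      using mq by (intro order_ge_tendsto[OF tendsto_divide[OF tendsto_const TQ]]) auto
    then show "?ord 2 (\<lambda>x. (rho x * Q x) * (1 / Q x))" by (rule order_ge_mult[OF orQ]) simp
    have "\<forall>\<^sub>F x in F. Q x > 0" using order_tendstoD(1)[OF TQ, of 0] mq by simp
    then show "\<forall>\<^sub>F x in F. \<bar>rho x\<bar> \<le> \<bar>(rho x * Q x) * (1 / Q x)\<bar>" by eventually_elim simp
  qed
  have ou: "?ord 1 u"
  proof -
    have "?ord 2 (\<lambda>x. (u x)\<^sup>2)"
      by (rule order_ge_mono[OF _ orho]) (use evW in eventually_elim, simp add: rW)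
    then show ?thesis using bigo_square_cancel[of u F sqrt_dist] by (simp add: order_ge_def)
  qed
  have oQm: "?ord 2 (\<lambda>x. Q x - (m x)\<^sup>2)"
  proof (rule order_ge_mono)
    show "\<forall>\<^sub>F x in F. \<bar>Q x - (m x)\<^sup>2\<bar> \<le> \<bar>
       (y x * ((2 / a + y x / a\<^sup>2) / (a * (a - rho x)) * (P1 x)\<^sup>2) + rho x * (1 / (a\<^sup>2 * (a - rho x)) * (P1 x)\<^sup>2))
     + (y x * ((- 2 / c + y x / c\<^sup>2) / (c * (c + rho x)) * (P3 x)\<^sup>2) - rho x * (1 / (c\<^sup>2 * (c + rho x)) * (P3 x)\<^sup>2))\<bar>"
      using evW
    proof eventually_elim
      case (elim x)
      show ?case unfolding defs psi1_expansion[OF rW(6)[OF elim] rW(4)[OF elim] rW(3)[OF elim]]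
        by (rule eq_refl, rule arg_cong[of _ _ abs])
          (simp add: algebra_simps add_divide_distrib diff_divide_distrib power2_eq_square)
    qed
    show "?ord 2 (\<lambda>x.
       (y x * ((2 / a + y x / a\<^sup>2) / (a * (a - rho x)) * (P1 x)\<^sup>2) + rho x * (1 / (a\<^sup>2 * (a - rho x)) * (P1 x)\<^sup>2))
     + (y x * ((- 2 / c + y x / c\<^sup>2) / (c * (c + rho x)) * (P3 x)\<^sup>2) - rho x * (1 / (c\<^sup>2 * (c + rho x)) * (P3 x)\<^sup>2)))"
      by (insert a c, intro order_ge_add order_ge_diff order_ge_mult[OF oy order_ge_tendsto] order_ge_mult[OF orho order_ge_tendsto])
        (rule lims | simp; fail)+
  qed
  show "?ord 4 (\<lambda>x. norm ((approx_root (w x) x (u x))\<^sup>2 - 2 * of_real (slope (proj x)) * zeta x))"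
  proof (rule order_ge_mono)
    show "\<forall>\<^sub>F x in F. \<bar>norm ((approx_root (w x) x (u x))\<^sup>2 - 2 * of_real (slope (proj x)) * zeta x)\<bar>
      \<le> \<bar>(y x)\<^sup>2 * ((P1 x)\<^sup>2 / a ^ 3 - (P3 x)\<^sup>2 / c ^ 3) + rho x * (Q x - (m x)\<^sup>2)\<bar>"
      using evW
    proof eventually_elim
      case (elim x)
      note r = rW[OF elim]
      have "(approx_root (w x) x (u x))\<^sup>2 - 2 * of_real (slope (proj x)) * zeta x
          = of_real ((w x)\<^sup>2 - (m x)\<^sup>2 * (u x)\<^sup>2 - 2 * y x * (m x)\<^sup>2)"
        using b(7)[OF elim] eps(2)[of x]
        by (simp add: complex_eq_iff approx_root_def zeta_def m_def y_def power2_eq_square algebra_simps)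
      also have "(w x)\<^sup>2 - (m x)\<^sup>2 * (u x)\<^sup>2 - 2 * y x * (m x)\<^sup>2 =
          (y x)\<^sup>2 * ((P1 x)\<^sup>2 / a ^ 3 - (P3 x)\<^sup>2 / c ^ 3) + rho x * (Q x - (m x)\<^sup>2)"
        unfolding r(5) psi_0_expansion[OF r(6)] unfolding r(1) defs by (simp add: algebra_simps)
      finally show ?case by (simp only: norm_of_real abs_abs)
    qed
    have "?ord 4 (\<lambda>x. (y x)\<^sup>2 * ((P1 x)\<^sup>2 / a ^ 3 - (P3 x)\<^sup>2 / c ^ 3))"
      by (rule order_ge_mult[OF order_ge_power[OF oy refl] order_ge_tendsto], insert a c)
        (rule lims | simp; fail)+
    moreover have "?ord 4 (\<lambda>x. rho x * (Q x - (m x)\<^sup>2))"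
      by (rule order_ge_mult[OF orho oQm]) simp
    ultimately show "?ord 4 (\<lambda>x. (y x)\<^sup>2 * ((P1 x)\<^sup>2 / a ^ 3 - (P3 x)\<^sup>2 / c ^ 3) + rho x * (Q x - (m x)\<^sup>2))"
      by (rule order_ge_add)
  qed
  obtain k where K: "(\<lambda>u. I u - J 0) \<in> O[nhds 0](\<lambda>u. u\<^sup>2)"
    "(\<lambda>u. K0 u - J 0 * u - k / 3 * u ^ 3) \<in> O[nhds 0](\<lambda>u. u ^ 5)"
    "(\<lambda>u. K1 u - J 0 / a * u - (k / a + J 0 / a\<^sup>2) / 3 * u ^ 3) \<in> O[nhds 0](\<lambda>u. u ^ 5)"
    "(\<lambda>u. K3 u - J 0 / c * u - (k / c - J 0 / c\<^sup>2) / 3 * u ^ 3) \<in> O[nhds 0](\<lambda>u. u ^ 5)"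
    by (rule K_expansion)
  have Tu: "(u \<longlongrightarrow> 0) F"
  proof -
    have "((\<lambda>x. sqrt (rho x)) \<longlongrightarrow> sqrt 0) F" by (intro tendsto_intros Trho)
    then have "((\<lambda>x. \<bar>u x\<bar>) \<longlongrightarrow> 0) F"
      by (rule Lim_transform_eventually[THEN tendsto_eq_rhs, rotated 2, rotated]) (use evW in \<open>eventually_elim, simp add: rW\<close>, simp)
    then show ?thesis by (simp add: tendsto_rabs_zero_iff)
  qed
  note E = order_ge_compose[OF K(1) ou Tu] order_ge_compose[OF K(2) ou Tu]
    order_ge_compose[OF K(3) ou Tu] order_ge_compose[OF K(4) ou Tu]
  have K_order: "?ord 1 (\<lambda>x. K (u x))"
    if "?ord 5 (\<lambda>x. K (u x) - l * u x - n * (u x) ^ 3)" for K l n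
  proof -
    have 1: "?ord 1 (\<lambda>x. u x * l)" by (rule order_ge_mult[OF ou const]) simp
    have "?ord 3 (\<lambda>x. (u x) ^ 3 * n)"
      by (rule order_ge_mult[OF order_ge_power[OF ou refl] const]) simp
    then have 2: "?ord 1 (\<lambda>x. (u x) ^ 3 * n)" by (rule order_ge_weaken[OF T0]) simp
    from order_ge_add[OF order_ge_add[OF order_ge_weaken[OF T0 that] 1] 2]
    show ?thesis by (simp add: mult.commute)
  qed
  have oK: "?ord 1 (\<lambda>x. K1 (u x) - K3 (u x))"
    by (rule order_ge_diff[OF K_order[OF E(3)] K_order[OF E(4)]])
  show "?ord 5 (\<lambda>x. potential x (u x) (w x)
      + 2 * J 0 / 3 * (3 * u x * (w x)\<^sup>2 - (slope (proj x))\<^sup>2 * (u x) ^ 3))"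
  proof (rule order_ge_mono)
    let ?e0 = "\<lambda>x. K0 (u x) - J 0 * u x - k / 3 * (u x) ^ 3"
    let ?e1 = "\<lambda>x. K1 (u x) - J 0 / a * u x - (k / a + J 0 / a\<^sup>2) / 3 * (u x) ^ 3"
    let ?e3 = "\<lambda>x. K3 (u x) - J 0 / c * u x - (k / c - J 0 / c\<^sup>2) / 3 * (u x) ^ 3"
    let ?M = "\<lambda>x. psi1 x 0 - (m x)\<^sup>2"
    \<comment> \<open>The exact remainder; each of its terms has order \<open>5\<close>. The coefficient \<open>k\<close> survives only in
      front of \<open>psi x 0\<close>, which contributes two orders.\<close>
    let ?rem = "\<lambda>x. ?e0 x - (X1 x)\<^sup>2 * ?e1 x + (X3 x)\<^sup>2 * ?e3 x - psi x 0 * ((u x) ^ 3 * (k / 3))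
       + (u x) ^ 3 * (J 0 * ((Q x - (m x)\<^sup>2) - ?M x * (1 / 3)))
       + (u x * w x)\<^sup>2 * (K1 (u x) - K3 (u x)) - (u x * (w x)\<^sup>2) * (I (u x) - J 0)"
    show "\<forall>\<^sub>F x in F. \<bar>potential x (u x) (w x)
      + 2 * J 0 / 3 * (3 * u x * (w x)\<^sup>2 - (slope (proj x))\<^sup>2 * (u x) ^ 3)\<bar> \<le> \<bar>?rem x\<bar>"
      using evW
    proof eventually_elim
      case (elim x)
      note r = rW[OF elim]
      have p0: "psi x 0 = (X1 x)\<^sup>2 / a - (X3 x)\<^sup>2 / c - 1" by (simp add: psi_def)
      have p1: "psi1 x 0 = (X1 x)\<^sup>2 / a\<^sup>2 + (X3 x)\<^sup>2 / c\<^sup>2" by (simp add: psi1_def power2_eq_square)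
      have w2: "(w x)\<^sup>2 = psi x 0 + (u x)\<^sup>2 * Q x" using r(5,1) by simp
      have "?rem x = K0 (u x) - (X1 x)\<^sup>2 * K1 (u x) + (X3 x)\<^sup>2 * K3 (u x)
         + J 0 * u x * ((X1 x)\<^sup>2 / a - (X3 x)\<^sup>2 / c - 1) + k / 3 * (u x) ^ 3 * ((X1 x)\<^sup>2 / a - (X3 x)\<^sup>2 / c - 1)
         + J 0 / 3 * (u x) ^ 3 * ((X1 x)\<^sup>2 / a\<^sup>2 + (X3 x)\<^sup>2 / c\<^sup>2) - psi x 0 * ((u x) ^ 3 * (k / 3))
       + (u x) ^ 3 * (J 0 * ((Q x - (m x)\<^sup>2) - ?M x * (1 / 3)))
       + (u x * w x)\<^sup>2 * (K1 (u x) - K3 (u x)) - (u x * (w x)\<^sup>2) * (I (u x) - J 0)"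
        by (simp add: algebra_simps add_divide_distrib diff_divide_distrib)
      also have "\<dots> = K0 (u x) - (X1 x)\<^sup>2 * K1 (u x) + (X3 x)\<^sup>2 * K3 (u x)
         + J 0 * u x * ((w x)\<^sup>2 - (u x)\<^sup>2 * Q x)
       + (u x) ^ 3 * (J 0 * (Q x - (m x)\<^sup>2 * (2 / 3)))
       + (u x * w x)\<^sup>2 * (K1 (u x) - K3 (u x)) - (u x * (w x)\<^sup>2) * (I (u x) - J 0)"
        unfolding w2 p0[symmetric] p1[symmetric] by (simp add: algebra_simps)
      also have "\<dots> = potential x (u x) (w x)
        + 2 * J 0 / 3 * (3 * u x * (w x)\<^sup>2 - (m x)\<^sup>2 * (u x) ^ 3)"
        unfolding potential_def b(7)[OF elim, symmetric]
        by (simp add: algebra_simps power2_eq_square power3_eq_cube)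
      finally show ?case unfolding m_def by simp
    qed
    have oM: "?ord 2 ?M"
    proof (rule order_ge_mono)
      show "\<forall>\<^sub>F x in F. \<bar>?M x\<bar> \<le> \<bar>y x * ((2 / a + y x / a\<^sup>2) / (a * a) * (P1 x)\<^sup>2)
        + y x * ((- 2 / c + y x / c\<^sup>2) / (c * c) * (P3 x)\<^sup>2)\<bar>"
        using evW
      proof eventually_elim
        case (elim x)
        have "- c < 0" using c by simp
        from psi1_expansion[OF rW(6)[OF elim] a this] show ?case unfolding defs
          by (intro eq_refl arg_cong[of _ _ abs])
            (simp add: algebra_simps add_divide_distrib diff_divide_distrib power2_eq_square)
      qed
      show "?ord 2 (\<lambda>x. y x * ((2 / a + y x / a\<^sup>2) / (a * a) * (P1 x)\<^sup>2)
        + y x * ((- 2 / c + y x / c\<^sup>2) / (c * c) * (P3 x)\<^sup>2))"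
        by (insert a c, intro order_ge_add order_ge_mult[OF oy order_ge_tendsto])
          (rule lims | simp; fail)+
    qed
    have o3: "?ord 3 (\<lambda>x. (u x) ^ 3)" by (rule order_ge_power[OF ou]) simp
    show "?ord 5 ?rem"
    proof -
      have 2: "?ord 0 (\<lambda>x. (X1 x)\<^sup>2)" "?ord 0 (\<lambda>x. (X3 x)\<^sup>2)"
        using order_ge_tendsto[OF tendsto_power[OF TX(1)]] order_ge_tendsto[OF tendsto_power[OF TX(3)]] by auto
      have r1: "?ord 5 (\<lambda>x. (X1 x)\<^sup>2 * ?e1 x)" and r3: "?ord 5 (\<lambda>x. (X3 x)\<^sup>2 * ?e3 x)"
        by (rule order_ge_mult[OF 2(1) E(3)], simp, rule order_ge_mult[OF 2(2) E(4)], simp)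
      have r4: "?ord 5 (\<lambda>x. psi x 0 * ((u x) ^ 3 * (k / 3)))"
        by (rule order_ge_mult[OF op0 order_ge_mult[OF o3 const refl]]) simp
      have "?ord 2 (\<lambda>x. (Q x - (m x)\<^sup>2) - ?M x * (1 / 3))"
        by (intro order_ge_diff[OF oQm] order_ge_mult[OF oM const]) simp
      then have r5: "?ord 5 (\<lambda>x. (u x) ^ 3 * (J 0 * ((Q x - (m x)\<^sup>2) - ?M x * (1 / 3))))"
        by (rule order_ge_mult[OF o3 order_ge_mult[OF const _ refl]]) simp
      have "?ord 4 (\<lambda>x. (u x * w x)\<^sup>2)"
        by (rule order_ge_power[OF order_ge_mult[OF ou ow refl]]) simp
      then have r6: "?ord 5 (\<lambda>x. (u x * w x)\<^sup>2 * (K1 (u x) - K3 (u x)))"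
        by (rule order_ge_mult[OF _ oK]) simp
      have "?ord 3 (\<lambda>x. u x * (w x)\<^sup>2)" by (rule order_ge_mult[OF ou ow2]) simp
      then have r7: "?ord 5 (\<lambda>x. (u x * (w x)\<^sup>2) * (I (u x) - J 0))"
        by (rule order_ge_mult[OF _ E(1)]) simp
      show ?thesis
        by (rule order_ge_diff[OF order_ge_add[OF order_ge_add[OF order_ge_diff[OF order_ge_add[OF
                order_ge_diff[OF E(2) r1] r3] r4] r5] r6] r7])
    qed
  qed
qed

end

section \<open>Square roots, monodromy and integrability\<close>

text \<open>The quotient \<open>z / s\<^sup>2\<close> is close to \<open>1 / (2 m)\<close>, so its principal root \<open>d\<close> is defined and corrects \<open>s\<close> to
  an exact root \<open>\<sigma> = s d\<close> of \<open>z\<close>. With \<open>k\<^sup>2 = 2 m\<close> the difference of the cubes is controlled by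
  \<open>(s - k \<sigma>) s (1 + k d) = s\<^sup>2 - k\<^sup>2 z\<close>, where \<open>\<bar>1 + k d\<bar> \<ge> 1\<close>.\<close>

lemma square_root_close:
  fixes s z :: complex and m C :: real
  assumes m: "m > 0" and z: "z \<noteq> 0" and close: "norm (s\<^sup>2 - 2 * of_real m * z) \<le> C * (norm z)\<^sup>2"
    and C: "C * norm z \<le> m"
  defines "\<sigma> \<equiv> s * csqrt (z / s\<^sup>2)"
  shows "s \<noteq> 0" "z / s\<^sup>2 \<notin> \<real>\<^sub>\<le>\<^sub>0" "\<sigma>\<^sup>2 = z"
    "norm (s ^ 3 - (of_real (sqrt (2 * m)) * \<sigma>) ^ 3) \<le> 10 * C * (norm z)\<^sup>2 * sqrt (m * norm z)"
proof -
  define Z k where "Z = norm z" and "k = (of_real (sqrt (2 * m)) :: complex)"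
  have Z: "Z > 0" using z by (simp add: Z_def)
  have k2: "k\<^sup>2 = 2 * of_real m" using m by (simp add: k_def flip: of_real_power)
  have cl: "norm (s\<^sup>2 - k\<^sup>2 * z) \<le> C * Z\<^sup>2" using close by (simp add: k2 Z_def)
  have "C * Z\<^sup>2 \<le> m * Z" using mult_right_mono[OF C, of Z] Z by (simp add: Z_def power2_eq_square)
  with cl have cl': "norm (s\<^sup>2 - k\<^sup>2 * z) \<le> m * Z" by simp
  have nk: "norm (k\<^sup>2 * z) = 2 * (m * Z)" using m by (simp add: k2 norm_mult Z_def)
  have lo: "m * Z \<le> (norm s)\<^sup>2" and hi: "(norm s)\<^sup>2 \<le> 3 * (m * Z)"
    using cl' nk norm_triangle_ineq2[of "k\<^sup>2 * z" "s\<^sup>2"] norm_triangle_ineq2[of "s\<^sup>2" "k\<^sup>2 * z"]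
    by (simp_all add: norm_power norm_minus_commute)
  have mZ: "m * Z > 0" using m Z by simp
  then have "(norm s)\<^sup>2 > 0" using lo by linarith
  then show s: "s \<noteq> 0" by auto
  have "norm (s\<^sup>2 / z - 2 * of_real m) = norm (s\<^sup>2 - k\<^sup>2 * z) / Z"
    using z by (simp add: Z_def k2 field_simps flip: norm_divide)
  also have "\<dots> \<le> m" using cl' Z by (simp add: field_simps)
  finally have "\<bar>Re (s\<^sup>2 / z - 2 * of_real m)\<bar> \<le> m" using abs_Re_le_cmod order_trans by blast
  then have "Re (s\<^sup>2 / z) > 0" using m by (simp add: abs_le_iff)
  moreover have "z / s\<^sup>2 = inverse (s\<^sup>2 / z)" by simp
  ultimately have "Re (z / s\<^sup>2) > 0" by (simp only: inverse_complex.sel) (auto intro!: divide_pos_pos add_pos_nonneg)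
  then show "z / s\<^sup>2 \<notin> \<real>\<^sub>\<le>\<^sub>0" by (auto simp: complex_nonpos_Reals_iff)
  show \<sigma>2: "\<sigma>\<^sup>2 = z" using s by (simp add: \<sigma>_def power_mult_distrib)
  define d where "d = csqrt (z / s\<^sup>2)"
  have d2: "d\<^sup>2 * s\<^sup>2 = z" using s by (simp add: d_def)
  have "Re d \<ge> 0" using csqrt_principal[of "z / s\<^sup>2"] by (auto simp: d_def)
  then have "Re (1 + k * d) \<ge> 1" using m by (simp add: k_def)
  then have 1: "norm (1 + k * d) \<ge> 1" using complex_Re_le_cmod order_trans by blast
  have "(s - k * \<sigma>) * (s * (1 + k * d)) = s\<^sup>2 - k\<^sup>2 * (d\<^sup>2 * s\<^sup>2)"
    unfolding \<sigma>_def d_def[symmetric] by (simp add: algebra_simps power2_eq_square)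
  then have "norm (s - k * \<sigma>) * norm s * norm (1 + k * d) = norm (s\<^sup>2 - k\<^sup>2 * z)"
    unfolding d2 by (simp add: mult.assoc flip: norm_mult)
  moreover have "norm (s - k * \<sigma>) * norm s * 1 \<le> norm (s - k * \<sigma>) * norm s * norm (1 + k * d)"
    using 1 by (intro mult_left_mono) auto
  ultimately have "norm (s - k * \<sigma>) * norm s \<le> C * Z\<^sup>2" using cl by simp
  moreover have ls: "sqrt (m * Z) \<le> norm s" using lo by (intro real_le_lsqrt) auto
  ultimately have A: "norm (s - k * \<sigma>) * sqrt (m * Z) \<le> C * Z\<^sup>2"
    using mult_left_mono[OF ls, of "norm (s - k * \<sigma>)"] by simp
  have n\<sigma>: "(norm (k * \<sigma>))\<^sup>2 = 2 * (m * Z)" using nk \<sigma>2 by (simp add: power_mult_distrib flip: norm_power)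
  have "norm s * norm (k * \<sigma>) \<le> (norm s)\<^sup>2 + (norm (k * \<sigma>))\<^sup>2"
    using sum_squares_bound[of "norm s" "norm (k * \<sigma>)"]
      mult_nonneg_nonneg[OF norm_ge_zero[of s] norm_ge_zero[of "k * \<sigma>"]] by linarith
  moreover have "norm (s\<^sup>2 + s * (k * \<sigma>) + (k * \<sigma>)\<^sup>2) \<le> (norm s)\<^sup>2 + norm s * norm (k * \<sigma>) + (norm (k * \<sigma>))\<^sup>2"
    by (intro norm_triangle_le add_mono) (simp_all add: norm_mult norm_power)
  ultimately have B: "norm (s\<^sup>2 + s * (k * \<sigma>) + (k * \<sigma>)\<^sup>2) \<le> 10 * (m * Z)" using hi n\<sigma> by linarith
  show "norm (s ^ 3 - (of_real (sqrt (2 * m)) * \<sigma>) ^ 3) \<le> 10 * C * (norm z)\<^sup>2 * sqrt (m * norm z)"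
  proof -
    have "norm (s ^ 3 - (k * \<sigma>) ^ 3) = norm (s - k * \<sigma>) * norm (s\<^sup>2 + s * (k * \<sigma>) + (k * \<sigma>)\<^sup>2)"
      unfolding norm_mult[symmetric] by (simp add: algebra_simps power2_eq_square power3_eq_cube)
    also have "\<dots> \<le> norm (s - k * \<sigma>) * (10 * (m * Z))" using B by (intro mult_left_mono) auto
    also have "\<dots> = 10 * sqrt (m * Z) * (norm (s - k * \<sigma>) * sqrt (m * Z))"
      using mZ by simp
    also have "\<dots> \<le> 10 * sqrt (m * Z) * (C * Z\<^sup>2)" using A mZ by (intro mult_left_mono) auto
    finally show ?thesis by (simp add: k_def Z_def mult_ac)
  qed
qed

text \<open>Lift \<open>z\<close> along the loop to a logarithm \<open>L\<close>. The quotient of \<open>\<sigma>\<close> by \<open>exp (L / 2)\<close> has square \<open>1\<close>, so it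
  is a parallel unit section; \<open>\<sigma>\<close> returns to itself, while \<open>exp (L / 2)\<close> changes sign because the
  winding number is odd.\<close>

lemma has_monodromy_minus_one:
  fixes V :: "'i \<Rightarrow> (real^3) set" and \<sigma> :: "'i \<Rightarrow> real^3 \<Rightarrow> complex"
  assumes cont: "\<And>i. continuous_on (V i \<inter> B) (\<sigma> i)"
    and sq: "\<And>i x. x \<in> V i \<inter> B \<Longrightarrow> (\<sigma> i x)\<^sup>2 = z x"
    and trans: "\<And>i j x. x \<in> V i \<inter> V j \<inter> B \<Longrightarrow> \<sigma> i x = g i j x *\<^sub>R \<sigma> j x"
    and \<gamma>: "path \<gamma>" "pathfinish \<gamma> = pathstart \<gamma>" "path_image \<gamma> \<subseteq> B"
    and z: "continuous_on B z" "\<And>x. x \<in> path_image \<gamma> \<Longrightarrow> z x \<noteq> 0"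
    and wn: "winding_number (z \<circ> \<gamma>) 0 \<in> {1, -1}"
  shows "has_monodromy V g \<gamma> (-1)"
proof -
  have "path (z \<circ> \<gamma>)" using \<gamma> z by (intro path_continuous_image) (auto intro: continuous_on_subset)
  moreover have "0 \<notin> path_image (z \<circ> \<gamma>)" using z(2) by (force simp: path_image_compose)
  ultimately obtain L where L: "path L" "pathfinish L - pathstart L = 2 * of_real pi * \<i> * winding_number (z \<circ> \<gamma>) 0"
    and zL: "\<And>t. t \<in> {0..1} \<Longrightarrow> (z \<circ> \<gamma>) t = 0 + exp (L t)"
    by (rule winding_number_as_continuous_log) blast
  define r where "r t = exp (L t / 2)" for t
  have r2: "(r t)\<^sup>2 = z (\<gamma> t)" if "t \<in> {0..1}" for t
    using zL[OF that] by (simp add: r_def flip: exp_of_nat_mult)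
  have \<gamma>B: "\<gamma> t \<in> B" if "t \<in> {0..1}" for t using that \<gamma>(3) by (auto simp: path_image_def)
  have half: "r 1 = - r 0"
  proof -
    have "L 1 / 2 = L 0 / 2 + of_real pi * \<i> \<or> L 1 / 2 = L 0 / 2 - of_real pi * \<i>"
      using L(2) wn by (auto simp: pathfinish_def pathstart_def field_simps)
    then show ?thesis unfolding r_def
      by (elim disjE) (simp_all only: exp_add exp_diff exp_pi_i, simp_all)
  qed
  define s where "s i t = Re (\<sigma> i (\<gamma> t) / r t)" for i t
  have r0: "r t \<noteq> 0" for t by (simp add: r_def)
  have pm: "\<sigma> i (\<gamma> t) / r t = 1 \<or> \<sigma> i (\<gamma> t) / r t = -1" if "t \<in> {0..1}" "\<gamma> t \<in> V i" for i t
  proof -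
    have "(\<sigma> i (\<gamma> t))\<^sup>2 = (r t)\<^sup>2"
      using sq[of "\<gamma> t" i] r2[OF that(1)] \<gamma>B[OF that(1)] that by simp
    then have "(\<sigma> i (\<gamma> t) / r t)\<^sup>2 = 1" using r0[of t] by (simp add: power_divide)
    then show ?thesis by (simp add: power2_eq_1_iff)
  qed
  show ?thesis unfolding has_monodromy_def
  proof (intro exI[of _ s] conjI allI ballI impI)
    fix i
    have rc: "continuous_on {0..1} r" unfolding r_def using L(1) by (auto simp: path_def intro!: continuous_intros)
    have "continuous_on {t \<in> {0..1}. \<gamma> t \<in> V i} (\<lambda>t. \<sigma> i (\<gamma> t))"
      by (rule continuous_on_compose2[OF cont[of i] continuous_on_subset[OF \<gamma>(1)[unfolded path_def]]])
        (use \<gamma>B in auto)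
    then show "continuous_on {t \<in> {0..1}. \<gamma> t \<in> V i} (s i)"
      unfolding s_def using r0 by (intro continuous_intros continuous_on_subset[OF rc]) auto
    fix t assume t: "t \<in> {0..1::real}"
    show "s i t \<in> {1, -1}" if "\<gamma> t \<in> V i" using pm[OF t that] by (auto simp: s_def)
    show "s i t = g i j (\<gamma> t) * s j t" if "\<gamma> t \<in> V i \<inter> V j" for j
    proof -
      have "\<sigma> i (\<gamma> t) / r t = g i j (\<gamma> t) *\<^sub>R (\<sigma> j (\<gamma> t) / r t)"
        using trans[of "\<gamma> t" i j] that \<gamma>B[OF t] by (simp add: divide_inverse)
      then show ?thesis by (simp add: s_def)
    qed
  next
    fix i assume "pathstart \<gamma> \<in> V i"
    show "s i 1 = -1 * s i 0"
      using \<gamma>(2) by (simp add: s_def half pathfinish_def pathstart_def)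
  qed
qed

text \<open>A continuous majorant on all of \<open>U\<close>, including \<open>\<Sigma>\<close>, is bounded on compact sets.\<close>

lemma locally_square_integrable_bounded:
  assumes U: "open U" and S: "closed \<Sigma>" and h: "continuous_on (U - \<Sigma>) h"
    and N: "continuous_on U N" "\<And>x. x \<in> U - \<Sigma> \<Longrightarrow> \<bar>h x\<bar> \<le> N x"
  shows "locally_square_integrable U \<Sigma> h"
  unfolding locally_square_integrable_def
proof (intro allI impI)
  fix K assume K: "compact K \<and> K \<subseteq> U"
  have "compact (N ` K)" using K N(1) by (intro compact_continuous_image) (auto intro: continuous_on_subset)
  then obtain b where b: "\<And>x. x \<in> K \<Longrightarrow> \<bar>N x\<bar> \<le> b"
    using compact_imp_bounded[of "N ` K"] by (auto simp: bounded_real)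
  have "K - \<Sigma> \<in> sets borel" using K S compact_imp_closed[of K] by (intro sets.Diff borel_closed) auto
  then have "K - \<Sigma> \<in> sets lebesgue" using sets_completionI_sets[of "K - \<Sigma>" lborel] by simp
  moreover have "bounded (K - \<Sigma>)" using K bounded_subset[OF compact_imp_bounded, of K "K - \<Sigma>"] by auto
  ultimately have L: "K - \<Sigma> \<in> lmeasurable" by (intro bounded_set_imp_lmeasurable)
  show "(\<lambda>x. (h x)\<^sup>2) absolutely_integrable_on (K - \<Sigma>)"
  proof (rule measurable_bounded_by_integrable_imp_absolutely_integrable)
    show M: "K - \<Sigma> \<in> sets lebesgue" using L by (rule fmeasurableD)
    have "continuous_on (K - \<Sigma>) (\<lambda>x. (h x)\<^sup>2)"
      using K by (intro continuous_intros continuous_on_subset[OF h]) auto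
    then show "(\<lambda>x. (h x)\<^sup>2) \<in> borel_measurable (lebesgue_on (K - \<Sigma>))"
      using M by (rule continuous_imp_measurable_on_sets_lebesgue)
    show "(\<lambda>x. b\<^sup>2) integrable_on K - \<Sigma>" by (rule integrable_on_const[OF L])
    fix x assume x: "x \<in> K - \<Sigma>"
    then have "\<bar>h x\<bar> \<le> b" using N(2)[of x] b[of x] K by fastforce
    then show "norm ((h x)\<^sup>2) \<le> b\<^sup>2" using power_mono[of "\<bar>h x\<bar>" b 2] by simp
  qed
qed

lemma section_norm_continuous:
  fixes V :: "'i \<Rightarrow> (real^3) set" and F :: "'i \<Rightarrow> real^3 \<Rightarrow> 'b::real_normed_vector"
  assumes flat: "flat_Z2_bundle X V g" and sec: "bundle_section V g F"
  shows "x \<in> V i \<Longrightarrow> section_norm V F x = norm (F i x)"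
    and "(\<And>i. continuous_on (V i) (F i)) \<Longrightarrow> continuous_on X (section_norm V F)"
proof -
  have eq: "section_norm V F x = norm (F i x)" if x: "x \<in> V i" for x i
  proof -
    define j where "j = (SOME i. x \<in> V i)"
    have j: "x \<in> V j" using someI[of "\<lambda>i. x \<in> V i", OF x] by (simp add: j_def)
    then have 1: "F j x = g j i x *\<^sub>R F i x" using x sec unfolding bundle_section_def by blast
    have "g j i x \<in> {1, -1}" using j x flat unfolding flat_Z2_bundle_def by blast
    then have "\<bar>g j i x\<bar> = 1" by auto
    then show ?thesis unfolding section_norm_def j_def[symmetric] 1 by simp
  qed
  then show "x \<in> V i \<Longrightarrow> section_norm V F x = norm (F i x)" .
  assume cont: "\<And>i. continuous_on (V i) (F i)"
  have X: "X = (\<Union>i. V i)" and op: "\<And>i. open (V i)" 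
    using flat unfolding flat_Z2_bundle_def by (blast, blast)
  show "continuous_on X (section_norm V F)" unfolding X
  proof (rule continuous_on_open_UN)
    show "open (V i)" for i by (rule op)
    show "continuous_on (V i) (section_norm V F)" for i
      by (rule continuous_on_eq[OF continuous_on_norm[OF cont]]) (simp add: eq)
  qed
qed

lemma Cinf_on_empty: "Cinf_on {} f"
proof -
  have "Ck_on k {} f" for k :: nat and f :: "'a \<Rightarrow> 'b"
    by (induction k arbitrary: f) (auto simp: Ck_on.simps(2))
  then show ?thesis by (intro Cinf_on_I) auto
qed

section \<open>The \<open>\<int>\<^sub>2\<close> harmonic function\<close>

context oriented_hyperbola
begin

text \<open>The square of \<open>w\<close>, just as \<open>rho\<close> is the square of \<open>u\<close>.\<close>

definition omega :: "real^3 \<Rightarrow> real" where "omega x = psi x (rho x)"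

text \<open>Two trivializing sets: \<open>w \<noteq> 0\<close> with the choice \<open>w > 0\<close>, and \<open>u \<noteq> 0\<close> with the choice \<open>u > 0\<close>. The other
  indices are filled up with empty sets.\<close>

definition V :: "nat \<Rightarrow> (real^3) set" where
  "V i = (if i = 0 then {x \<in> U. omega x > 0} else if i = 1 then {x \<in> U. rho x > 0} else {})"

definition ub :: "nat \<Rightarrow> real^3 \<Rightarrow> real" where
  "ub i x = (if i = 0 then X2 x / sqrt (omega x) else sqrt (rho x))"

definition wb :: "nat \<Rightarrow> real^3 \<Rightarrow> real" where
  "wb i x = (if i = 0 then sqrt (omega x) else X2 x / sqrt (rho x))"

definition trans_fun :: "nat \<Rightarrow> nat \<Rightarrow> real^3 \<Rightarrow> real" where
  "trans_fun i j x = (if i = j then 1 else sgn (X2 x))"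

definition f :: "nat \<Rightarrow> real^3 \<Rightarrow> real" where "f i x = potential x (ub i x) (wb i x)"

lemma rho_U:
  assumes "x \<in> U" shows "0 \<le> rho x" "rho x < a" "0 \<le> omega x" "rho x * omega x = (X2 x)\<^sup>2" "c + rho x > 0"
  using rho[OF U_X1[OF assms]] c by (auto simp: omega_def)

lemma rho_U_nonzero: "x \<in> U \<Longrightarrow> a - rho x \<noteq> 0" "x \<in> U \<Longrightarrow> c + rho x \<noteq> 0"
  using rho_U[of x] by auto

lemma continuous_rho: "continuous_on U rho"
  by (rule continuous_on_subset[OF continuous_on_rho]) (auto simp: U_X1)

lemma continuous_omega: "continuous_on U omega"
  unfolding omega_def[abs_def] psi_def
  by (intro continuous_intros continuous_rho ballI rho_U_nonzero)

lemma V_cases: "x \<in> V i \<Longrightarrow> i = 0 \<or> i = 1"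
  by (auto simp: V_def split: if_splits)

lemma V_subset: "V i \<subseteq> U - H"
proof
  fix x assume "x \<in> V i"
  then have x: "x \<in> U" "\<not> (rho x = 0 \<and> omega x = 0)" by (auto simp: V_def split: if_splits)
  then show "x \<in> U - H" using H_iff_rho[OF U_X1[OF x(1)]] by (simp add: omega_def)
qed

lemma V_cover: "(\<Union>i. V i) = U - H"
proof (intro equalityI subsetI)
  fix x assume x: "x \<in> U - H"
  then have xU: "x \<in> U" by simp
  have "rho x \<noteq> 0 \<or> omega x \<noteq> 0" using H_iff_rho[OF U_X1[OF xU]] x by (simp add: omega_def)
  then have "x \<in> V 0 \<or> x \<in> V 1" using rho_U(1,3)[OF xU] xU by (auto simp: V_def)
  then show "x \<in> (\<Union>i. V i)" by blast
qed (use V_subset in auto)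

lemma open_V: "open (V i)"
proof -
  have "open {x \<in> U. h x > 0}" if "continuous_on U h" for h :: "real^3 \<Rightarrow> real"
    using continuous_open_preimage[OF that open_U open_greaterThan[of 0]]
    by (simp add: vimage_def Int_def)
  then show ?thesis using continuous_rho continuous_omega by (simp add: V_def)
qed

lemma branch_V: "branch (V i) (ub i) (wb i)"
proof -
  have sub: "V i \<subseteq> {x. X1 x \<noteq> 0} - H" using V_subset[of i] U_X1 by blast
  have rho': "Cinf_on (V i) rho" by (rule Cinf_on_subset[OF Cinf_rho open_V sub])
  have omega': "Cinf_on (V i) omega"
    unfolding omega_def[abs_def] psi_def
    by (intro Cinf_on_diff Cinf_on_divide Cinf_on_power Cinf_on_add Cinf_X Cinf_on_const rho' open_V
        rho_U_nonzero) (use V_subset[of i] in blast)+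
  consider "i = 0" | "i = 1" | "i > 1" by linarith
  then show ?thesis
  proof cases
    case 1
    have ub: "ub i = (\<lambda>x. X2 x / sqrt (omega x))" "wb i = (\<lambda>x. sqrt (omega x))"
      using 1 by (auto simp: ub_def wb_def)
    have pos: "omega x > 0" if "x \<in> V i" for x using that 1 by (simp add: V_def)
    show ?thesis unfolding branch_def ub
    proof (intro conjI ballI)
      show s: "Cinf_on (V i) (\<lambda>x. sqrt (omega x))" by (rule Cinf_on_sqrt[OF omega' pos])
      show "Cinf_on (V i) (\<lambda>x. X2 x / sqrt (omega x))"
      proof (rule Cinf_on_divide[OF Cinf_X(2)[OF open_V] s])
        show "sqrt (omega x) \<noteq> 0" if "x \<in> V i" for x using pos[OF that] by simp
      qed
      fix x assume x: "x \<in> V i"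
      then have "x \<in> U" using V_subset by blast
      note r = rho_U[OF this] and p = pos[OF x]
      show "X1 x \<noteq> 0" "x \<notin> H" using sub x by auto
      have *: "(X2 x / sqrt (omega x))\<^sup>2 = rho x" using r(4) p by (simp add: power_divide field_simps)
      then show "(X2 x / sqrt (omega x))\<^sup>2 < a" using r by simp
      show "X2 x / sqrt (omega x) * sqrt (omega x) = X2 x" using p by simp
      show "(sqrt (omega x))\<^sup>2 = psi x ((X2 x / sqrt (omega x))\<^sup>2)" unfolding * using r by (simp add: omega_def)
    qed
  next
    case 2
    have ub: "ub i = (\<lambda>x. sqrt (rho x))" "wb i = (\<lambda>x. X2 x / sqrt (rho x))"
      using 2 by (auto simp: ub_def wb_def)
    have pos: "rho x > 0" if "x \<in> V i" for x using that 2 by (simp add: V_def)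
    show ?thesis unfolding branch_def ub
    proof (intro conjI ballI)
      show s: "Cinf_on (V i) (\<lambda>x. sqrt (rho x))" by (rule Cinf_on_sqrt[OF rho' pos])
      show "Cinf_on (V i) (\<lambda>x. X2 x / sqrt (rho x))"
      proof (rule Cinf_on_divide[OF Cinf_X(2)[OF open_V] s])
        show "sqrt (rho x) \<noteq> 0" if "x \<in> V i" for x using pos[OF that] by simp
      qed
      fix x assume x: "x \<in> V i"
      then have "x \<in> U" using V_subset by blast
      note r = rho_U[OF this] and p = pos[OF x]
      show "X1 x \<noteq> 0" "x \<notin> H" using sub x by auto
      show "(sqrt (rho x))\<^sup>2 < a" using r by simp
      show "sqrt (rho x) * (X2 x / sqrt (rho x)) = X2 x" using p by simp
      have "(X2 x / sqrt (rho x))\<^sup>2 = omega x" using r(4) p by (simp add: power_divide field_simps)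
      then show "(X2 x / sqrt (rho x))\<^sup>2 = psi x ((sqrt (rho x))\<^sup>2)" using r by (simp add: omega_def)
    qed
  next
    case 3
    then show ?thesis by (auto simp: branch_def V_def Cinf_on_empty)
  qed
qed

text \<open>Since \<open>u w = X2\<close>, on the overlap the two choices of sign differ by the sign of \<open>X2\<close>.\<close>

lemma overlap:
  assumes "x \<in> V 0" "x \<in> V 1"
  shows "X2 x \<noteq> 0" "X2 x / sqrt (omega x) = sgn (X2 x) * sqrt (rho x)"
    "sqrt (omega x) = sgn (X2 x) * (X2 x / sqrt (rho x))"
    "sqrt (rho x) = sgn (X2 x) * (X2 x / sqrt (omega x))"
    "X2 x / sqrt (rho x) = sgn (X2 x) * sqrt (omega x)"
proof -
  have pos: "rho x > 0" "omega x > 0" and x: "x \<in> U" using assms by (simp_all add: V_def)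
  have e: "sqrt (rho x) * sqrt (omega x) = \<bar>X2 x\<bar>"
    using rho_U(4)[OF x] by (simp flip: real_sqrt_mult)
  then show ne: "X2 x \<noteq> 0" using pos by auto
  define r o' where "r = sqrt (rho x)" and "o' = sqrt (omega x)"
  have r: "r > 0" "o' > 0" "r * o' = \<bar>X2 x\<bar>" using pos e by (simp_all add: r_def o'_def)
  have x2: "X2 x = sgn (X2 x) * (r * o')" using ne r by (simp add: sgn_if)
  have ss: "sgn (X2 x) * (sgn (X2 x) * k) = k" for k using ne by (simp add: sgn_if)
  have "X2 x / o' = sgn (X2 x) * r" "X2 x / r = sgn (X2 x) * o'"
    using r(1,2) x2 by (metis nonzero_mult_div_cancel_right mult.assoc less_irrefl,
        metis nonzero_mult_div_cancel_right mult.assoc mult.commute less_irrefl)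
  then show "X2 x / sqrt (omega x) = sgn (X2 x) * sqrt (rho x)"
    "sqrt (omega x) = sgn (X2 x) * (X2 x / sqrt (rho x))"
    "sqrt (rho x) = sgn (X2 x) * (X2 x / sqrt (omega x))"
    "X2 x / sqrt (rho x) = sgn (X2 x) * sqrt (omega x)"
    unfolding r_def[symmetric] o'_def[symmetric] using ne by (simp_all add: ss)
qed

lemma transition:
  assumes "x \<in> V i \<inter> V j"
  shows "ub i x = trans_fun i j x * ub j x" "wb i x = trans_fun i j x * wb j x"
    and trans_fun_sign: "trans_fun i j x \<in> {1, -1}"
proof -
  consider "i = j" | "i = 0" "j = 1" | "i = 1" "j = 0"
    using V_cases[of x i] V_cases[of x j] assms by blast
  then have "ub i x = trans_fun i j x * ub j x \<and> wb i x = trans_fun i j x * wb j x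
      \<and> trans_fun i j x \<in> {1, -1}"
  proof cases
    case 2
    then have o: "x \<in> V 0" "x \<in> V 1" using assms by auto
    have "ub i x = trans_fun i j x * ub j x" "wb i x = trans_fun i j x * wb j x"
      using 2 overlap(2,3)[OF o] by (simp_all add: trans_fun_def ub_def wb_def)
    then show ?thesis using 2 overlap(1)[OF o] by (simp add: trans_fun_def sgn_if)
  next
    case 3
    then have o: "x \<in> V 0" "x \<in> V 1" using assms by auto
    have "ub i x = trans_fun i j x * ub j x" "wb i x = trans_fun i j x * wb j x"
      using 3 overlap(4,5)[OF o] by (simp_all add: trans_fun_def ub_def wb_def)
    then show ?thesis using 3 overlap(1)[OF o] by (simp add: trans_fun_def sgn_if)
  qed (simp add: trans_fun_def)
  then show "ub i x = trans_fun i j x * ub j x" "wb i x = trans_fun i j x * wb j x"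
    "trans_fun i j x \<in> {1, -1}" by blast+
qed

lemma flat_bundle: "flat_Z2_bundle (U - H) V trans_fun"
  unfolding flat_Z2_bundle_def
proof (intro conjI allI ballI)
  show "open (V i)" for i by (rule open_V)
  show "(\<Union>i. V i) = U - H" by (rule V_cover)
  show sgn: "trans_fun i j x \<in> {1, -1}" if "x \<in> V i \<inter> V j" for i j x using trans_fun_sign[OF that] .
  show "continuous_on (V i \<inter> V j) (trans_fun i j)" for i j
  proof (cases "i = j")
    case False
    have "X2 x \<noteq> 0" if "x \<in> V i \<inter> V j" for x using sgn[OF that] False by (auto simp: trans_fun_def)
    then have "continuous_on (V i \<inter> V j) (\<lambda>x. sgn (X2 x))"
      by (intro continuous_on_sgn continuous_X) auto
    with False show ?thesis by (simp add: trans_fun_def[abs_def])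
  qed (simp add: trans_fun_def[abs_def])
  show "trans_fun i j x * trans_fun j k x = trans_fun i k x" if x: "x \<in> V i \<inter> V j \<inter> V k" for i j k x
  proof (cases "i = j \<or> j = k")
    case False
    then have "i = k" using x V_cases[of x i] V_cases[of x j] V_cases[of x k] by auto
    with False show ?thesis using sgn[of x i j] x by (auto simp: trans_fun_def)
  qed (auto simp: trans_fun_def)
qed

lemma potential_odd: "s \<in> {1, -1} \<Longrightarrow> potential x (s * u) (s * w) = s * potential x u w"
  by (auto simp: potential_def)

lemma section_f: "bundle_section V trans_fun f"
  unfolding bundle_section_def
proof (intro allI ballI)
  fix i j x assume x: "x \<in> V i \<inter> V j"
  show "f i x = trans_fun i j x *\<^sub>R f j x"
    using arg_cong2[OF transition(1,2)[OF x], of "potential x"] potential_odd[OF trans_fun_sign[OF x]]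
    unfolding f_def by simp
qed

lemma gradient_f:
  assumes "x \<in> V i"
  shows "gradient (f i) x = (- 2 * X1 x * K1 (ub i x)) *\<^sub>R u1
      + (2 * X2 x * (K1 (ub i x) - K3 (ub i x)) - 2 * wb i x * I (ub i x)) *\<^sub>R u2 + (2 * X3 x * K3 (ub i x)) *\<^sub>R u3"
    and "laplacian (f i) x = 0"
  using potential_gradient_harmonic[OF branch_V assms] by (simp_all add: f_def[abs_def])

lemma section_gradient: "bundle_section V trans_fun (\<lambda>i. gradient (f i))"
  unfolding bundle_section_def
proof (intro allI ballI)
  fix i j x assume x: "x \<in> V i \<inter> V j"
  define G where "G u w = (- 2 * X1 x * K1 u) *\<^sub>R u1
      + (2 * X2 x * (K1 u - K3 u) - 2 * w * I u) *\<^sub>R u2 + (2 * X3 x * K3 u) *\<^sub>R u3" for u w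
  have "G (s * u) (s * w) = s *\<^sub>R G u w" if "s \<in> {1, -1}" for s u w
    using that by (auto simp: G_def algebra_simps)
  moreover have "gradient (f i) x = G (ub i x) (wb i x)" "gradient (f j) x = G (ub j x) (wb j x)"
    using x gradient_f(1)[of x i] gradient_f(1)[of x j] by (simp_all add: G_def)
  ultimately show "gradient (f i) x = trans_fun i j x *\<^sub>R gradient (f j) x"
    using arg_cong2[OF transition(1,2)[OF x], of G] trans_fun_sign[OF x] by simp
qed

lemma ub_wb_abs:
  assumes "x \<in> V i"
  shows "\<bar>ub i x\<bar> = sqrt (rho x)" "\<bar>wb i x\<bar> = sqrt (omega x)"
  using branch_rho[OF branch_V assms] by (simp_all add: omega_def)

lemma K_abs: "\<bar>K0 \<bar>u\<bar>\<bar> = \<bar>K0 u\<bar>" "\<bar>K1 \<bar>u\<bar>\<bar> = \<bar>K1 u\<bar>" "\<bar>K3 \<bar>u\<bar>\<bar> = \<bar>K3 u\<bar>" "I \<bar>u\<bar> = I u"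
  by (simp_all add: abs_if)

lemma continuous_K_rho:
  assumes "Cinf_on {u. u\<^sup>2 < a} K" shows "continuous_on U (\<lambda>x. K (sqrt (rho x)))"
proof (rule continuous_on_compose2[OF Cinf_on_D(3)[OF assms] continuous_on_real_sqrt[OF continuous_rho]])
  show "(\<lambda>x. sqrt (rho x)) ` U \<subseteq> {u. u\<^sup>2 < a}" using rho_U by auto
qed

lemmas continuous_K = continuous_K_rho[OF Cinf_K(1)] continuous_K_rho[OF Cinf_K(2)]
  continuous_K_rho[OF Cinf_K(3)] continuous_K_rho[OF Cinf_I]

text \<open>The absolute values of \<open>u\<close> and \<open>w\<close> extend continuously across the hyperbola as \<open>sqrt rho\<close> and
  \<open>sqrt omega\<close>. They bound \<open>f\<close> and, since its gradient does not involve the derivatives of \<open>u\<close> and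
  \<open>w\<close>, also the gradient.\<close>

lemma f_square_integrable: "locally_square_integrable U H (section_norm V f)"
proof (rule locally_square_integrable_bounded[OF open_U closed_H])
  show "continuous_on (U - H) (section_norm V f)"
    by (rule section_norm_continuous(2)[OF flat_bundle section_f])
      (use Cinf_on_D(3)[OF Cinf_potential[OF branch_V]] in \<open>simp add: f_def[abs_def]\<close>)
  let ?r = "\<lambda>x. sqrt (rho x)"
  let ?N = "\<lambda>x. \<bar>K0 (?r x)\<bar> + ((X2 x)\<^sup>2 + (X1 x)\<^sup>2) * \<bar>K1 (?r x)\<bar> + ((X3 x)\<^sup>2 + (X2 x)\<^sup>2) * \<bar>K3 (?r x)\<bar>
    + \<bar>X2 x\<bar> * sqrt (omega x) * \<bar>I (?r x)\<bar>"
  show "continuous_on U ?N" by (intro continuous_intros continuous_K continuous_omega)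
  fix x assume "x \<in> U - H"
  then obtain i where i: "x \<in> V i" using V_cover by blast
  have "\<bar>f i x\<bar> \<le> \<bar>K0 (ub i x)\<bar> + \<bar>((X2 x)\<^sup>2 - (X1 x)\<^sup>2) * K1 (ub i x)\<bar> + \<bar>((X3 x)\<^sup>2 - (X2 x)\<^sup>2) * K3 (ub i x)\<bar>
      + \<bar>X2 x * wb i x * I (ub i x)\<bar>"
    unfolding f_def potential_def by linarith
  also have "\<dots> \<le> \<bar>K0 (ub i x)\<bar> + ((X2 x)\<^sup>2 + (X1 x)\<^sup>2) * \<bar>K1 (ub i x)\<bar> + ((X3 x)\<^sup>2 + (X2 x)\<^sup>2) * \<bar>K3 (ub i x)\<bar>
      + \<bar>X2 x\<bar> * \<bar>wb i x\<bar> * \<bar>I (ub i x)\<bar>"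
    unfolding abs_mult by (intro add_mono mult_right_mono order_refl) (auto simp: abs_le_iff)
  also have "\<dots> = ?N x" by (simp only: ub_wb_abs[OF i, symmetric] K_abs)
  finally show "\<bar>section_norm V f x\<bar> \<le> ?N x"
    using section_norm_continuous(1)[OF flat_bundle section_f i] by simp
qed

lemma gradient_square_integrable: "locally_square_integrable U H (section_norm V (\<lambda>i. gradient (f i)))"
proof (rule locally_square_integrable_bounded[OF open_U closed_H])
  have cont: "continuous_on (V i) (gradient (f i))" for i
  proof -
    note b = branchD[OF branch_V[of i]]
    have K: "continuous_on (V i) (\<lambda>x. K (ub i x))" if "Cinf_on {u. u\<^sup>2 < a} K" for K
      by (rule Cinf_on_D(3)[OF Cinf_on_compose[OF that b(2)]]) (use b(6) in auto)
    show ?thesis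
      by (rule continuous_on_eq[OF _ gradient_f(1)[symmetric]])
        (intro continuous_intros K[OF Cinf_K(2)] K[OF Cinf_K(3)] K[OF Cinf_I] Cinf_on_D(3)[OF b(3)])
  qed
  show "continuous_on (U - H) (section_norm V (\<lambda>i. gradient (f i)))"
    by (rule section_norm_continuous(2)[OF flat_bundle section_gradient cont])
  let ?r = "\<lambda>x. sqrt (rho x)"
  let ?N = "\<lambda>x. 2 * \<bar>X1 x\<bar> * \<bar>K1 (?r x)\<bar> + (2 * \<bar>X2 x\<bar> * (\<bar>K1 (?r x)\<bar> + \<bar>K3 (?r x)\<bar>) + 2 * sqrt (omega x) * \<bar>I (?r x)\<bar>)
    + 2 * \<bar>X3 x\<bar> * \<bar>K3 (?r x)\<bar>"
  show "continuous_on U ?N" by (intro continuous_intros continuous_K continuous_omega)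
  fix x assume "x \<in> U - H"
  then obtain i where i: "x \<in> V i" using V_cover by blast
  have nu: "norm u1 = 1" "norm u2 = 1" "norm u3 = 1" by (simp_all add: norm_eq_sqrt_inner)
  have "norm (gradient (f i) x) \<le> \<bar>- 2 * X1 x * K1 (ub i x)\<bar>
      + \<bar>2 * X2 x * (K1 (ub i x) - K3 (ub i x)) - 2 * wb i x * I (ub i x)\<bar> + \<bar>2 * X3 x * K3 (ub i x)\<bar>"
    unfolding gradient_f(1)[OF i]
    by (intro norm_triangle_le add_mono) (simp_all add: nu)
  also have "\<dots> \<le> 2 * \<bar>X1 x\<bar> * \<bar>K1 (ub i x)\<bar> + (2 * \<bar>X2 x\<bar> * (\<bar>K1 (ub i x)\<bar> + \<bar>K3 (ub i x)\<bar>)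
      + 2 * \<bar>wb i x\<bar> * \<bar>I (ub i x)\<bar>) + 2 * \<bar>X3 x\<bar> * \<bar>K3 (ub i x)\<bar>"
  proof (intro add_mono)
    have "\<bar>2 * X2 x * (K1 (ub i x) - K3 (ub i x)) - 2 * wb i x * I (ub i x)\<bar>
      \<le> \<bar>2 * X2 x * (K1 (ub i x) - K3 (ub i x))\<bar> + \<bar>2 * wb i x * I (ub i x)\<bar>" by (rule abs_triangle_ineq4)
    also have "\<dots> \<le> 2 * \<bar>X2 x\<bar> * (\<bar>K1 (ub i x)\<bar> + \<bar>K3 (ub i x)\<bar>) + 2 * \<bar>wb i x\<bar> * \<bar>I (ub i x)\<bar>"
      unfolding abs_mult by (intro add_mono mult_mono abs_triangle_ineq4) auto
    finally show "\<bar>2 * X2 x * (K1 (ub i x) - K3 (ub i x)) - 2 * wb i x * I (ub i x)\<bar>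
      \<le> 2 * \<bar>X2 x\<bar> * (\<bar>K1 (ub i x)\<bar> + \<bar>K3 (ub i x)\<bar>) + 2 * \<bar>wb i x\<bar> * \<bar>I (ub i x)\<bar>" .
  qed (simp_all add: abs_mult)
  also have "\<dots> = ?N x" by (simp only: ub_wb_abs[OF i, symmetric] K_abs)
  finally show "\<bar>section_norm V (\<lambda>i. gradient (f i)) x\<bar> \<le> ?N x"
    using section_norm_continuous(1)[OF flat_bundle section_gradient i] by simp
qed

text \<open>The exact square root of \<open>zeta\<close> near the hyperbola, as a section of the bundle.\<close>

definition sigma :: "nat \<Rightarrow> real^3 \<Rightarrow> complex" where
  "sigma i x = (let s = approx_root (wb i x) x (ub i x) in s * csqrt (zeta x / s\<^sup>2))"

text \<open>The coefficient \<open>B\<close> is \<open>\<i>\<close> times this number. The factor \<open>eps\<close> comes from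
  \<open>Im (w + \<i> eps m u)\<^sup>3 = eps m (3 u w\<^sup>2 - m\<^sup>2 u\<^sup>3)\<close>.\<close>

definition coeff :: "real^3 \<Rightarrow> real" where
  "coeff q = eps q * (2 * J 0 / (3 * slope q)) * sqrt (2 * slope q) ^ 3"

lemma J_pos: "J 0 > 0" using a c by (simp add: J_def)

lemma eventually_order_ge:
  assumes "order_ge (at q within S) d n h"
  obtains C where "C > 0" "\<forall>\<^sub>F x in at q. x \<in> S \<longrightarrow> \<bar>h x\<bar> \<le> C * \<bar>d x\<bar> ^ n"
proof -
  obtain C where "C > 0" "\<forall>\<^sub>F x in at q within S. norm (h x) \<le> C * norm (d x ^ n)"
    using assms unfolding order_ge_def by (rule landau_o.bigE)
  then have "C > 0" "\<forall>\<^sub>F x in at q. x \<in> S \<longrightarrow> \<bar>h x\<bar> \<le> C * \<bar>d x\<bar> ^ n"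
    by (simp_all add: eventually_at_filter power_abs)
  then show thesis by (rule that)
qed

text \<open>The two bounds of \<open>branch_estimates\<close> at a single point, with one constant for both.\<close>

definition estimates_at :: "nat \<Rightarrow> real \<Rightarrow> real^3 \<Rightarrow> bool" where
  "estimates_at i C x \<longleftrightarrow>
    norm ((approx_root (wb i x) x (ub i x))\<^sup>2 - 2 * of_real (slope (proj x)) * zeta x) \<le> C * (norm (zeta x))\<^sup>2 \<and>
    \<bar>f i x + 2 * J 0 / 3 * (3 * ub i x * (wb i x)\<^sup>2 - (slope (proj x))\<^sup>2 * (ub i x) ^ 3)\<bar> \<le> C * sqrt_dist x ^ 5"

lemma sqrt_dist_nonneg: "0 \<le> sqrt_dist x" and sqrt_dist_power4: "sqrt_dist x ^ 4 = (norm (zeta x))\<^sup>2"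
proof -
  have "sqrt_dist x ^ 4 = ((sqrt_dist x)\<^sup>2)\<^sup>2" by (simp flip: power_mult)
  then show "sqrt_dist x ^ 4 = (norm (zeta x))\<^sup>2" by (simp add: sqrt_dist_def)
qed (simp add: sqrt_dist_def)

lemma estimates_at_mono:
  assumes "estimates_at i C x" "C \<le> C'" shows "estimates_at i C' x"
proof -
  have "C * (norm (zeta x))\<^sup>2 \<le> C' * (norm (zeta x))\<^sup>2" "C * sqrt_dist x ^ 5 \<le> C' * sqrt_dist x ^ 5"
    using assms(2) sqrt_dist_nonneg[of x] by (auto intro!: mult_right_mono)
  with assms(1) show ?thesis unfolding estimates_at_def by linarith
qed

lemma estimates_near:
  assumes q: "q \<in> H" shows "\<exists>C>0. \<forall>\<^sub>F x in at q. x \<in> V i \<longrightarrow> estimates_at i C x"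
proof -
  have VU: "V i \<subseteq> U" using V_subset by blast
  note E = branch_estimates[OF branch_V VU q]
  obtain C1 where C1: "C1 > 0" "\<forall>\<^sub>F x in at q. x \<in> V i \<longrightarrow>
      \<bar>norm ((approx_root (wb i x) x (ub i x))\<^sup>2 - 2 * of_real (slope (proj x)) * zeta x)\<bar> \<le> C1 * \<bar>sqrt_dist x\<bar> ^ 4"
    by (rule eventually_order_ge[OF E(1)])
  obtain C2 where C2: "C2 > 0" "\<forall>\<^sub>F x in at q. x \<in> V i \<longrightarrow>
      \<bar>potential x (ub i x) (wb i x)
      + 2 * J 0 / 3 * (3 * ub i x * (wb i x)\<^sup>2 - (slope (proj x))\<^sup>2 * (ub i x) ^ 3)\<bar> \<le> C2 * \<bar>sqrt_dist x\<bar> ^ 5"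
    by (rule eventually_order_ge[OF E(2)])
  have "\<forall>\<^sub>F x in at q. x \<in> V i \<longrightarrow> estimates_at i (C1 + C2) x"
    using C1(2) C2(2)
  proof eventually_elim
    case (elim x)
    have m: "C1 * (norm (zeta x))\<^sup>2 \<le> (C1 + C2) * (norm (zeta x))\<^sup>2" "C2 * sqrt_dist x ^ 5 \<le> (C1 + C2) * sqrt_dist x ^ 5"
      using C1(1) C2(1) sqrt_dist_nonneg[of x] by (auto intro!: mult_right_mono)
    show ?case
    proof
      assume "x \<in> V i"
      with elim have e: "norm ((approx_root (wb i x) x (ub i x))\<^sup>2 - 2 * of_real (slope (proj x)) * zeta x) \<le> C1 * (norm (zeta x))\<^sup>2"
        "\<bar>f i x + 2 * J 0 / 3 * (3 * ub i x * (wb i x)\<^sup>2 - (slope (proj x))\<^sup>2 * (ub i x) ^ 3)\<bar> \<le> C2 * sqrt_dist x ^ 5"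
        by (simp_all add: sqrt_dist_nonneg sqrt_dist_power4 f_def)
      show "estimates_at i (C1 + C2) x"
        unfolding estimates_at_def using order_trans[OF e(1) m(1)] order_trans[OF e(2) m(2)] by blast
    qed
  qed
  then show ?thesis using C1(1) C2(1) by (intro exI[of _ "C1 + C2"]) simp
qed

lemma local_estimates:
  assumes q: "q \<in> H"
  shows "\<exists>r C. r > 0 \<and> C > 0 \<and> ball q r \<subseteq> U \<and>
    (\<forall>x\<in>ball q r. slope q / 2 < slope (proj x) \<and> C * norm (zeta x) \<le> slope (proj x)) \<and>
    (\<forall>i. \<forall>x\<in>V i \<inter> ball q r. estimates_at i C x)"
proof -
  have qU: "q \<in> U" using q H_subset_U by blast
  obtain C0 where C0: "C0 > 0" "\<forall>\<^sub>F x in at q. x \<in> V 0 \<longrightarrow> estimates_at 0 C0 x"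
    using estimates_near[OF q] by blast
  obtain C1 where C1: "C1 > 0" "\<forall>\<^sub>F x in at q. x \<in> V 1 \<longrightarrow> estimates_at 1 C1 x"
    using estimates_near[OF q] by blast
  define C where "C = C0 + C1"
  have C: "C > 0" "C0 \<le> C" "C1 \<le> C" using C0(1) C1(1) by (simp_all add: C_def)
  have sq: "slope q > 0" using slope_pos[OF X1_nonzero_on_H[OF q]] .
  have cont: "continuous_on U (\<lambda>x. slope (proj x) - C * norm (zeta x))" "continuous_on U (\<lambda>x. slope (proj x))"
    by (intro continuous_intros Cinf_on_D(3)[OF Cinf_slope_proj] Cinf_on_D(3)[OF Cinf_zeta])+
  have z0: "zeta q = 0" "proj q = q" using zeta_eq_0[OF qU] q proj_on_H by auto
  have lim: "(h \<longlongrightarrow> h q) (at q)" if "continuous_on U h" for h :: "real^3 \<Rightarrow> real"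
    using that open_U qU by (simp add: continuous_on_eq_continuous_at continuous_at)
  have "\<forall>\<^sub>F x in at q. slope q / 2 < slope (proj x)" "\<forall>\<^sub>F x in at q. 0 < slope (proj x) - C * norm (zeta x)"
    using order_tendstoD(1)[OF lim[OF cont(2)], of "slope q / 2"] order_tendstoD(1)[OF lim[OF cont(1)], of 0] sq z0
    by simp_all
  moreover have "\<forall>\<^sub>F x in at q. x \<in> U" using eventually_at_in_open'[OF open_U qU] .
  ultimately have "\<forall>\<^sub>F x in at q. x \<in> U \<and> slope q / 2 < slope (proj x) \<and> C * norm (zeta x) \<le> slope (proj x) \<and>
    (\<forall>i. x \<in> V i \<longrightarrow> estimates_at i C x)"
    using C0(2) C1(2)
  proof eventually_elim
    case (elim x)
    have "estimates_at i C x" if "x \<in> V i" for i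
      using V_cases[OF that] elim(4,5) that estimates_at_mono[OF _ C(2)] estimates_at_mono[OF _ C(3)] by blast
    then show ?case using elim(1,2,3) by simp
  qed
  then obtain r where r: "r > 0" and all: "\<And>x. x \<noteq> q \<Longrightarrow> dist x q < r \<Longrightarrow>
    x \<in> U \<and> slope q / 2 < slope (proj x) \<and> C * norm (zeta x) \<le> slope (proj x) \<and>
    (\<forall>i. x \<in> V i \<longrightarrow> estimates_at i C x)"
    unfolding eventually_at by blast
  have all': "x \<in> U \<and> slope q / 2 < slope (proj x) \<and> C * norm (zeta x) \<le> slope (proj x) \<and>
    (\<forall>i. x \<in> V i \<longrightarrow> estimates_at i C x)" if "x \<in> ball q r" for x
  proof (cases "x = q")
    case True
    then show ?thesis using z0 sq qU q V_subset by auto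
  next
    case False
    then show ?thesis using all[of x] that by (simp add: dist_commute)
  qed
  show ?thesis using r C(1) all' by (intro exI[of _ r] exI[of _ C]) auto
qed

lemma continuous_approx_root: "continuous_on (V i) (\<lambda>x. approx_root (wb i x) x (ub i x))"
proof -
  note b = branchD[OF branch_V[of i]]
  have "V i \<subseteq> U" "V i \<subseteq> {x. X1 x \<noteq> 0}" using V_subset[of i] U_X1 by auto
  then have "continuous_on (V i) (\<lambda>x. slope (proj x))" "continuous_on (V i) eps"
    using continuous_on_subset[OF Cinf_on_D(3)[OF Cinf_slope_proj]] continuous_on_subset[OF Cinf_on_D(3)[OF Cinf_eps]]
    by blast+
  then show ?thesis unfolding approx_root_def
    by (intro continuous_intros Cinf_on_D(3)[OF b(2)] Cinf_on_D(3)[OF b(3)])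
qed

lemma approx_root_transition:
  assumes "x \<in> V i \<inter> V j"
  shows "approx_root (wb i x) x (ub i x) = trans_fun i j x *\<^sub>R approx_root (wb j x) x (ub j x)"
  using arg_cong2[OF transition(2,1)[OF assms], of "\<lambda>w u. approx_root w x u"]
  by (simp add: approx_root_def complex_eq_iff)

lemma sigma_local:
  assumes est: "\<forall>i. \<forall>x\<in>V i \<inter> B. estimates_at i C x \<and> C * norm (zeta x) \<le> slope (proj x)"
  shows "continuous_on (V i \<inter> B) (sigma i)"
    and "x \<in> V i \<inter> B \<Longrightarrow> (sigma i x)\<^sup>2 = zeta x"
    and "x \<in> V i \<inter> V j \<inter> B \<Longrightarrow> sigma i x = trans_fun i j x *\<^sub>R sigma j x"
    and "x \<in> V i \<inter> B \<Longrightarrow> norm (approx_root (wb i x) x (ub i x) ^ 3 - (of_real (sqrt (2 * slope (proj x))) * sigma i x) ^ 3)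
        \<le> 10 * C * (norm (zeta x))\<^sup>2 * sqrt (slope (proj x) * norm (zeta x))"
proof -
  have S: "approx_root (wb i x) x (ub i x) \<noteq> 0" "zeta x / (approx_root (wb i x) x (ub i x))\<^sup>2 \<notin> \<real>\<^sub>\<le>\<^sub>0"
    "(sigma i x)\<^sup>2 = zeta x"
    "norm (approx_root (wb i x) x (ub i x) ^ 3 - (of_real (sqrt (2 * slope (proj x))) * sigma i x) ^ 3)
        \<le> 10 * C * (norm (zeta x))\<^sup>2 * sqrt (slope (proj x) * norm (zeta x))" if x: "x \<in> V i \<inter> B" for x i
  proof -
    have VB: "estimates_at i C x" "C * norm (zeta x) \<le> slope (proj x)" using est x by blast+
    have xU: "x \<in> U" and "x \<notin> H" using x V_subset[of i] by auto
    then have z: "zeta x \<noteq> 0" using zeta_eq_0[OF xU] by simp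
    have m: "slope (proj x) > 0" using slope_pos[OF X1_proj_nonzero[OF xU]] .
    note sr = square_root_close[OF m z conjunct1[OF VB(1)[unfolded estimates_at_def]] VB(2)]
    show "approx_root (wb i x) x (ub i x) \<noteq> 0" "zeta x / (approx_root (wb i x) x (ub i x))\<^sup>2 \<notin> \<real>\<^sub>\<le>\<^sub>0"
      by (rule sr(1), rule sr(2))
    show "(sigma i x)\<^sup>2 = zeta x" unfolding sigma_def Let_def by (rule sr(3))
    show "norm (approx_root (wb i x) x (ub i x) ^ 3 - (of_real (sqrt (2 * slope (proj x))) * sigma i x) ^ 3)
        \<le> 10 * C * (norm (zeta x))\<^sup>2 * sqrt (slope (proj x) * norm (zeta x))"
      unfolding sigma_def Let_def by (rule sr(4))
  qed
  then show "x \<in> V i \<inter> B \<Longrightarrow> (sigma i x)\<^sup>2 = zeta x"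
    "x \<in> V i \<inter> B \<Longrightarrow> norm (approx_root (wb i x) x (ub i x) ^ 3 - (of_real (sqrt (2 * slope (proj x))) * sigma i x) ^ 3)
        \<le> 10 * C * (norm (zeta x))\<^sup>2 * sqrt (slope (proj x) * norm (zeta x))" by blast+
  show "continuous_on (V i \<inter> B) (sigma i)"
  proof -
    have s: "continuous_on (V i \<inter> B) (\<lambda>x. approx_root (wb i x) x (ub i x))"
      by (rule continuous_on_subset[OF continuous_approx_root]) auto
    have z: "continuous_on (V i \<inter> B) zeta"
      by (rule continuous_on_subset[OF Cinf_on_D(3)[OF Cinf_zeta]]) (use V_subset[of i] in auto)
    have d: "continuous_on (V i \<inter> B) (\<lambda>x. zeta x / (approx_root (wb i x) x (ub i x))\<^sup>2)"
      using S(1) by (intro continuous_on_divide z continuous_on_power s) auto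
    have "continuous_on (V i \<inter> B) (\<lambda>x. csqrt (zeta x / (approx_root (wb i x) x (ub i x))\<^sup>2))"
      by (rule continuous_on_compose2[OF continuous_on_csqrt d]) (use S(2) in auto)
    then show ?thesis unfolding sigma_def[abs_def] Let_def by (intro continuous_on_mult s)
  qed
  assume x: "x \<in> V i \<inter> V j \<inter> B"
  then have "x \<in> V i \<inter> V j" by blast
  from approx_root_transition[OF this] trans_fun_sign[OF this]
  show "sigma i x = trans_fun i j x *\<^sub>R sigma j x" unfolding sigma_def Let_def by auto
qed

lemma monodromy: "monodromy_minus_one_around U H \<tau> V trans_fun"
  unfolding monodromy_minus_one_around_def
proof (rule exI[of _ normal], rule exI[of _ U], rule exI[of _ proj], rule exI[of _ zeta], intro conjI ballI)
  show "tubular_neighbourhood U H \<tau> normal U proj zeta" by (rule tubular)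
  fix q assume q: "q \<in> H"
  from local_estimates[OF q] obtain r C where r: "r > 0" "C > 0" "ball q r \<subseteq> U"
    "\<forall>x\<in>ball q r. slope q / 2 < slope (proj x) \<and> C * norm (zeta x) \<le> slope (proj x)"
    "\<forall>i. \<forall>x\<in>V i \<inter> ball q r. estimates_at i C x"
    by blast
  have VB: "\<forall>i. \<forall>x\<in>V i \<inter> ball q r. estimates_at i C x \<and> C * norm (zeta x) \<le> slope (proj x)"
    using r(4,5) by blast
  note sg = sigma_local[OF VB]
  show "\<exists>\<epsilon>>0. ball q \<epsilon> \<subseteq> U \<and>
      (\<forall>\<gamma>. path \<gamma> \<and> pathfinish \<gamma> = pathstart \<gamma> \<and> path_image \<gamma> \<subseteq> ball q \<epsilon> - H \<and>
           winding_number (zeta \<circ> \<gamma>) 0 \<in> {1, -1} \<longrightarrow> has_monodromy V trans_fun \<gamma> (-1))"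
  proof (intro exI[of _ r] conjI allI impI r(1,3))
    fix \<gamma> assume g: "path \<gamma> \<and> pathfinish \<gamma> = pathstart \<gamma> \<and> path_image \<gamma> \<subseteq> ball q r - H \<and>
           winding_number (zeta \<circ> \<gamma>) 0 \<in> {1, -1}"
    show "has_monodromy V trans_fun \<gamma> (-1)"
    proof (rule has_monodromy_minus_one[where B = "ball q r" and \<sigma> = sigma and z = zeta])
      show "continuous_on (ball q r) zeta" by (rule continuous_on_subset[OF Cinf_on_D(3)[OF Cinf_zeta] r(3)])
      show "zeta x \<noteq> 0" if "x \<in> path_image \<gamma>" for x
        using zeta_eq_0[of x] that g r(3) by blast
      show "(sigma i x)\<^sup>2 = zeta x" if "x \<in> V i \<inter> ball q r" for i x by (rule sg(2)[OF that])
      show "sigma i x = trans_fun i j x *\<^sub>R sigma j x" if "x \<in> V i \<inter> V j \<inter> ball q r" for i j x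
        by (rule sg(3)[OF that])
      show "continuous_on (V i \<inter> ball q r) (sigma i)" for i by (rule sg(1))
    qed (use g in auto)
  qed
qed

lemma expansion:
  assumes q: "q \<in> H"
  obtains W where "open W" "q \<in> W" "W \<subseteq> U" "proj ` W \<subseteq> W"
    "expansion_on H \<tau> normal proj zeta V trans_fun f W (\<lambda>x. 0) (\<lambda>x. \<i> * of_real (coeff x))"
proof -
  from local_estimates[OF q] obtain r C where r: "r > 0" "C > 0" "ball q r \<subseteq> U"
    "\<forall>x\<in>ball q r. slope q / 2 < slope (proj x) \<and> C * norm (zeta x) \<le> slope (proj x)"
    "\<forall>i. \<forall>x\<in>V i \<inter> ball q r. estimates_at i C x"
    by blast
  have qs: "slope q > 0" using slope_pos[OF X1_nonzero_on_H[OF q]] .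
  \<comment> \<open>A ball need not be mapped into itself by the projection; this part of it is, since the
    projection is idempotent.\<close>
  define W where "W = ball q r \<inter> proj -` ball q r"
  have WB: "W \<subseteq> ball q r" and WU: "W \<subseteq> U" using r(3) by (auto simp: W_def)
  have "open W" unfolding W_def
    by (rule continuous_open_preimage[OF continuous_on_subset[OF Cinf_on_D(3)[OF Cinf_proj] r(3)]]) auto
  moreover have "q \<in> W" using r(1) proj_on_H[OF q] by (simp add: W_def)
  moreover have "proj ` W \<subseteq> W"
    using proj_on_H[OF proj_in_H] WU by (auto simp: W_def)
  moreover have "expansion_on H \<tau> normal proj zeta V trans_fun f W (\<lambda>x. 0) (\<lambda>x. \<i> * of_real (coeff x))"
    unfolding expansion_on_def
  proof (intro conjI)
    have c: "Cinf_on {x. X1 x \<noteq> 0} coeff" unfolding coeff_def[abs_def]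
      by (intro Cinf_on_mult Cinf_on_divide Cinf_on_power Cinf_on_sqrt Cinf_eps Cinf_slope Cinf_on_const open_X1_nonzero)
        (use slope_pos in force)+
    then have "Cinf_on {x. X1 x \<noteq> 0} (\<lambda>x. coeff x *\<^sub>R \<i>)"
      by (intro Cinf_on_scaleR Cinf_on_const open_X1_nonzero)
    then show "smooth_on (H \<inter> W) (\<lambda>x. \<i> * of_real (coeff x))"
      by (intro Cinf_on_imp_smooth_on[of "{x. X1 x \<noteq> 0}"])
        (auto simp: scaleR_conv_of_real mult.commute X1_nonzero_on_H)
    show "smooth_on (H \<inter> W) (\<lambda>x. 0::complex)"
      by (rule Cinf_on_imp_smooth_on[OF Cinf_on_const[OF open_UNIV]]) simp
    have VB: "\<forall>i. \<forall>x\<in>V i \<inter> W. estimates_at i C x \<and> C * norm (zeta x) \<le> slope (proj x)"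
      using r(4,5) WB by blast
    note sg = sigma_local[OF VB]
    define D where "D = C + 20 * J 0 * C / 3 / sqrt (slope q / 2)"
    show "\<exists>\<sigma> C. (\<forall>i. continuous_on (V i \<inter> W) (\<sigma> i) \<and> (\<forall>x\<in>V i \<inter> W. (\<sigma> i x)\<^sup>2 = zeta x)) \<and>
      bundle_section (\<lambda>i. V i \<inter> W) trans_fun \<sigma> \<and>
      (\<forall>i. \<forall>x\<in>V i \<inter> W.
        \<bar>f i x - (Re (0 * \<sigma> i x + \<i> * of_real (coeff (proj x)) * (\<sigma> i x)^3)
           - 1/2 * Re (cnj (frame_coordinate \<tau> normal (proj x) (mean_curvature_vector H \<tau> (proj x))) * zeta x)
                 * Re (0 * \<sigma> i x))\<bar> \<le> C * norm (zeta x) powr (5/2))"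
    proof (intro exI[of _ sigma] exI[of _ D] conjI allI ballI)
      show "continuous_on (V i \<inter> W) (sigma i)" for i by (rule sg(1))
      show "(sigma i x)\<^sup>2 = zeta x" if "x \<in> V i \<inter> W" for i x by (rule sg(2)[OF that])
      show "bundle_section (\<lambda>i. V i \<inter> W) trans_fun sigma"
        unfolding bundle_section_def using sg(3) by blast
      fix i x assume x: "x \<in> V i \<inter> W"
      then have xU: "x \<in> U" "x \<notin> H" "x \<in> ball q r \<inter> V i" using WU WB V_subset[of i] by auto
      define m e Z s k where "m = slope (proj x)" and "e = eps x" and "Z = norm (zeta x)"
        and "s = approx_root (wb i x) x (ub i x)" and "k = (of_real (sqrt (2 * m)) :: complex)"
      have est: "estimates_at i C x" using VB x by blast
      have Z: "Z > 0" using zeta_eq_0[OF xU(1)] xU(2) by (simp add: Z_def)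
      have m: "m > 0" "slope q / 2 < m" using r(4) xU(3) qs by (force simp: m_def)+
      have e: "e * e = 1" "\<bar>e\<bar> = 1" using eps by (simp_all add: e_def)
      have Im3: "Im (s ^ 3) = e * m * (3 * ub i x * (wb i x)\<^sup>2 - m\<^sup>2 * (ub i x) ^ 3)"
      proof -
        have "Im (s ^ 3) = 3 * (wb i x)\<^sup>2 * (e * m * ub i x) - (e * e) * (e * m ^ 3 * (ub i x) ^ 3)"
          by (simp add: s_def approx_root_def m_def e_def power3_eq_cube power2_eq_square algebra_simps)
        then show ?thesis unfolding e(1) by (simp add: algebra_simps power3_eq_cube power2_eq_square)
      qed
      have F1: "\<bar>f i x + 2 * J 0 / (3 * m) * e * Im (s ^ 3)\<bar> \<le> C * sqrt_dist x ^ 5"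
      proof -
        have "2 * J 0 / (3 * m) * e * Im (s ^ 3) = 2 * J 0 / 3 * (3 * ub i x * (wb i x)\<^sup>2 - m\<^sup>2 * (ub i x) ^ 3) * (e * e)"
          unfolding Im3 using m(1) by (simp add: field_simps)
        moreover have "\<bar>f i x + 2 * J 0 / 3 * (3 * ub i x * (wb i x)\<^sup>2 - m\<^sup>2 * (ub i x) ^ 3)\<bar> \<le> C * sqrt_dist x ^ 5"
          using est by (simp add: estimates_at_def m_def)
        ultimately show ?thesis by (simp only: e(1) mult_1_right)
      qed
      have F2: "Re (\<i> * of_real (coeff (proj x)) * (sigma i x)^3) = - (2 * J 0 / (3 * m) * e * Im ((k * sigma i x) ^ 3))"
      proof -
        have "(k * sigma i x) ^ 3 = of_real (sqrt (2 * m) ^ 3) * (sigma i x) ^ 3"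
          by (simp add: k_def power_mult_distrib)
        then have "Im ((k * sigma i x) ^ 3) = sqrt (2 * m) ^ 3 * Im ((sigma i x) ^ 3)"
          by (simp only: Re_complex_of_real Im_complex_of_real times_complex.sel mult_zero_left add_0_right)
        then show ?thesis by (simp add: coeff_def m_def e_def eps_proj[OF xU(1)])
      qed
      have F3: "\<bar>2 * J 0 / (3 * m) * e * Im (s ^ 3) - 2 * J 0 / (3 * m) * e * Im ((k * sigma i x) ^ 3)\<bar>
          \<le> 20 * J 0 * C / 3 / sqrt (slope q / 2) * sqrt_dist x ^ 5"
      proof -
        have "\<bar>2 * J 0 / (3 * m) * e * Im (s ^ 3) - 2 * J 0 / (3 * m) * e * Im ((k * sigma i x) ^ 3)\<bar>
          = 2 * J 0 / (3 * m) * \<bar>Im (s ^ 3 - (k * sigma i x) ^ 3)\<bar>"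
          using J_pos m(1) e(2) unfolding right_diff_distrib[symmetric] minus_complex.sel
          by (simp add: abs_mult)
        also have "\<dots> \<le> 2 * J 0 / (3 * m) * (10 * C * Z\<^sup>2 * sqrt (m * Z))"
          using sg(4)[OF x] J_pos m(1) order_trans[OF abs_Im_le_cmod]
          unfolding s_def k_def m_def Z_def by (intro mult_left_mono) (blast, simp)
        also have "\<dots> = 20 * J 0 * C / 3 * (Z\<^sup>2 * sqrt Z) / sqrt m"
          using m(1) by (simp add: real_sqrt_mult field_simps)
        also have "Z\<^sup>2 * sqrt Z = sqrt_dist x ^ 5"
        proof -
          have "sqrt_dist x ^ 5 = ((sqrt_dist x)\<^sup>2)\<^sup>2 * sqrt_dist x" by (simp add: eval_nat_numeral)
          then show ?thesis by (simp add: sqrt_dist_def Z_def)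
        qed
        also have "20 * J 0 * C / 3 * sqrt_dist x ^ 5 / sqrt m \<le> 20 * J 0 * C / 3 * sqrt_dist x ^ 5 / sqrt (slope q / 2)"
          using J_pos r(2) qs m by (intro divide_left_mono mult_nonneg_nonneg mult_pos_pos) (auto simp: sqrt_dist_def)
        finally show ?thesis by simp
      qed
      have r5: "sqrt_dist x ^ 5 = Z powr (5 / 2)"
        using Z by (simp add: sqrt_dist_def Z_def powr_power flip: powr_half_sqrt)
      have "\<bar>f i x - Re (\<i> * of_real (coeff (proj x)) * (sigma i x)^3)\<bar> \<le> D * sqrt_dist x ^ 5"
        using F1 F3 unfolding F2 D_def distrib_right by linarith
      then show "\<bar>f i x - (Re (0 * sigma i x + \<i> * of_real (coeff (proj x)) * (sigma i x)^3)
           - 1/2 * Re (cnj (frame_coordinate \<tau> normal (proj x) (mean_curvature_vector H \<tau> (proj x))) * zeta x)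
                 * Re (0 * sigma i x))\<bar> \<le> D * norm (zeta x) powr (5/2)"
        by (simp add: Z_def r5)
    qed
  qed
  ultimately show thesis using WU by (intro that)
qed

lemma coefficients_satisfy:
  assumes P: "\<And>q. q \<in> H \<Longrightarrow> P 0 (\<i> * of_real (coeff q))"
  shows "expansion_coefficients_satisfy P U H \<tau> V trans_fun f"
  unfolding expansion_coefficients_satisfy_def
proof (rule exI[of _ normal], rule exI[of _ U], rule exI[of _ proj], rule exI[of _ zeta], intro conjI ballI)
  show "tubular_neighbourhood U H \<tau> normal U proj zeta" by (rule tubular)
  fix q assume "q \<in> H"
  then obtain W where "open W" "q \<in> W" "W \<subseteq> U" "proj ` W \<subseteq> W"
    "expansion_on H \<tau> normal proj zeta V trans_fun f W (\<lambda>x. 0) (\<lambda>x. \<i> * of_real (coeff x))"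
    by (rule expansion)
  then show "\<exists>W A B. open W \<and> q \<in> W \<and> W \<subseteq> U \<and> proj ` W \<subseteq> W \<and>
      expansion_on H \<tau> normal proj zeta V trans_fun f W A B \<and> (\<forall>q\<in>H \<inter> W. P (A q) (B q))"
    using P by blast
qed

lemma nondegenerate_f: "nondegenerate U H \<tau> V trans_fun f"
  unfolding nondegenerate_def critical_def
proof
  show "expansion_coefficients_satisfy (\<lambda>a b. a = 0) U H \<tau> V trans_fun f"
    by (rule coefficients_satisfy) simp
  have "coeff q \<noteq> 0" if "q \<in> H" for q
    using slope_pos[OF X1_nonzero_on_H[OF that]] J_pos eps(1)[of q] by (auto simp: coeff_def)
  then show "expansion_coefficients_satisfy (\<lambda>a b. b \<noteq> 0) U H \<tau> V trans_fun f"
    by (intro coefficients_satisfy) simp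
qed

lemma Z2_harmonic_f: "Z2_harmonic_function U H \<tau> V trans_fun f"
  unfolding Z2_harmonic_function_def
proof (intro conjI allI ballI)
  show "open U" "oriented_curve H \<tau>" "flat_Z2_bundle (U - H) V trans_fun"
    "monodromy_minus_one_around U H \<tau> V trans_fun" "bundle_section V trans_fun f"
    "locally_square_integrable U H (section_norm V f)"
    "locally_square_integrable U H (section_norm V (\<lambda>i. gradient (f i)))"
    by (rule open_U oriented flat_bundle monodromy section_f f_square_integrable gradient_square_integrable)+
  show "closedin (top_of_set U) H" by (rule closed_subset[OF H_subset_U closed_H])
  show "smooth_on (V i) (f i)" for i
    using Cinf_on_imp_smooth_on[OF Cinf_potential[OF branch_V] order_refl] by (simp add: f_def[abs_def])
  show "laplacian (f i) x = 0" if "x \<in> V i" for i x by (rule gradient_f(2)[OF that])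
qed

end

section \<open>Planar hyperbolas are branching sets\<close>

theorem theorem1p7:
  fixes H :: "(real^3) set" and \<tau> :: "real^3 \<Rightarrow> real^3"
  assumes "planar_hyperbola H" and "oriented_curve H \<tau>"
  shows "\<exists>U (V :: nat \<Rightarrow> (real^3) set) g f.
           H \<subseteq> U \<and> Z2_harmonic_function U H \<tau> V g f \<and> nondegenerate U H \<tau> V g f"
proof -
  obtain h1 h3 p \<phi> where h: "h1 > 0" "h3 > 0" and \<phi>: "orthogonal_transformation \<phi>"
    and H: "H = (\<lambda>x. p + \<phi> x) ` standard_hyperbola h1 h3"
    using assms(1) unfolding planar_hyperbola_def by blast
  have inn: "\<phi> x \<bullet> \<phi> y = x \<bullet> y" for x y using \<phi> by (simp add: orthogonal_transformation_def)
  have lin: "linear \<phi>" using \<phi> by (simp add: orthogonal_transformation_def)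
  define u1 u2 u3 where "u1 = \<phi> (axis 1 1)" and "u2 = \<phi> (axis 2 1)" and "u3 = \<phi> (axis 3 1)"
  have \<phi>_expand: "\<phi> y = (y$1) *\<^sub>R u1 + (y$2) *\<^sub>R u2 + (y$3) *\<^sub>R u3" for y
  proof -
    have "y = (y$1) *\<^sub>R axis 1 1 + (y$2) *\<^sub>R axis 2 1 + (y$3) *\<^sub>R axis 3 1"
      by (simp add: vec_eq_iff forall_3 axis_def)
    from arg_cong[OF this, of \<phi>] show ?thesis
      unfolding u1_def u2_def u3_def linear_add[OF lin] linear_scale[OF lin] .
  qed
  have coord: "\<phi> y \<bullet> u1 = y$1" "\<phi> y \<bullet> u2 = y$2" "\<phi> y \<bullet> u3 = y$3" for y
    by (simp_all add: u1_def u2_def u3_def inn inner_axis)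
  interpret hc: hyperbola_coordinates p u1 u2 u3 "h1\<^sup>2" "h3\<^sup>2"
  proof
    show "x = (x \<bullet> u1) *\<^sub>R u1 + (x \<bullet> u2) *\<^sub>R u2 + (x \<bullet> u3) *\<^sub>R u3" for x
    proof -
      obtain y where y: "x = \<phi> y" using orthogonal_transformation_surj[OF \<phi>] by (metis surjD)
      show ?thesis unfolding y coord by (rule \<phi>_expand)
    qed
  qed (use h in \<open>simp_all add: u1_def u2_def u3_def inn inner_axis_axis\<close>)
  have XH: "hc.X1 (p + \<phi> y) = y$1" "hc.X2 (p + \<phi> y) = y$2" "hc.X3 (p + \<phi> y) = y$3" for y
    by (simp_all add: hc.X1_def hc.X2_def hc.X3_def coord)
  have "hc.H = (\<lambda>x. p + \<phi> x) ` standard_hyperbola h1 h3"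
  proof (intro equalityI subsetI)
    fix x assume x: "x \<in> hc.H"
    obtain y where y: "x - p = \<phi> y" using orthogonal_transformation_surj[OF \<phi>] by (metis surjD)
    then have xy: "x = p + \<phi> y" by (simp add: algebra_simps)
    then have "y \<in> standard_hyperbola h1 h3"
      using x by (simp add: hc.H_def standard_hyperbola_def XH)
    then show "x \<in> (\<lambda>x. p + \<phi> x) ` standard_hyperbola h1 h3" using xy by blast
  qed (auto simp: hc.H_def standard_hyperbola_def XH)
  then have hcH: "hc.H = H" using H by simp
  then have or: "oriented_curve hc.H \<tau>" using assms(2) by simp
  obtain ep em where e: "ep \<in> {1, -1}" "em \<in> {1, -1}"
    "\<forall>q\<in>hc.H. cross3 (\<tau> q) (hc.normal q) = (if hc.X1 q > 0 then ep else em) *\<^sub>R u2"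
    using hc.orientation_signs[OF or] by blast
  interpret oh: oriented_hyperbola p u1 u2 u3 "h1\<^sup>2" "h3\<^sup>2" \<tau> ep em
    by unfold_locales (use or e in auto)
  show ?thesis
    using hc.H_subset_U oh.Z2_harmonic_f oh.nondegenerate_f unfolding hcH by blast
qed

end
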